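(* Let $S$ be a countable set and let $\{X_t(1),X_t(2),\dots\}$ be a collection of independent continuous-time Markov chains on $S$ with identical jump rates. Set $\eta_t(x)=\sum_{i\ge 1}1_{\{X_t(i)=x\}}$ for $x\in S$, $t\ge 0$, and assume the process is well defined, i.e. $\eta_t(x)<\infty$ for all $x\in S$ and $t\ge 0$. Then the process $\{\eta_t;t\ge 0\}$ on $\{0,1,2,\dots\}^S$ preserves t-stability. Hence, if the distribution of $\eta_0$ is t-stable, then the distribution of $\eta_t$ is negatively associated for every $t\ge 0$.
   Context: Let $\mathbb{N}=\{0,1,2,\dots\}$. The process $\eta_t$ describes particles on $S$ jumping independently with the same jump rates: given the (possibly random) initial configuration $\eta_0$, with $\eta_0(x)$ particles at $x$, the particles evolve as independent Markov chains with common jump rates, and $\eta_t(x)$ is the number of particles at $x$ at time $t$. A polynomial $f\in\mathbb{C}[x_1,\dots,x_n]$ is stable if $f(x_1,\dots,x_n)\ne 0$ whenever $\operatorname{Im}(x_j)>0$ for all $j$. A function $f$ on $\mathbb{C}^n$ is t-stable if there are stable polynomials $f_m$ with $f_m\to f$ uniformly on all compact subsets of $\mathbb{C}^n$. A probability measure $\mu$ on $\mathbb{N}^n$ is t-stable if its generating function $\sum\mu(i_1,\dots,i_n)x_1^{i_1}\cdots x_n^{i_n}$ is (the power series of) a t-stable function on $\mathbb{C}^n$. For countable $S$, a probability measure on $\mathbb{N}^S$ is t-stable if each of its projections (marginals) onto a finite subset of coordinates is t-stable. A process $\{\eta_t\}$ preserves t-stability if for any t-stable initial distribution (for which the process is well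 defined), the distribution at any later time is t-stable. A probability measure $\mu$ on $\mathbb{N}^S$ (product topology, coordinatewise partial order) is negatively associated if $\int FG\,d\mu\le\int F\,d\mu\int G\,d\mu$ for all increasing continuous real-valued functions $F,G$ depending on disjoint sets of coordinates, for which the three integrals exist and are finite. *)

theory Defs
  imports "HOL-Probability.Probability"
begin

text \<open>
  For a finite set \<open>A\<close> of variables, \<open>\<complex>\<^sup>A\<close> is represented by the extensional functions
  \<open>A \<rightarrow>\<^sub>E UNIV\<close>, and its topology by \<open>product_topology (\<lambda>_. euclidean) A\<close>. Polynomials are
  represented by polynomial functions.
\<close>

definition polynomial_function_on :: "'v set \<Rightarrow> (('v \<Rightarrow> complex) \<Rightarrow> complex) \<Rightarrow> bool" where
  "polynomial_function_on A p \<longleftrightarrow>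
     (\<exists>K c. finite K \<and> K \<subseteq> (A \<rightarrow>\<^sub>E (UNIV :: nat set)) \<and>
        (\<forall>z \<in> A \<rightarrow>\<^sub>E UNIV. p z = (\<Sum>k\<in>K. c k * (\<Prod>a\<in>A. z a ^ k a))))"

definition stable_polynomial :: "'v set \<Rightarrow> (('v \<Rightarrow> complex) \<Rightarrow> complex) \<Rightarrow> bool" where
  "stable_polynomial A p \<longleftrightarrow> polynomial_function_on A p \<and>
     (\<forall>z \<in> A \<rightarrow>\<^sub>E UNIV. (\<forall>a\<in>A. Im (z a) > 0) \<longrightarrow> p z \<noteq> 0)"

definition t_stable_function :: "'v set \<Rightarrow> (('v \<Rightarrow> complex) \<Rightarrow> complex) \<Rightarrow> bool" where
  "t_stable_function A f \<longleftrightarrow>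
     (\<exists>p :: nat \<Rightarrow> ('v \<Rightarrow> complex) \<Rightarrow> complex. (\<forall>m. stable_polynomial A (p m)) \<and>
        (\<forall>K. compactin (product_topology (\<lambda>_. euclidean) A) K \<longrightarrow>
             uniform_limit K p f sequentially))"

text \<open>Here \<open>\<mu>\<close> is a measure on \<open>\<nat>\<^sup>A\<close> for a finite set \<open>A\<close>.\<close>

definition t_stable_finite_measure :: "'v set \<Rightarrow> ('v \<Rightarrow> nat) measure \<Rightarrow> bool" where
  "t_stable_finite_measure A \<mu> \<longleftrightarrow>
     (\<exists>f. t_stable_function A f \<and>
        (\<forall>z \<in> A \<rightarrow>\<^sub>E UNIV.
           ((\<lambda>k. complex_of_real (measure \<mu> {k}) * (\<Prod>a\<in>A. z a ^ k a)) has_sum f z)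
             (A \<rightarrow>\<^sub>E UNIV)))"

text \<open>
  Probability measures on \<open>\<nat>\<^sup>S\<close> live on the Borel sets of the product topology, which for
  countable \<open>S\<close> form the product sigma-algebra.
\<close>

definition t_stable_measure :: "('s::countable \<Rightarrow> nat) measure \<Rightarrow> bool" where
  "t_stable_measure \<mu> \<longleftrightarrow> prob_space \<mu> \<and> sets \<mu> = sets borel \<and>
     (\<forall>A. finite A \<longrightarrow>
        t_stable_finite_measure A
          (distr \<mu> (PiM A (\<lambda>_. count_space UNIV)) (\<lambda>\<eta>. restrict \<eta> A)))"

definition depends_only_on :: "'s set \<Rightarrow> (('s \<Rightarrow> nat) \<Rightarrow> real) \<Rightarrow> bool" where
  "depends_only_on A F \<longleftrightarrow> (\<forall>\<eta> \<zeta>. (\<forall>x\<in>A. \<eta> x = \<zeta> x) \<longrightarrow> F \<eta> = F \<zeta>)"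

definition negatively_associated :: "('s::countable \<Rightarrow> nat) measure \<Rightarrow> bool" where
  "negatively_associated \<mu> \<longleftrightarrow> prob_space \<mu> \<and> sets \<mu> = sets borel \<and>
     (\<forall>F G A B. mono F \<and> mono G \<and> continuous_on UNIV F \<and> continuous_on UNIV G \<and>
        A \<inter> B = {} \<and> depends_only_on A F \<and> depends_only_on B G \<and>
        integrable \<mu> F \<and> integrable \<mu> G \<and> integrable \<mu> (\<lambda>\<eta>. F \<eta> * G \<eta>) \<longrightarrow>
        (\<integral>\<eta>. F \<eta> * G \<eta> \<partial>\<mu>) \<le> (\<integral>\<eta>. F \<eta> \<partial>\<mu>) * (\<integral>\<eta>. G \<eta> \<partial>\<mu>))"

text \<open>
  \<open>q x y\<close> is the rate of jumping from \<open>x\<close> to \<open>y\<close>, for \<open>x \<noteq> y\<close>; the diagonal of \<open>q\<close> is never used.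
\<close>

definition jump_rates :: "('s \<Rightarrow> 's \<Rightarrow> real) \<Rightarrow> bool" where
  "jump_rates q \<longleftrightarrow> (\<forall>x y. x \<noteq> y \<longrightarrow> 0 \<le> q x y) \<and> (\<forall>x. q x summable_on (UNIV - {x}))"

definition transition_function :: "(real \<Rightarrow> 's \<Rightarrow> 's \<Rightarrow> real) \<Rightarrow> bool" where
  "transition_function P \<longleftrightarrow>
     (\<forall>t\<ge>0. \<forall>x y. 0 \<le> P t x y) \<and>
     (\<forall>t\<ge>0. \<forall>x. (P t x has_sum 1) UNIV) \<and>
     (\<forall>x y. P 0 x y = (if x = y then 1 else 0)) \<and>
     (\<forall>s\<ge>0. \<forall>t\<ge>0. \<forall>x y. ((\<lambda>z. P s x z * P t z y) has_sum P (s + t) x y) UNIV)"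

definition has_jump_rates :: "(real \<Rightarrow> 's \<Rightarrow> 's \<Rightarrow> real) \<Rightarrow> ('s \<Rightarrow> 's \<Rightarrow> real) \<Rightarrow> bool" where
  "has_jump_rates P q \<longleftrightarrow>
     (\<forall>x y. x \<noteq> y \<longrightarrow> ((\<lambda>t. P t x y) has_real_derivative q x y) (at 0 within {0..})) \<and>
     (\<forall>x. ((\<lambda>t. P t x x) has_real_derivative - (\<Sum>\<^sub>\<infinity>y\<in>UNIV - {x}. q x y)) (at 0 within {0..}))"

text \<open>
  The Markov property: given the states at finitely many times, the latest of which is \<open>s\<close>, the
  state at time \<open>s + h\<close> has distribution \<open>P h (z s)\<close>.
\<close>

definition markov_chain ::
    "'w measure \<Rightarrow> (real \<Rightarrow> 's \<Rightarrow> 's \<Rightarrow> real) \<Rightarrow> (real \<Rightarrow> 'w \<Rightarrow> 's) \<Rightarrow> bool" where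
  "markov_chain M P Y \<longleftrightarrow>
     (\<forall>t\<ge>0. Y t \<in> measurable M (count_space UNIV)) \<and>
     (\<forall>s\<ge>0. \<forall>h\<ge>0. \<forall>T z y. finite T \<and> T \<subseteq> {0..s} \<and> s \<in> T \<and>
        \<P>(\<omega> in M. \<forall>u\<in>T. Y u \<omega> = z u) > 0 \<longrightarrow>
        \<P>(\<omega> in M. Y (s + h) \<omega> = y \<bar> \<forall>u\<in>T. Y u \<omega> = z u) = P h (z s) y)"

text \<open>
  \<open>N\<close> is the number of particles, which may be random and may be infinite; the particles are
  numbered by the \<open>i\<close> with \<open>enat i < N\<close>, and \<open>X i t\<close> is the position of particle \<open>i\<close> at time
  \<open>t\<close> (irrelevant if there is no such particle). The initial positions are arbitrary, possibly
  dependent, random variables. Given the number of particles and the initial positions, the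
  particles evolve as independent Markov chains with common transition function \<open>P\<close>. Since all
  data are discrete, it suffices to condition on the number of particles and the initial
  positions of finitely many of them.
\<close>

definition independent_particles ::
    "'w measure \<Rightarrow> (real \<Rightarrow> 's \<Rightarrow> 's \<Rightarrow> real) \<Rightarrow> ('w \<Rightarrow> enat) \<Rightarrow> (nat \<Rightarrow> real \<Rightarrow> 'w \<Rightarrow> 's) \<Rightarrow> bool"
  where
  "independent_particles M P N X \<longleftrightarrow>
     N \<in> measurable M (count_space UNIV) \<and>
     (\<forall>i. \<forall>t\<ge>0. X i t \<in> measurable M (count_space UNIV)) \<and>
     (\<forall>n I \<xi>. finite I \<and> (\<forall>i\<in>I. enat i < n) \<longrightarrow>
        (let E = {\<omega> \<in> space M. N \<omega> = n \<and> (\<forall>i\<in>I. X i 0 \<omega> = \<xi> i)};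
             M' = uniform_measure M E
         in measure M E > 0 \<longrightarrow>
              prob_space.indep_vars M' (\<lambda>_. PiM {0..} (\<lambda>_. count_space UNIV))
                (\<lambda>i \<omega>. \<lambda>t\<in>{0..}. X i t \<omega>) I \<and>
              (\<forall>i\<in>I. markov_chain M' P (X i))))"

definition particles_at ::
    "('w \<Rightarrow> enat) \<Rightarrow> (nat \<Rightarrow> real \<Rightarrow> 'w \<Rightarrow> 's) \<Rightarrow> real \<Rightarrow> 'w \<Rightarrow> 's \<Rightarrow> nat set" where
  "particles_at N X t \<omega> x = {i. enat i < N \<omega> \<and> X i t \<omega> = x}"

definition occupation ::
    "('w \<Rightarrow> enat) \<Rightarrow> (nat \<Rightarrow> real \<Rightarrow> 'w \<Rightarrow> 's) \<Rightarrow> real \<Rightarrow> 'w \<Rightarrow> 's \<Rightarrow> nat" where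
  "occupation N X t \<omega> x = card (particles_at N X t \<omega> x)"

end

theory Submission
  imports Defs "HOL-Complex_Analysis.Complex_Analysis" "HOL-Computational_Algebra.Fundamental_Theorem_Algebra"
begin

text \<open>
  Preservation: conditionally on the start, the generating function of the particles that started
  in a finite set \<open>B\<close> is that of \<open>\<eta>\<^sub>0\<close> on \<open>B\<close>, composed with an affine map with nonnegative
  coefficients, hence t-stable. To let \<open>B\<close> increase to \<open>S\<close> one needs locally uniform convergence on
  all of \<open>\<complex>\<^sup>A\<close>, that is, exponential moments that are bounded uniformly in \<open>B\<close>. The number \<open>Y\<close> of
  particles in \<open>A\<close> has a generating function that is a limit of real-rooted polynomials with
  nonnegative coefficients, hence log-concave, which bounds \<open>E R\<^sup>Y\<close> by a negative power of
  \<open>E 2\<^sup>-\<^sup>Y\<close>; the latter stays away from \<open>0\<close> because \<open>Y\<close> is finite in the limit.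

  Negative association: replace every site by \<open>N\<close> slots, each holding at most one particle. The
  operators \<open>1 + y \<partial>\<close> preserve stability, so the law of the occupied slots has a stable multiaffine
  generating polynomial. Its homogenization is stable too, which gives pairwise negative
  correlation, also after conditioning, and the induction of Feder and Mihail yields negative
  association. Finally \<open>N\<close> tends to infinity.
\<close>

section \<open>Univariate polynomials without zeros in the upper half plane\<close>

text \<open>Convergence of generating functions on the unit polydisc would come for free;
  t-stability asks for approximation on all compact sets, and this makes exponential moments the
  obstacle. The point 1 is the mean of m copies of 1/2 and one copy of 1 + m/2, and the value at 1
  is the total mass. So log-concavity bounds E (1 + m/2)^Y by (E 2^-Y)^-m, and m is free to push 1 +
  m/2 beyond any radius. The slots serve both halves. Throwing a configuration uniformly into N
  slots per site and forbidding collisions changes its mass only by a factor tending to 1, and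
  setting all slot variables equal gives the real-rooted polynomials. Homogenization is what the
  averaging in the induction needs: the correlations of F with the occupation numbers add up to 0
  only if the number of occupied slots is constant, and the extra variable carries the deficit. The
  argument that homogenizing keeps stability uses positive coefficients, obtained by flipping sites;
  positivity also keeps all conditional weights from degenerating.\<close>

lemma complex_poly_root_induct [consumes 1, case_names const factor]:
  fixes q :: "complex poly"
  assumes "q \<noteq> 0" "\<And>c. c \<noteq> 0 \<Longrightarrow> Q [:c:]" "\<And>f r q. degree f = 1 \<Longrightarrow> lead_coeff f = 1 \<Longrightarrow> pderiv f = 1 \<Longrightarrow> (\<And>x. poly f x = x - r) \<Longrightarrow>
      q \<noteq> 0 \<Longrightarrow> Q q \<Longrightarrow> Q (f * q)"
  shows "Q q"
  using assms(1)
proof (induction "degree q" arbitrary: q)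
  case 0
  then obtain c where "q = [:c:]" by (metis degree_eq_zeroE)
  with 0 assms(2) show ?case by auto
next
  case (Suc n)
  then obtain r where "poly q r = 0"
    using alg_closed_imp_poly_has_root[of q] by auto
  then obtain p where p: "q = [:-r, 1:] * p" by (metis poly_eq_0_iff_dvd dvdE)
  with Suc have "p \<noteq> 0" by auto
  then have "degree q = Suc (degree p)" unfolding p by (subst degree_mult_eq) auto
  with Suc have "Q p" using \<open>p \<noteq> 0\<close> by auto
  with \<open>p \<noteq> 0\<close> show ?case unfolding p
    by (intro assms(3)[of _ r]) (auto simp: pderiv_pCons)
qed

text \<open>q'/q is the sum of 1/(x - r) over the roots r. Nonvanishing puts all roots in the closed
  lower half plane, so every summand has negative imaginary part; strictness needs at least one
  root.\<close>

lemma Im_logarithmic_derivative: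
  fixes q :: "complex poly"
  assumes "\<And>x. Im x > 0 \<Longrightarrow> poly q x \<noteq> 0" "Im x > 0"
  shows "Im (poly (pderiv q) x / poly q x) \<le> 0"
    and "degree q > 0 \<Longrightarrow> Im (poly (pderiv q) x / poly q x) < 0"
proof -
  have "q \<noteq> 0" using assms(1)[of x] assms(2) by auto
  then have "(\<forall>x. Im x > 0 \<longrightarrow> poly q x \<noteq> 0) \<longrightarrow> Im (poly (pderiv q) x / poly q x) \<le> 0 \<and>
     (degree q > 0 \<longrightarrow> Im (poly (pderiv q) x / poly q x) < 0)"
  proof (induction q rule: complex_poly_root_induct)
    case (const c)
    then show ?case by (simp add: pderiv_pCons)
  next
    case (factor f r q)
    show ?case
    proof
      assume *: "\<forall>x. Im x > 0 \<longrightarrow> poly (f * q) x \<noteq> 0"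
      have r: "Im r \<le> 0" using *[rule_format, of r] factor(4) by force
      have q: "\<forall>x. Im x > 0 \<longrightarrow> poly q x \<noteq> 0" using * by auto
      have ne: "x - r \<noteq> 0" "poly q x \<noteq> 0" using r assms(2) q by auto
      have "poly (pderiv (f * q)) x / poly (f * q) x
          = 1 / (x - r) + poly (pderiv q) x / poly q x"
      proof -
        have "poly (pderiv (f * q)) x = (x - r) * poly (pderiv q) x + poly q x"
          using factor(3,4) by (simp add: pderiv_mult)
        then show ?thesis using ne by (simp add: field_simps factor(4))
      qed
      moreover have "Im (1 / (x - r)) < 0"
      proof -
        have "Im (1 / (x - r)) = - (Im x - Im r) / (cmod (x - r))\<^sup>2"
          by (simp add: Im_divide cmod_power2)
        moreover have "(cmod (x - r))\<^sup>2 > 0" using ne by simp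
        ultimately show ?thesis using r assms(2) by (simp add: divide_neg_pos)
      qed
      ultimately show "Im (poly (pderiv (f * q)) x / poly (f * q) x) \<le> 0 \<and>
        (degree (f * q) > 0 \<longrightarrow> Im (poly (pderiv (f * q)) x / poly (f * q) x) < 0)"
        using factor(6) q by auto
    qed
  qed
  then show "Im (poly (pderiv q) x / poly q x) \<le> 0"
    and "degree q > 0 \<Longrightarrow> Im (poly (pderiv q) x / poly q x) < 0" using assms by auto
qed

text \<open>Each root has Im r \<le> 0, so each factor satisfies |x - r| \<ge> Im x. Unlike mere
  nonvanishing, this bound survives limits.\<close>

lemma norm_poly_ge_lead_coeff:
  fixes q :: "complex poly"
  assumes "\<And>x. Im x > 0 \<Longrightarrow> poly q x \<noteq> 0" "Im x > 0"
  shows "norm (lead_coeff q) * Im x ^ degree q \<le> norm (poly q x)"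
proof -
  have "q \<noteq> 0" using assms(1)[of x] assms(2) by auto
  then have "(\<forall>x. Im x > 0 \<longrightarrow> poly q x \<noteq> 0) \<longrightarrow> norm (lead_coeff q) * Im x ^ degree q \<le> norm (poly q x)"
  proof (induction q rule: complex_poly_root_induct)
    case (factor f r q)
    show ?case
    proof
      assume *: "\<forall>x. Im x > 0 \<longrightarrow> poly (f * q) x \<noteq> 0"
      have r: "Im r \<le> 0" using *[rule_format, of r] factor(4) by force
      have q: "\<forall>x. Im x > 0 \<longrightarrow> poly q x \<noteq> 0" using * by auto
      have "degree (f * q) = Suc (degree q)" using factor(1,5) by (subst degree_mult_eq) auto
      moreover have "lead_coeff (f * q) = lead_coeff q" using factor(2) by (simp only: lead_coeff_mult) simp
      moreover have "Im x \<le> norm (x - r)" using r abs_Im_le_cmod[of "x - r"] by simp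
      ultimately show "norm (lead_coeff (f * q)) * Im x ^ degree (f * q)
          \<le> norm (poly (f * q) x)"
        using factor(6) q mult_mono[of "Im x" "norm (x - r)" "norm (lead_coeff q) * Im x ^ degree q" "norm (poly q x)"] assms(2)
        by (simp add: norm_mult mult_ac factor(4))
    qed
  qed auto
  then show ?thesis using assms by auto
qed

text \<open>AM-GM for one number c + m/2 and m numbers c - 1/2, whose mean is c. Applied with c = 1
  + s to a factor x + s, whose values at 1 + m/2, 1/2 and 1 are c + m/2, c - 1/2 and c.\<close>

lemma affine_weighted_ineq:
  fixes c :: real
  assumes "c \<ge> 1"
  shows "(c + real m / 2) * (c - 1 / 2) ^ m \<le> c ^ Suc m"
proof (induction m)
  case (Suc m)
  have "(c + real (Suc m) / 2) * (c - 1 / 2) \<le> c * (c + real m / 2)"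
    using assms by (simp add: field_simps)
  then have "(c + real (Suc m) / 2) * (c - 1 / 2) ^ Suc m \<le> c * (c + real m / 2) * (c - 1 / 2) ^ m"
    using assms mult_right_mono[of _ _ "(c - 1/2) ^ m"] by (simp add: mult.assoc)
  also have "\<dots> \<le> c * c ^ Suc m" using Suc assms by (simp add: mult.assoc)
  finally show ?case by simp
qed simp

text \<open>Log-concavity on the positive axis, between the points \<open>1/2\<close>, \<open>1\<close> and \<open>1 + m/2\<close>.\<close>

lemma real_rooted_three_point:
  fixes q :: "complex poly"
  assumes "\<And>x. poly q x = 0 \<Longrightarrow> x \<in> \<real> \<and> Re x \<le> 0"
  shows "norm (poly q (1 + of_nat m / 2)) * norm (poly q (1 / 2)) ^ m \<le> norm (poly q 1) ^ Suc m"
proof (cases "q = 0")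
  case False
  then have "(\<forall>x. poly q x = 0 \<longrightarrow> x \<in> \<real> \<and> Re x \<le> 0) \<longrightarrow>
    norm (poly q (1 + of_nat m / 2)) * norm (poly q (1 / 2)) ^ m \<le> norm (poly q 1) ^ Suc m"
  proof (induction q rule: complex_poly_root_induct)
    case (factor f r q)
    show ?case
    proof
      assume *: "\<forall>x. poly (f * q) x = 0 \<longrightarrow> x \<in> \<real> \<and> Re x \<le> 0"
      then have "r \<in> \<real> \<and> Re r \<le> 0" using factor(4) by auto
      then obtain s where r: "r = of_real (- s)" "s \<ge> 0" by (auto elim!: Reals_cases) (metis add.inverse_inverse neg_0_le_iff_le)
      have q: "\<forall>x. poly q x = 0 \<longrightarrow> x \<in> \<real> \<and> Re x \<le> 0" using * by auto
      have n: "norm (of_real x - r) = x + s" if "x \<ge> 0" for x :: real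
        unfolding r using that r(2) by (metis abs_of_nonneg add_nonneg_nonneg diff_minus_eq_add norm_of_real of_real_diff)
      have n1: "norm (1 + of_nat m / 2 - r) = 1 + m / 2 + s" "norm (1 / 2 - r) = 1 / 2 + s" "norm (1 - r) = 1 + s"
        using n[of "1 + m / 2"] n[of "1/2"] n[of 1] by simp_all
      have "(1 + s + m / 2) * (1 + s - 1 / 2) ^ m \<le> (1 + s) ^ Suc m" 
        using affine_weighted_ineq[of "1 + s" m] r by simp
      then have "norm (1 + of_nat m / 2 - r) * norm (1 / 2 - r) ^ m \<le> norm (1 - r) ^ Suc m"
        unfolding n1 by (simp add: algebra_simps)
      then have "(norm (1 + of_nat m / 2 - r) * norm (1 / 2 - r) ^ m) * (norm (poly q (1 + of_nat m / 2)) * norm (poly q (1 / 2)) ^ m)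
         \<le> norm (1 - r) ^ Suc m * norm (poly q 1) ^ Suc m"
        using factor(6) q by (intro mult_mono) auto
      then show "norm (poly (f * q) (1 + of_nat m / 2)) * norm (poly (f * q) (1 / 2)) ^ m
         \<le> norm (poly (f * q) 1) ^ Suc m"
        by (simp add: norm_mult power_mult_distrib mult_ac factor(4))
    qed
  qed auto
  then show ?thesis using assms by auto
qed auto

section \<open>Hurwitz's theorem in several variables\<close>

lemma uniform_limit_finite_sum:
  fixes f :: "'j \<Rightarrow> 'a \<Rightarrow> 'b \<Rightarrow> 'c :: real_normed_vector"
  assumes "finite J" "\<And>j. j \<in> J \<Longrightarrow> uniform_limit X (f j) (l j) F"
  shows "uniform_limit X (\<lambda>n x. \<Sum>j\<in>J. f j n x) (\<lambda>x. \<Sum>j\<in>J. l j x) F"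
  using assms by (induction J rule: finite_induct) (auto intro!: uniform_limit_add uniform_limit_const)

lemma tendsto_const_over_Suc: "(\<lambda>n. c / of_nat (Suc n)) \<longlonglongrightarrow> (0 :: complex)"
  using tendsto_mult[OF tendsto_const[of c] LIMSEQ_inverse_real_of_nat[THEN tendsto_of_real]]
  by (simp add: divide_inverse del: of_nat_Suc)

text \<open>With fixed functions \<open>g j\<close> and converging coefficients, locally uniform
  convergence is automatic, so the one-variable theorem applies. The point \<open>t\<close> rules
  out a limit that vanishes identically: together with a zero at \<open>s\<close> it makes the limit
  nonconstant.\<close>

lemma hurwitz_finite_sum:
  fixes g :: "'j \<Rightarrow> complex \<Rightarrow> complex" and c :: "nat \<Rightarrow> 'j \<Rightarrow> complex"
  assumes J: "finite J" and U: "open U" "connected U"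
    and g: "\<And>j. j \<in> J \<Longrightarrow> g j holomorphic_on U"
    and c: "\<And>j. j \<in> J \<Longrightarrow> (\<lambda>n. c n j) \<longlonglongrightarrow> c' j"
    and nz: "\<And>n s. s \<in> U \<Longrightarrow> (\<Sum>j\<in>J. c n j * g j s) \<noteq> 0"
    and t: "t \<in> U" "(\<Sum>j\<in>J. c' j * g j t) \<noteq> 0" and s: "s \<in> U"
  shows "(\<Sum>j\<in>J. c' j * g j s) \<noteq> 0"
proof
  assume 0: "(\<Sum>j\<in>J. c' j * g j s) = 0"
  let ?G = "\<lambda>s. \<Sum>j\<in>J. c' j * g j s"
  have "?G s \<noteq> 0"
  proof (rule Hurwitz_no_zeros[where \<F> = "\<lambda>n s. \<Sum>j\<in>J. c n j * g j s" and S = U and g = ?G and ?z0.0 = s])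
    show "(\<lambda>s. \<Sum>j\<in>J. c n j * g j s) holomorphic_on U" for n by (intro holomorphic_intros g)
    show "?G holomorphic_on U" by (intro holomorphic_intros g)
    show "\<not> ?G constant_on U" using t s 0 unfolding constant_on_def by metis
    show "uniform_limit K (\<lambda>n s. \<Sum>j\<in>J. c n j * g j s) ?G sequentially" if K: "compact K" "K \<subseteq> U" for K
    proof (rule uniform_limit_finite_sum[OF J])
      fix j assume j: "j \<in> J"
      have 1: "uniform_limit K (\<lambda>n s. c n j) (\<lambda>s. c' j) sequentially"
        using c[OF j] unfolding uniform_limit_iff tendsto_iff by (auto elim: eventually_mono)
      have 2: "bounded (g j ` K)"
        using K g[OF j] by (meson compact_continuous_image compact_imp_bounded continuous_on_subset holomorphic_on_imp_continuous_on)
      have 3: "bounded ((\<lambda>s::complex. c' j) ` K)" by (auto simp: bounded_iff)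
      show "uniform_limit K (\<lambda>n s. c n j * g j s) (\<lambda>s. c' j * g j s) sequentially"
        by (rule uniform_lim_mult[OF 1 uniform_limit_const 3 2])
    qed
  qed (use U nz s in auto)
  with 0 show False by simp
qed


text \<open>Points are arbitrary functions constrained only on \<open>E\<close>, so coordinates can
  be updated or dropped without adjusting the point elsewhere.\<close>

definition upper_poly :: "'e set \<Rightarrow> ('e \<Rightarrow> complex) set" where
  "upper_poly E = {z. \<forall>e\<in>E. Im (z e) > 0}"

definition multiaffine :: "'e set \<Rightarrow> ('e set \<Rightarrow> complex) \<Rightarrow> ('e \<Rightarrow> complex) \<Rightarrow> complex" where
  "multiaffine E b z = (\<Sum>S\<in>Pow E. b S * (\<Prod>e\<in>S. z e))"

text \<open>Reduces several variables to one: each coordinate confines the parameter s of the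
  complex line through u (s = 0) and v (s = 1) to a convex open set.\<close>

lemma segment_upper_poly:
  assumes "finite E" "u \<in> upper_poly E" "v \<in> upper_poly E"
  defines "U \<equiv> {s. (\<lambda>e. u e + s * (v e - u e)) \<in> upper_poly E}"
  shows "open U" "connected U" "0 \<in> U" "1 \<in> U"
proof -
  have U: "U = (\<Inter>e\<in>E. {s. 0 < Im (u e + s * (v e - u e))})"
    unfolding U_def upper_poly_def by auto
  show "open U" unfolding U
    using assms(1) by (intro open_INT ballI open_Collect_less continuous_intros) auto
  have "convex {s. 0 < Im (u e + s * (v e - u e))}" for e
  proof -
    \<comment> \<open>With d = v e - u e, the number Im (s * d) is real-linear in s: the inner
      product of s with the vector (Im d, Re d).\<close>
    have "{s. 0 < Im (u e + s * (v e - u e))} =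
        {s. inner (Complex (Im (v e - u e)) (Re (v e - u e))) s > - Im (u e)}"
      by (auto simp: inner_complex_def algebra_simps)
    then show ?thesis by (simp only: convex_halfspace_gt)
  qed
  then have "convex U" unfolding U by (intro convex_INT) auto
  then show "connected U" by (rule convex_connected)
  show "0 \<in> U" "1 \<in> U" using assms(2,3) unfolding U_def upper_poly_def by auto
qed

text \<open>On the complex line from \<open>u\<close> to \<open>v\<close> the monomials are the
  fixed functions of the one-variable version.\<close>

lemma multiaffine_hurwitz:
  assumes E: "finite E"
    and b: "\<And>S. S \<subseteq> E \<Longrightarrow> (\<lambda>n. b n S) \<longlonglongrightarrow> b' S"
    and nz: "\<And>n z. z \<in> upper_poly E \<Longrightarrow> multiaffine E (b n) z \<noteq> 0"
    and v: "v \<in> upper_poly E" "multiaffine E b' v \<noteq> 0"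
    and u: "u \<in> upper_poly E"
  shows "multiaffine E b' u \<noteq> 0"
proof -
  let ?L = "\<lambda>s e. u e + s * (v e - u e)"
  define U where "U = {s. ?L s \<in> upper_poly E}"
  note U = segment_upper_poly[OF E u v(1), folded U_def]
  define g where "g S s = (\<Prod>e\<in>S. ?L s e)" for S s
  have L: "(\<Sum>S\<in>Pow E. c S * g S s) = multiaffine E c (?L s)" for c s
    by (simp add: multiaffine_def g_def)
  have "(\<Sum>S\<in>Pow E. b' S * g S 0) \<noteq> 0"
  proof (rule hurwitz_finite_sum[of "Pow E" U g b b' 1])
    show "g S holomorphic_on U" for S unfolding g_def by (intro holomorphic_intros)
    show "(\<Sum>S\<in>Pow E. b n S * g S s) \<noteq> 0" if "s \<in> U" for n s
      using that nz unfolding L by (auto simp: U_def)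
    show "(\<Sum>S\<in>Pow E. b' S * g S 1) \<noteq> 0" unfolding L using v by simp
  qed (use E U b in auto)
  then show ?thesis unfolding L by simp
qed

text \<open>Supplies the point \<open>v\<close> for the previous lemma.\<close>

lemma multiaffine_nonzero_near_one:
  assumes "finite E" "(\<Sum>S\<in>Pow E. b S) \<noteq> 0"
  obtains v where "v \<in> upper_poly E" "multiaffine E b v \<noteq> 0"
proof -
  let ?f = "\<lambda>t::real. multiaffine E b (\<lambda>_. 1 + \<i> * of_real t)"
  have "(?f \<longlongrightarrow> ?f 0) (at_right 0)"
    unfolding multiaffine_def by (intro tendsto_intros)
  moreover have "?f 0 \<noteq> 0" using assms by (simp add: multiaffine_def)
  ultimately have "\<forall>\<^sub>F t in at_right 0. ?f t \<noteq> 0" by (rule tendsto_imp_eventually_ne)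
  moreover have "\<forall>\<^sub>F t in at_right (0::real). t > 0" by (simp add: eventually_at_right_less)
  ultimately have "\<forall>\<^sub>F t in at_right 0. ?f t \<noteq> 0 \<and> t > 0" by eventually_elim simp
  then obtain t where "?f t \<noteq> 0" "t > 0"
    using eventually_happens'[of "at_right (0::real)"] by (metis (mono_tags, lifting) trivial_limit_at_right_real)
  then show ?thesis by (intro that[of "\<lambda>_. 1 + \<i> * of_real t"]) (auto simp: upper_poly_def)
qed

section \<open>Polynomials as coefficient arrays, and the operators 1 + y d/dx\<close>

definition box_poly :: "'v set \<Rightarrow> nat \<Rightarrow> (('v \<Rightarrow> nat) \<Rightarrow> complex) \<Rightarrow> ('v \<Rightarrow> complex) \<Rightarrow> complex" where
  "box_poly A D c x = (\<Sum>k\<in>PiE A (\<lambda>_. {..D}). c k * (\<Prod>a\<in>A. x a ^ k a))"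

text \<open>Guarantees that the truncated sum \<open>box_poly\<close> drops no monomial; in
  particular the shifted coefficients that a derivative reads just beyond the bound are 0.\<close>

definition in_box :: "'v set \<Rightarrow> nat \<Rightarrow> (('v \<Rightarrow> nat) \<Rightarrow> complex) \<Rightarrow> bool" where
  "in_box A D c \<longleftrightarrow> (\<forall>k a. a \<in> A \<longrightarrow> k a > D \<longrightarrow> c k = 0)"

text \<open>Coefficient array of f + y df/dx_a when \<open>c\<close> is the array of f;
  differentiation shifts the exponent, hence the factor \<open>Suc (k a)\<close>.\<close>

definition add_deriv :: "'v \<Rightarrow> complex \<Rightarrow> (('v \<Rightarrow> nat) \<Rightarrow> complex) \<Rightarrow> ('v \<Rightarrow> nat) \<Rightarrow> complex" where
  "add_deriv a y c k = c k + y * of_nat (Suc (k a)) * c (k(a := Suc (k a)))"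

lemma in_box_add_deriv: "in_box A D c \<Longrightarrow> in_box A D (add_deriv a y c)"
  unfolding in_box_def add_deriv_def
  by (smt (verit, best) add_0 fun_upd_apply less_SucI mult_zero_right)

text \<open>With the other variables frozen, f is a polynomial q in x_a without zeros in the upper
  half plane. A zero of q + y q' would give q'/q = -1/y, whose imaginary part is positive, against
  the sign of the logarithmic derivative.\<close>

lemma box_poly_add_deriv_nonzero:
  assumes A: "finite A" "a \<in> A" and c: "in_box A D c" and y: "Im y > 0"
    and nz: "\<And>x. x \<in> upper_poly A \<Longrightarrow> box_poly A D c x \<noteq> 0" and x: "x \<in> upper_poly A"
  shows "box_poly A D (add_deriv a y c) x \<noteq> 0"
proof -
  let ?B = "PiE A (\<lambda>_. {..D})"
  define w where "w k = (\<Prod>b\<in>A - {a}. x b ^ k b)" for k :: "'a \<Rightarrow> nat"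
  have fB: "finite ?B" using A by (intro finite_PiE) auto
  define q where "q = (\<Sum>k\<in>?B. monom (c k * w k) (k a))"
  have q: "poly q s = box_poly A D c (x(a := s))" for s
  proof -
    have "(\<Prod>b\<in>A. (x(a := s)) b ^ k b) = s ^ k a * w k" for k
      unfolding w_def using A by (subst prod.remove[of A a]) (auto intro!: prod.cong)
    then show ?thesis unfolding q_def box_poly_def
      by (auto simp: poly_sum poly_monom mult_ac intro!: sum.cong)
  qed
  have qnz: "poly q s \<noteq> 0" if "Im s > 0" for s
    unfolding q using that x by (intro nz) (auto simp: upper_poly_def)
  have pw: "(\<Prod>b\<in>A. x b ^ k b) = x a ^ k a * w k" for k
    unfolding w_def using A by (subst prod.remove[of A a]) auto
  have "poly (pderiv q) (x a) = (\<Sum>k\<in>?B. of_nat (Suc (k a)) * c (k(a := Suc (k a))) * (\<Prod>b\<in>A. x b ^ k b))"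
  proof -
    have "poly (pderiv q) (x a) = (\<Sum>k\<in>?B. of_nat (k a) * c k * w k * x a ^ (k a - 1))"
      unfolding q_def by (simp add: higher_pderiv_sum[of 1, simplified] pderiv_monom poly_sum poly_monom mult.assoc)
    also have "\<dots> = (\<Sum>k\<in>{k\<in>?B. k a \<noteq> 0}. of_nat (k a) * c k * w k * x a ^ (k a - 1))"
      using fB by (intro sum.mono_neutral_right) auto
    also have "\<dots> = (\<Sum>k\<in>{k\<in>?B. k a < D}. of_nat (Suc (k a)) * c (k(a := Suc (k a))) * w k * x a ^ k a)"
    proof (rule sum.reindex_bij_witness[of _ "\<lambda>k. k(a := Suc (k a))" "\<lambda>k. k(a := k a - 1)"])
      have "w (k(a := j)) = w k" for k j unfolding w_def by (intro prod.cong) auto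
      then show "of_nat (Suc ((k(a := k a - 1)) a)) * c ((k(a := k a - 1))(a := Suc ((k(a := k a - 1)) a)))
          * w (k(a := k a - 1)) * x a ^ (k(a := k a - 1)) a = of_nat (k a) * c k * w k * x a ^ (k a - 1)"
        if "k \<in> {k\<in>?B. k a \<noteq> 0}" for k using that by simp
    qed (use A in \<open>auto simp: PiE_iff extensional_def le_diff_conv\<close>)
    \<comment> \<open>The added exponents have \<open>k a = D\<close>; there \<open>c\<close> is
      read outside the box and vanishes.\<close>
    also have "\<dots> = (\<Sum>k\<in>?B. of_nat (Suc (k a)) * c (k(a := Suc (k a))) * w k * x a ^ k a)"
    proof (rule sum.mono_neutral_left)
      show "\<forall>k\<in>?B - {k\<in>?B. k a < D}. of_nat (Suc (k a)) * c (k(a := Suc (k a))) * w k * x a ^ k a = 0"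
      proof
        fix k assume "k \<in> ?B - {k\<in>?B. k a < D}"
        then have "k a \<le> D" "\<not> k a < D" using A by (auto simp: PiE_iff)
        then have "D < (k(a := Suc (k a))) a" by simp
        then have "c (k(a := Suc (k a))) = 0" using c A unfolding in_box_def by blast
        then show "of_nat (Suc (k a)) * c (k(a := Suc (k a))) * w k * x a ^ k a = 0" by simp
      qed
    qed (use fB in auto)
    finally show ?thesis unfolding pw by (simp only: mult.assoc mult.left_commute mult.commute)
  qed
  then have eq: "box_poly A D (add_deriv a y c) x = poly q (x a) + y * poly (pderiv q) (x a)"
    unfolding q fun_upd_triv box_poly_def add_deriv_def distrib_right sum.distrib
    by (simp only: sum_distrib_left mult.assoc)
  have xa: "Im (x a) > 0" using x A by (auto simp: upper_poly_def)
  show ?thesis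
  proof
    assume "box_poly A D (add_deriv a y c) x = 0"
    then have "poly (pderiv q) (x a) / poly q (x a) = - 1 / y"
    proof -
      have y0: "y \<noteq> 0" using y by auto
      have "y * poly (pderiv q) (x a) = - poly q (x a)"
        using eq \<open>box_poly A D (add_deriv a y c) x = 0\<close> by (simp add: add_eq_0_iff)
      then have "poly (pderiv q) (x a) = - poly q (x a) / y"
        using y0 by (metis nonzero_mult_div_cancel_left)
      then show ?thesis using qnz[OF xa] by simp
    qed
    moreover have "Im (- 1 / y) > 0" using y by (auto simp: Im_divide intro!: divide_pos_pos sum_power2_gt_zero_iff[THEN iffD2])
    ultimately show False using Im_logarithmic_derivative(1)[of q "x a"] qnz xa by (metis not_less)
  qed
qed

lemma sum_Pow_insert:
  assumes "finite A" "x \<notin> A"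
  shows "sum f (Pow (insert x A)) = sum f (Pow A) + (\<Sum>S\<in>Pow A. f (insert x S))"
proof -
  have "inj_on (insert x) (Pow A)" using assms by (intro inj_onI) (metis PowD insert_ident subsetD)
  moreover have "Pow A \<inter> insert x ` Pow A = {}" using assms by auto
  ultimately show ?thesis using assms
    by (simp add: Pow_insert sum.union_disjoint sum.reindex)
qed

text \<open>An element (a, i) stands for slot i of site a, and S for the set of occupied
  slots.\<close>

definition occ :: "('v \<times> nat) set \<Rightarrow> 'v \<Rightarrow> nat" where
  "occ S a = card {e\<in>S. fst e = a}"

lemma occ_insert: "finite S \<Longrightarrow> (a, i) \<notin> S \<Longrightarrow> occ (insert (a, i) S) = (occ S)(a := Suc (occ S a))"
proof
  fix b assume "finite S" "(a, i) \<notin> S"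
  moreover have "{e \<in> insert (a, i) S. fst e = b} = (if b = a then insert (a, i) {e\<in>S. fst e = b} else {e\<in>S. fst e = b})"
    by auto
  ultimately show "occ (insert (a, i) S) b = ((occ S)(a := Suc (occ S a))) b"
    by (auto simp: occ_def)
qed

lemma occ_eq_0: "S \<subseteq> A \<times> UNIV \<Longrightarrow> a \<notin> A \<Longrightarrow> occ S a = 0"
  by (auto simp: occ_def card_eq_0_iff)

text \<open>The result of applying \<open>1 + y\<^sub>e \<partial>\<^sub>a\<close> for all \<open>e = (a, i) \<in> E\<close>.\<close>

definition iter_deriv ::
    "'v set \<Rightarrow> ('v \<times> nat) set \<Rightarrow> ('v \<times> nat \<Rightarrow> complex) \<Rightarrow> (('v \<Rightarrow> nat) \<Rightarrow> complex) \<Rightarrow> ('v \<Rightarrow> nat) \<Rightarrow> complex" where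
  "iter_deriv A E y c k = (\<Sum>S\<in>Pow E. (\<Prod>e\<in>S. y e) *
     ((\<Prod>a\<in>A. fact (k a + occ S a) / fact (k a)) * c (\<lambda>a. k a + occ S a)))"

text \<open>Subsets are split by whether they contain (a, i). The factorials fit because (k + n +
  1)! / k! = (k + 1) * ((k + 1) + n)! / (k + 1)!, where k + 1 is the factor of the
  derivative.\<close>

lemma iter_deriv_insert:
  assumes A: "finite A" "a \<in> A" and E: "finite E" "(a, i) \<notin> E"
  shows "iter_deriv A (insert (a, i) E) y c = add_deriv a (y (a, i)) (iter_deriv A E y c)"
proof
  fix k
  have "(\<Prod>e\<in>insert (a, i) S. y e) * ((\<Prod>b\<in>A. fact (k b + occ (insert (a, i) S) b) / fact (k b)) *
      c (\<lambda>b. k b + occ (insert (a, i) S) b)) =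
    y (a, i) * of_nat (Suc (k a)) * ((\<Prod>e\<in>S. y e) *
      ((\<Prod>b\<in>A. fact ((k(a := Suc (k a))) b + occ S b) / fact ((k(a := Suc (k a))) b)) *
        c (\<lambda>b. (k(a := Suc (k a))) b + occ S b)))" if "S \<subseteq> E" for S
  proof -
    have S: "finite S" "(a, i) \<notin> S" using that E finite_subset by auto
    have "(\<lambda>b. k b + occ (insert (a, i) S) b) = (\<lambda>b. (k(a := Suc (k a))) b + occ S b)"
      using S by (auto simp: occ_insert)
    moreover have "(\<Prod>b\<in>A. fact (k b + occ (insert (a, i) S) b) / fact (k b) :: complex) =
       of_nat (Suc (k a)) * (\<Prod>b\<in>A. fact ((k(a := Suc (k a))) b + occ S b) / fact ((k(a := Suc (k a))) b))"
    proof -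
      have "(\<Prod>b\<in>A - {a}. fact (k b + occ (insert (a, i) S) b) / fact (k b) :: complex) =
          (\<Prod>b\<in>A - {a}. fact ((k(a := Suc (k a))) b + occ S b) / fact ((k(a := Suc (k a))) b))"
        using S by (intro prod.cong) (auto simp: occ_insert)
      moreover have "fact (k a + occ (insert (a, i) S) a) / fact (k a) =
          of_nat (Suc (k a)) * (fact (Suc (k a) + occ S a) / fact (Suc (k a)) :: complex)"
        using S by (simp add: occ_insert field_simps del: of_nat_Suc)
      ultimately show ?thesis using A by (simp add: prod.remove[of A a] mult.assoc del: of_nat_Suc)
    qed
    ultimately show ?thesis using S by (simp add: mult_ac)
  qed
  then show "iter_deriv A (insert (a, i) E) y c k = add_deriv a (y (a, i)) (iter_deriv A E y c) k"
    using E by (simp add: iter_deriv_def add_deriv_def sum_Pow_insert sum_distrib_left)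
qed

lemma iter_deriv_nonzero:
  assumes A: "finite A" and E: "finite E" "E \<subseteq> A \<times> UNIV" and c: "in_box A D c"
    and y: "y \<in> upper_poly E" and nz: "\<And>x. x \<in> upper_poly A \<Longrightarrow> box_poly A D c x \<noteq> 0"
  shows "in_box A D (iter_deriv A E y c) \<and> (\<forall>x\<in>upper_poly A. box_poly A D (iter_deriv A E y c) x \<noteq> 0)"
  using E y
proof (induction E rule: finite_induct)
  case empty
  have "iter_deriv A {} y c = c" by (rule ext) (simp add: iter_deriv_def occ_def)
  then show ?case using c nz by simp
next
  case (insert e E)
  then obtain a i where e: "e = (a, i)" "a \<in> A" by auto
  have "y \<in> upper_poly E" "Im (y (a, i)) > 0" using insert e by (auto simp: upper_poly_def)
  with insert e A show ?case
    by (simp add: iter_deriv_insert in_box_add_deriv box_poly_add_deriv_nonzero)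
qed

text \<open>Apply all operators 1 + y_e d/dx_a to f and read the result as a polynomial in y: it is
  multiaffine, and at x = 0 its coefficient at S is the partial derivative of f of order
  \<open>occ S\<close>. Since 0 is only a boundary point of the upper half plane, the evaluation is
  at i \<epsilon> instead, at the cost of an error below \<delta>.\<close>

lemma multiaffine_approximation:
  assumes A: "finite A" and E: "finite E" "E \<subseteq> A \<times> UNIV" and c: "in_box A D c"
    and nz: "\<And>x. x \<in> upper_poly A \<Longrightarrow> box_poly A D c x \<noteq> 0" and \<delta>: "\<delta> > 0"
  obtains b where "\<And>y. y \<in> upper_poly E \<Longrightarrow> multiaffine E b y \<noteq> 0"
    "\<And>S. S \<subseteq> E \<Longrightarrow> norm (b S - (\<Prod>a\<in>A. fact (occ S a)) * c (restrict (occ S) A)) < \<delta>"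
proof -
  let ?B = "PiE A (\<lambda>_. {..D})"
  have fB: "finite ?B" using A by (intro finite_PiE) auto
  define \<beta> where "\<beta> \<epsilon> S = (\<Sum>k\<in>?B. (\<Prod>a\<in>A. fact (k a + occ S a) / fact (k a)) * c (\<lambda>a. k a + occ S a)
     * (\<Prod>a\<in>A. (\<i> * of_real \<epsilon>) ^ k a))" for \<epsilon> :: real and S
  have \<beta>: "multiaffine E (\<beta> \<epsilon>) y = box_poly A D (iter_deriv A E y c) (\<lambda>_. \<i> * of_real \<epsilon>)" for \<epsilon> y
    unfolding multiaffine_def box_poly_def iter_deriv_def \<beta>_def sum_distrib_right sum_distrib_left
    by (subst sum.swap) (simp add: mult_ac)
  have "(\<lambda>\<epsilon>. \<beta> \<epsilon> S) \<midarrow>0\<rightarrow> (\<Prod>a\<in>A. fact (occ S a)) * c (restrict (occ S) A)" if S: "S \<subseteq> E" for S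
  proof -
    let ?k0 = "restrict (\<lambda>_. 0) A :: 'a \<Rightarrow> nat"
    have "(\<lambda>\<epsilon>. \<beta> \<epsilon> S) \<midarrow>0\<rightarrow> \<beta> 0 S" unfolding \<beta>_def by (intro tendsto_intros)
    \<comment> \<open>At \<epsilon> = 0 only the exponent 0 contributes, through 0 ^ 0 = 1.\<close>
    also have "\<beta> 0 S = (\<Sum>k\<in>{?k0}. (\<Prod>a\<in>A. fact (k a + occ S a) / fact (k a)) * c (\<lambda>a. k a + occ S a)
       * (\<Prod>a\<in>A. (\<i> * of_real 0) ^ k a))"
      unfolding \<beta>_def
    proof (intro sum.mono_neutral_right fB ballI)
      fix k assume "k \<in> ?B - {?k0}"
      then have "k \<in> extensional A" "k \<noteq> ?k0" by (auto simp: PiE_def)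
      then have "\<exists>a\<in>A. k a \<noteq> 0" by (metis extensionalityI restrict_apply restrict_extensional)
      then have "(\<Prod>a\<in>A. (\<i> * of_real 0) ^ k a) = (0 :: complex)" using A by (auto intro!: prod_zero)
      then show "(\<Prod>a\<in>A. fact (k a + occ S a) / fact (k a)) * c (\<lambda>a. k a + occ S a)
       * (\<Prod>a\<in>A. (\<i> * of_real 0) ^ k a) = 0" by simp
    qed auto
    also have "\<dots> = (\<Prod>a\<in>A. fact (occ S a)) * c (\<lambda>a. ?k0 a + occ S a)" by simp
    also have "(\<lambda>a. ?k0 a + occ S a) = restrict (occ S) A"
      using S E occ_eq_0[of S A] by (auto simp: fun_eq_iff restrict_def)
    finally show ?thesis .
  qed
  from tendstoD[OF this \<delta>]
  have "\<forall>\<^sub>F \<epsilon> in at 0. norm (\<beta> \<epsilon> S - (\<Prod>a\<in>A. fact (occ S a)) * c (restrict (occ S) A)) < \<delta>"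
    if "S \<in> Pow E" for S using that by (simp add: dist_norm)
  then have "\<forall>\<^sub>F \<epsilon> in at 0. \<forall>S\<in>Pow E. norm (\<beta> \<epsilon> S - (\<Prod>a\<in>A. fact (occ S a)) * c (restrict (occ S) A)) < \<delta>"
    using E by (intro eventually_ball_finite) auto
  then have "\<forall>\<^sub>F \<epsilon> in at_right 0. \<forall>S\<in>Pow E. norm (\<beta> \<epsilon> S - (\<Prod>a\<in>A. fact (occ S a)) * c (restrict (occ S) A)) < \<delta>"
    by (rule filter_leD[rotated]) (simp add: at_le)
  moreover have "\<forall>\<^sub>F \<epsilon> in at_right (0::real). \<epsilon> > 0" by (simp add: eventually_at_right_less)
  ultimately have "\<forall>\<^sub>F \<epsilon> in at_right 0. \<epsilon> > 0 \<and>
      (\<forall>S\<in>Pow E. norm (\<beta> \<epsilon> S - (\<Prod>a\<in>A. fact (occ S a)) * c (restrict (occ S) A)) < \<delta>)"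
    by eventually_elim simp
  from eventually_happens'[OF _ this] obtain \<epsilon> where "\<epsilon> > 0" and
    "\<forall>S\<in>Pow E. norm (\<beta> \<epsilon> S - (\<Prod>a\<in>A. fact (occ S a)) * c (restrict (occ S) A)) < \<delta>"
    by auto
  moreover have "multiaffine E (\<beta> \<epsilon>) y \<noteq> 0" if "y \<in> upper_poly E" for y
    unfolding \<beta> using iter_deriv_nonzero[OF A E c that nz] \<open>\<epsilon> > 0\<close> by (auto simp: upper_poly_def)
  ultimately show ?thesis by (intro that[of "\<beta> \<epsilon>"]) auto
qed

section \<open>Coefficients from values on the torus\<close>

lemma sum_roots_unity:
  assumes "l < M" "k < M"
  shows "(\<Sum>r<M. cis (2 * pi * real r / real M) ^ l * cnj (cis (2 * pi * real r / real M) ^ k)) = (if l = k then of_nat M else 0)"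
proof -
  let ?u = "cis (2 * pi * real l / real M) * cnj (cis (2 * pi * real k / real M))"
  have eq: "cis (2 * pi * real r / real M) ^ l * cnj (cis (2 * pi * real r / real M) ^ k) = ?u ^ r" for r
  proof -
    have "cis (2 * pi * real r / real M) ^ l = cis (2 * pi * real l / real M) ^ r" for l
      unfolding Complex.DeMoivre by (rule arg_cong[of _ _ cis]) simp
    then show ?thesis by (simp add: power_mult_distrib)
  qed
  have uM: "?u ^ M = 1"
  proof -
    have "cis (2 * pi * real j / real M) ^ M = 1" for j
      using assms by (simp add: Complex.DeMoivre cis_multiple_2pi)
    then show ?thesis by (simp add: power_mult_distrib flip: complex_cnj_power)
  qed
  have S: "(\<Sum>r<M. cis (2 * pi * real r / real M) ^ l * cnj (cis (2 * pi * real r / real M) ^ k)) = (\<Sum>r<M. ?u ^ r)"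
    by (intro sum.cong refl eq)
  show ?thesis unfolding S
  proof (cases "l = k")
    case True
    then have "?u = 1" by (simp add: cis_cnj cis_mult)
    then show "(\<Sum>r<M. ?u ^ r) = (if l = k then of_nat M else 0)" using True by simp
  next
    case False
    have "inj_on (\<lambda>k. cis (2 * pi * real k / real M)) {..<M}"
      using Complex.bij_betw_roots_unity[of M] assms by (auto simp: bij_betw_def)
    then have "cis (2 * pi * real l / real M) \<noteq> cis (2 * pi * real k / real M)"
      using False assms by (auto dest: inj_onD)
    then have "?u \<noteq> 1" 
      by (simp add: cis_cnj cis_inverse[symmetric] field_simps)
    then have "(\<Sum>r<M. ?u ^ r) = 0" using uM by (simp add: geometric_sum)
    then show "(\<Sum>r<M. ?u ^ r) = (if l = k then of_nat M else 0)" using False by simp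
  qed
qed

text \<open>Cauchy's estimate by discrete averaging: finitely many exponents carry all but \<delta>
  of the absolute sum, and on those the average over M-th roots of unity in every coordinate
  isolates the coefficient at \<open>k0\<close> exactly.\<close>

lemma coeff_bound_torus:
  fixes c :: "('v \<Rightarrow> nat) \<Rightarrow> complex"
  assumes A: "finite A" and c: "(\<lambda>k. norm (c k)) summable_on (PiE A (\<lambda>_. UNIV))"
    and g: "\<And>z. z \<in> PiE A (\<lambda>_. sphere 0 1) \<Longrightarrow> ((\<lambda>k. c k * (\<Prod>a\<in>A. z a ^ k a)) has_sum g z) (PiE A (\<lambda>_. UNIV))"
    and \<epsilon>: "\<And>z. z \<in> PiE A (\<lambda>_. sphere 0 1) \<Longrightarrow> norm (g z) \<le> \<epsilon>"
    and k0: "k0 \<in> PiE A (\<lambda>_. UNIV)"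
  shows "norm (c k0) \<le> \<epsilon>"
proof (rule field_le_epsilon)
  fix \<delta> :: real assume "\<delta> > 0"
  let ?I = "PiE A (\<lambda>_. UNIV :: nat set)"
  note cs = c
  obtain F where F: "finite F" "F \<subseteq> ?I" "norm (sum (\<lambda>k. norm (c k)) F - infsum (\<lambda>k. norm (c k)) ?I) \<le> \<delta>"
    using has_sum_finite_approximation[OF has_sum_infsum[OF cs] \<open>\<delta> > 0\<close>] by (auto simp: dist_norm)
  define L where "L = insert k0 F"
  have L: "finite L" "L \<subseteq> ?I" "k0 \<in> L" using F k0 by (auto simp: L_def)
  have cL: "(\<lambda>k. norm (c k)) summable_on (?I - L)" using cs L by (intro summable_on_cofin_subset) auto
  have "sum (\<lambda>k. norm (c k)) F \<le> sum (\<lambda>k. norm (c k)) L" using L by (intro sum_mono2) (auto simp: L_def)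
  moreover have "infsum (\<lambda>k. norm (c k)) (?I - L) = infsum (\<lambda>k. norm (c k)) ?I - sum (\<lambda>k. norm (c k)) L"
    using infsum_Diff[OF cs, of L] L by simp
  ultimately have tail: "infsum (\<lambda>k. norm (c k)) (?I - L) \<le> \<delta>" using F(3) by (auto simp: abs_le_iff)
  \<comment> \<open>M exceeds every exponent in \<open>L\<close>, so different exponents stay
    different modulo M.\<close>
  define M where "M = Suc (Max (insert 0 ((\<lambda>(k, a). k a) ` (L \<times> A))))"
  have M: "k a < M" if "k \<in> L" "a \<in> A" for k a
  proof -
    have "k a \<le> Max (insert 0 ((\<lambda>(k, a). k a) ` (L \<times> A)))"
      using that A L by (intro Max_ge) (auto intro!: rev_image_eqI[of "(k, a)"])
    then show ?thesis by (simp add: M_def)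
  qed
  let ?W = "PiE A (\<lambda>_. {..<M})"
  define z where "z \<omega> = restrict (\<lambda>a. cis (2 * pi * real (\<omega> a) / real M)) A" for \<omega> :: "'v \<Rightarrow> nat"
  have z: "z \<omega> \<in> PiE A (\<lambda>_. sphere 0 1)" for \<omega> by (auto simp: z_def)
  have fW: "finite ?W" "card ?W = M ^ card A" using A by (auto intro!: finite_PiE simp: card_PiE)
  have orth: "(\<Sum>\<omega>\<in>?W. (\<Prod>a\<in>A. z \<omega> a ^ l a) * (\<Prod>a\<in>A. cnj (z \<omega> a ^ k0 a))) = (if l = k0 then of_nat (M ^ card A) else 0)"
    if "l \<in> L" for l
  proof -
    have "(\<Sum>\<omega>\<in>?W. (\<Prod>a\<in>A. z \<omega> a ^ l a) * (\<Prod>a\<in>A. cnj (z \<omega> a ^ k0 a))) =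
       (\<Sum>\<omega>\<in>?W. \<Prod>a\<in>A. (\<lambda>a r. cis (2 * pi * real r / real M) ^ l a * cnj (cis (2 * pi * real r / real M) ^ k0 a)) a (\<omega> a))"
      unfolding prod.distrib[symmetric] by (intro sum.cong prod.cong) (auto simp: z_def)
    also have "\<dots> = (\<Prod>a\<in>A. \<Sum>r<M. cis (2 * pi * real r / real M) ^ l a * cnj (cis (2 * pi * real r / real M) ^ k0 a))"
      using A by (subst prod_sum_PiE) auto
    also have "\<dots> = (\<Prod>a\<in>A. if l a = k0 a then of_nat M else 0)"
      using M that L by (intro prod.cong sum_roots_unity) auto
    also have "\<dots> = (if l = k0 then of_nat (M ^ card A) else 0)"
    proof (cases "l = k0")
      case False
      then have "\<exists>a\<in>A. l a \<noteq> k0 a" using that L k0 by (meson PiE_ext subsetD)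
      then show ?thesis using False A by (auto intro!: prod_zero)
    qed simp
    finally show ?thesis .
  qed
  have bd: "norm (\<Sum>l\<in>L. c l * (\<Prod>a\<in>A. z \<omega> a ^ l a)) \<le> \<epsilon> + \<delta>" for \<omega>
  proof -
    let ?s = "\<Sum>l\<in>L. c l * (\<Prod>a\<in>A. z \<omega> a ^ l a)"
    have "((\<lambda>k. c k * (\<Prod>a\<in>A. z \<omega> a ^ k a)) has_sum (g (z \<omega>) - ?s)) (?I - L)"
      using has_sum_Diff[OF g[OF z] has_sum_finite[OF L(1)] L(2)] .
    then have "norm (g (z \<omega>) - ?s) \<le> infsum (\<lambda>k. norm (c k)) (?I - L)"
    proof (rule norm_has_sum_bound[rotated])
      have "norm (c k * (\<Prod>a\<in>A. z \<omega> a ^ k a)) = norm (c k)" for k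
      proof -
        have "norm (\<Prod>a\<in>A. z \<omega> a ^ k a) = 1" unfolding prod_norm[symmetric] by (intro prod.neutral) (auto simp: z_def norm_power)
        then show ?thesis by (simp add: norm_mult)
      qed
      then show "((\<lambda>k. norm (c k * (\<Prod>a\<in>A. z \<omega> a ^ k a))) has_sum infsum (\<lambda>k. norm (c k)) (?I - L)) (?I - L)"
        using has_sum_infsum[OF cL] by simp
    qed
    then show ?thesis using tail \<epsilon>[OF z[of \<omega>]] norm_triangle_sub[of ?s "g (z \<omega>)"] norm_minus_commute[of ?s "g (z \<omega>)"] by linarith
  qed
  have "of_nat (M ^ card A) * c k0 = (\<Sum>l\<in>L. c l * (\<Sum>\<omega>\<in>?W. (\<Prod>a\<in>A. z \<omega> a ^ l a) * (\<Prod>a\<in>A. cnj (z \<omega> a ^ k0 a))))"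
  proof -
    have "of_nat (M ^ card A) * c k0 = (\<Sum>l\<in>L. if l = k0 then c l * of_nat (M ^ card A) else 0)"
      using L by (simp add: mult.commute)
    also have "\<dots> = (\<Sum>l\<in>L. c l * (\<Sum>\<omega>\<in>?W. (\<Prod>a\<in>A. z \<omega> a ^ l a) * (\<Prod>a\<in>A. cnj (z \<omega> a ^ k0 a))))"
      by (intro sum.cong refl, subst orth) auto
    finally show ?thesis .
  qed
  also have "\<dots> = (\<Sum>\<omega>\<in>?W. (\<Sum>l\<in>L. c l * (\<Prod>a\<in>A. z \<omega> a ^ l a)) * (\<Prod>a\<in>A. cnj (z \<omega> a ^ k0 a)))"
    unfolding sum_distrib_left sum_distrib_right by (subst sum.swap) (simp add: mult.assoc)
  finally have "norm (of_nat (M ^ card A) * c k0) \<le> (\<Sum>\<omega>\<in>?W. \<epsilon> + \<delta>)"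
  proof (simp only:, intro sum_norm_le)
    fix \<omega>
    have "norm (\<Prod>a\<in>A. cnj (z \<omega> a ^ k0 a)) = 1" unfolding prod_norm[symmetric]
      by (intro prod.neutral) (auto simp: z_def norm_power)
    then show "norm ((\<Sum>l\<in>L. c l * (\<Prod>a\<in>A. z \<omega> a ^ l a)) * (\<Prod>a\<in>A. cnj (z \<omega> a ^ k0 a))) \<le> \<epsilon> + \<delta>"
      using bd[of \<omega>] by (simp add: norm_mult)
  qed
  then have "real (M ^ card A) * norm (c k0) \<le> real (M ^ card A) * (\<epsilon> + \<delta>)"
    by (simp add: norm_mult fW norm_power)
  moreover have "real (M ^ card A) > 0" by (simp add: M_def)
  ultimately show "norm (c k0) \<le> \<epsilon> + \<delta>" by (simp only: mult_le_cancel_left_pos)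
qed

section \<open>Homogenized multiaffine polynomials\<close>

text \<open>An expectation without normalization, so that conditioning is a change of weights and
  never a division.\<close>

definition wsum :: "'e set \<Rightarrow> ('e set \<Rightarrow> real) \<Rightarrow> ('e set \<Rightarrow> real) \<Rightarrow> real" where
  "wsum E a F = (\<Sum>S\<in>Pow E. a S * F S)"

text \<open>The truncated exponent \<open>d - card S\<close> is harmless: below, \<open>a S = 0\<close> whenever \<open>card S > d\<close>.\<close>

definition hom_poly :: "'e set \<Rightarrow> nat \<Rightarrow> ('e set \<Rightarrow> real) \<Rightarrow> ('e \<Rightarrow> complex) \<Rightarrow> complex \<Rightarrow> complex" where
  "hom_poly E d a z w = (\<Sum>S\<in>Pow E. of_real (a S) * (\<Prod>e\<in>S. z e) * w ^ (d - card S))"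

text \<open>Strict positivity on all sets of at most d elements ensures that no deletion, and no
  contraction for d \<ge> 1, yields the zero polynomial, so that Hurwitz's theorem always has a
  nonzero value to start from.\<close>

definition hom_stable :: "'e set \<Rightarrow> nat \<Rightarrow> ('e set \<Rightarrow> real) \<Rightarrow> bool" where
  "hom_stable E d a \<longleftrightarrow> finite E \<and> (\<forall>S\<subseteq>E. if card S \<le> d then a S > 0 else a S = 0) \<and>
     (\<forall>z\<in>upper_poly E. \<forall>w. Im w > 0 \<longrightarrow> hom_poly E d a z w \<noteq> 0)"

text \<open>
  Differentiation of the homogenization: with respect to \<open>z\<^sub>e\<close> for \<open>Some e\<close> (conditioning on the
  presence of \<open>e\<close>), and with respect to the additional variable for \<open>None\<close>.
\<close>

fun contract :: "nat \<Rightarrow> 'e option \<Rightarrow> ('e set \<Rightarrow> real) \<Rightarrow> 'e set \<Rightarrow> real" where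
  "contract d None a S = real (d - card S) * a S"
| "contract d (Some e) a S = a (insert e S)"

fun remove :: "'e option \<Rightarrow> 'e set \<Rightarrow> 'e set" where
  "remove None E = E"
| "remove (Some e) E = E - {e}"

lemma wsum_split:
  assumes "finite E" "e \<in> E"
  shows "wsum E a F = wsum (E - {e}) a F + wsum (E - {e}) (contract d (Some e) a) (\<lambda>S. F (insert e S))"
  using sum_Pow_insert[of "E - {e}" e "\<lambda>S. a S * F S"] assms by (simp add: wsum_def insert_absorb)

lemma hom_poly_split:
  assumes "finite E" "e \<in> E"
  shows "hom_poly E d a z w = hom_poly (E - {e}) d a z w + z e * hom_poly (E - {e}) (d - 1) (contract d (Some e) a) z w"
proof -
  \<comment> \<open>The exponents agree even for truncated subtraction: d - (card S + 1) = d - 1 -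
    card S.\<close>
  have "of_real (a (insert e S)) * (\<Prod>e\<in>insert e S. z e) * w ^ (d - card (insert e S)) =
    z e * (of_real (contract d (Some e) a S) * (\<Prod>e\<in>S. z e) * w ^ (d - 1 - card S))" if "S \<in> Pow (E - {e})" for S
  proof -
    have "finite S" "e \<notin> S" using that assms by (auto intro: finite_subset)
    then show ?thesis by (simp add: mult_ac)
  qed
  then have "(\<Sum>S\<in>Pow (E - {e}). of_real (a (insert e S)) * (\<Prod>e\<in>insert e S. z e) * w ^ (d - card (insert e S))) =
      z e * hom_poly (E - {e}) (d - 1) (contract d (Some e) a) z w"
    unfolding hom_poly_def sum_distrib_left by (intro sum.cong refl)
  then show ?thesis
    using sum_Pow_insert[of "E - {e}" e "\<lambda>S. of_real (a S) * (\<Prod>e\<in>S. z e) * w ^ (d - card S)"] assms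
    by (simp add: hom_poly_def insert_absorb)
qed

lemma hom_poly_cong:
  assumes "\<And>e. e \<in> E \<Longrightarrow> z e = z' e" shows "hom_poly E d a z w = hom_poly E d a z' w"
  unfolding hom_poly_def using assms by (intro sum.cong arg_cong2[of _ _ _ _ "(*)"] prod.cong refl) auto

text \<open>Every monomial has total degree d in z and w. At (i, ..., i) this supplies the nonzero
  value that Hurwitz's theorem asks for.\<close>

lemma hom_poly_diagonal:
  assumes "\<And>S. S \<subseteq> E \<Longrightarrow> card S > d \<Longrightarrow> a S = 0"
  shows "hom_poly E d a (\<lambda>_. x) x = x ^ d * of_real (wsum E a (\<lambda>_. 1))"
proof -
  have "of_real (a S) * (\<Prod>e\<in>S. x) * x ^ (d - card S) = x ^ d * of_real (a S)" if "S \<subseteq> E" for S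
  proof (cases "card S \<le> d")
    case True
    then show ?thesis by (simp flip: power_add)
  qed (use assms that in auto)
  then show ?thesis unfolding hom_poly_def wsum_def of_real_sum sum_distrib_left
    by (intro sum.cong) auto
qed

lemma wsum_one_pos:
  assumes "finite E" "\<forall>S\<subseteq>E. if card S \<le> d then a S > 0 else a S = 0"
  shows "wsum E a (\<lambda>_. 1) > 0"
  unfolding wsum_def
proof (rule sum_pos2[of _ "{}"])
  show "0 \<le> a S * 1" if "S \<in> Pow E" for S
    using that assms(2)[rule_format, of S] by (cases "card S \<le> d") auto
  show "0 < a {} * 1" using assms(2)[rule_format, of "{}"] by auto
qed (use assms(1) in auto)

lemma hom_stable_wsum_pos: "hom_stable E d a \<Longrightarrow> wsum E a (\<lambda>_. 1) > 0"
  unfolding hom_stable_def by (blast intro: wsum_one_pos)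

text \<open>Hurwitz along a pencil p1 + c p2 with c tending to 0. The homogenizing variable is
  treated as one more coordinate, \<open>None\<close>, and the segment ends at (i, ..., i).\<close>

lemma hom_poly_pencil_limit:
  assumes E: "finite E"
    and nz: "\<And>n z w. z \<in> upper_poly E \<Longrightarrow> Im w > 0 \<Longrightarrow> hom_poly E d1 a1 z w + c n * hom_poly E d2 a2 z w \<noteq> 0"
    and c: "c \<longlonglongrightarrow> 0" and i: "hom_poly E d1 a1 (\<lambda>_. \<i>) \<i> \<noteq> 0"
    and z: "z \<in> upper_poly E" and w: "Im w > 0"
  shows "hom_poly E d1 a1 z w \<noteq> 0"
proof -
  let ?E = "insert None (Some ` E)"
  let ?u = "\<lambda>v. case v of None \<Rightarrow> w | Some e \<Rightarrow> z e"
  let ?L = "\<lambda>s v. ?u v + s * ((\<lambda>_. \<i>) v - ?u v)"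
  have u: "?u \<in> upper_poly ?E" "(\<lambda>_. \<i>) \<in> upper_poly ?E" using z w by (auto simp: upper_poly_def)
  define U where "U = {s. ?L s \<in> upper_poly ?E}"
  have fE: "finite ?E" using E by simp
  note U = segment_upper_poly[OF fE u, folded U_def]
  \<comment> \<open>The finite sum is indexed by a Boolean: True selects the limit polynomial, False
    the perturbation.\<close>
  define g where "g = (\<lambda>j s. if j then hom_poly E d1 a1 (\<lambda>e. ?L s (Some e)) (?L s None)
                            else hom_poly E d2 a2 (\<lambda>e. ?L s (Some e)) (?L s None))"
  have "(\<Sum>j\<in>UNIV. (if j then 1 else 0) * g j 0) \<noteq> 0"
  proof (rule hurwitz_finite_sum[of UNIV U g "\<lambda>n j. if j then 1 else c n" "\<lambda>j. if j then 1 else 0" 1])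
    show "g j holomorphic_on U" for j
      by (cases j) (auto simp: g_def hom_poly_def intro!: holomorphic_intros)
    show "(\<lambda>n. if j then 1 else c n) \<longlonglongrightarrow> (if j then 1 else 0)" for j
      using c by (cases j) auto
    show "(\<Sum>j\<in>UNIV. (if j then 1 else c n) * g j s) \<noteq> 0" if "s \<in> U" for n s
    proof -
      have "(\<lambda>e. ?L s (Some e)) \<in> upper_poly E" "Im (?L s None) > 0"
        using that by (auto simp: U_def upper_poly_def)
      from nz[OF this, of n] show ?thesis by (simp add: UNIV_bool g_def add.commute)
    qed
    show "(\<Sum>j\<in>UNIV. (if j then 1 else 0) * g j 1) \<noteq> 0" using i by (simp add: UNIV_bool g_def)
  qed (use U in auto)
  then show ?thesis by (simp add: UNIV_bool g_def)
qed

text \<open>Deletion is the substitution z_e = 0, a boundary point reached through z_e = i / (n +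
  1).\<close>

lemma hom_stable_delete:
  assumes a: "hom_stable E d a" and e: "e \<in> E"
  shows "hom_stable (E - {e}) d a"
proof -
  have E: "finite E" and nz: "\<And>z w. z \<in> upper_poly E \<Longrightarrow> Im w > 0 \<Longrightarrow> hom_poly E d a z w \<noteq> 0"
    and pos: "\<forall>S\<subseteq>E - {e}. if card S \<le> d then a S > 0 else a S = 0"
    using a unfolding hom_stable_def by blast+
  have "hom_poly (E - {e}) d a z w \<noteq> 0" if "z \<in> upper_poly (E - {e})" "Im w > 0" for z w
  proof (rule hom_poly_pencil_limit[where c = "\<lambda>n. \<i> / of_nat (Suc n)" and ?d2.0 = "d - 1" and ?a2.0 = "contract d (Some e) a"])
    fix n z w assume z: "z \<in> upper_poly (E - {e})" and w: "Im w > 0"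
    let ?z = "z(e := \<i> / of_nat (Suc n))"
    have "Im (\<i> / of_nat (Suc n)) > 0" by (simp add: Im_divide_of_nat del: of_nat_Suc)
    then have "?z \<in> upper_poly E" using z by (auto simp: upper_poly_def)
    from nz[OF this w] show "hom_poly (E - {e}) d a z w
        + \<i> / of_nat (Suc n) * hom_poly (E - {e}) (d - 1) (contract d (Some e) a) z w \<noteq> 0"
      using hom_poly_split[OF E e, of d a ?z w] hom_poly_cong[of "E - {e}" ?z z] by simp
  next
    show "(\<lambda>n. \<i> / of_nat (Suc n)) \<longlonglongrightarrow> 0" by (rule tendsto_const_over_Suc)
    have "hom_poly (E - {e}) d a (\<lambda>_. \<i>) \<i> = \<i> ^ d * of_real (wsum (E - {e}) a (\<lambda>_. 1))"
    proof (rule hom_poly_diagonal)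
      fix S assume "S \<subseteq> E - {e}" "card S > d"
      then show "a S = 0" using pos[rule_format, of S] by (simp split: if_splits)
    qed
    moreover have "wsum (E - {e}) a (\<lambda>_. 1) > 0" using wsum_one_pos[OF _ pos] E by blast
    ultimately show "hom_poly (E - {e}) d a (\<lambda>_. \<i>) \<i> \<noteq> 0" by simp
  qed (use E that in auto)
  then show ?thesis unfolding hom_stable_def using E pos by blast
qed

text \<open>For \<open>Some e\<close>, the derivative is the leading coefficient in z_e: divide by
  z_e and let it tend to infinity. For \<open>None\<close>, this is the Gauss-Lucas theorem in the
  form of the sign of the logarithmic derivative.\<close>

lemma hom_stable_contract:
  assumes a: "hom_stable E d a" and v: "v \<in> insert None (Some ` E)" and d: "d \<ge> 1"
  shows "hom_stable (remove v E) (d - 1) (contract d v a)"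
proof -
  have E: "finite E" and nz: "\<And>z w. z \<in> upper_poly E \<Longrightarrow> Im w > 0 \<Longrightarrow> hom_poly E d a z w \<noteq> 0"
    and pos: "\<forall>S\<subseteq>E. if card S \<le> d then a S > 0 else a S = 0"
    using a unfolding hom_stable_def by blast+
  have pos': "\<forall>S\<subseteq>remove v E. if card S \<le> d - 1 then contract d v a S > 0 else contract d v a S = 0"
  proof (intro allI impI)
    fix S assume S: "S \<subseteq> remove v E"
    show "if card S \<le> d - 1 then contract d v a S > 0 else contract d v a S = 0"
    proof (cases v)
      case None
      then show ?thesis using S d pos[rule_format, of S] by (auto split: if_splits)
    next
      case (Some e)
      then have "finite S" "e \<notin> S" "insert e S \<subseteq> E" using S v E by (auto intro: finite_subset)
      then show ?thesis using S d pos[rule_format, of "insert e S"] Some by (auto split: if_splits)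
    qed
  qed
  have fin: "finite (remove v E)" using E by (cases v) auto
  have "hom_poly (remove v E) (d - 1) (contract d v a) z w \<noteq> 0"
    if z: "z \<in> upper_poly (remove v E)" and w: "Im w > 0" for z w
  proof (cases v)
    case (Some e)
    then have e: "e \<in> E" using v by auto
    have pos'': "\<forall>S\<subseteq>E - {e}. if card S \<le> d - 1 then contract d (Some e) a S > 0 else contract d (Some e) a S = 0"
      using pos' unfolding Some remove.simps .
    have "hom_poly (E - {e}) (d - 1) (contract d (Some e) a) z w \<noteq> 0"
    proof (rule hom_poly_pencil_limit[where c = "\<lambda>n. - \<i> / of_nat (Suc n)" and ?d2.0 = d and ?a2.0 = a])
      fix n z w assume z: "z \<in> upper_poly (E - {e})" and w: "Im w > 0"
      \<comment> \<open>z_e runs to infinity along the imaginary axis; \<open>c\<close> below is its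
        inverse.\<close>
      let ?s = "\<i> * of_nat (Suc n)"
      have "z(e := ?s) \<in> upper_poly E" using z by (auto simp: upper_poly_def simp del: of_nat_Suc)
      from nz[OF this w] have *: "hom_poly (E - {e}) d a z w
          + ?s * hom_poly (E - {e}) (d - 1) (contract d (Some e) a) z w \<noteq> 0"
        using hom_poly_split[OF E e, of d a "z(e := ?s)" w] hom_poly_cong[of "E - {e}" "z(e := ?s)" z] by simp
      define c where "c = - \<i> / of_nat (Suc n)"
      have c: "c \<noteq> 0" "c * ?s = 1" by (simp_all add: c_def del: of_nat_Suc)
      have "c * (x + ?s * y) = y + c * x" for x y :: complex
        using c(2) by (simp only: distrib_left mult.assoc[symmetric]) simp
      then show "hom_poly (E - {e}) (d - 1) (contract d (Some e) a) z w
          + - \<i> / of_nat (Suc n) * hom_poly (E - {e}) d a z w \<noteq> 0"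
        unfolding c_def[symmetric] using * c(1) by (metis no_zero_divisors)
    next
      show "(\<lambda>n. - \<i> / of_nat (Suc n)) \<longlonglongrightarrow> 0" by (rule tendsto_const_over_Suc)
      have "hom_poly (E - {e}) (d - 1) (contract d (Some e) a) (\<lambda>_. \<i>) \<i> =
          \<i> ^ (d - 1) * of_real (wsum (E - {e}) (contract d (Some e) a) (\<lambda>_. 1))"
      proof (rule hom_poly_diagonal)
        fix S assume "S \<subseteq> E - {e}" "card S > d - 1"
        then show "contract d (Some e) a S = 0" using pos''[rule_format, of S] by (simp split: if_splits)
      qed
      moreover have "wsum (E - {e}) (contract d (Some e) a) (\<lambda>_. 1) > 0" using wsum_one_pos[OF _ pos''] E by blast
      ultimately show "hom_poly (E - {e}) (d - 1) (contract d (Some e) a) (\<lambda>_. \<i>) \<i> \<noteq> 0" by simp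
    qed (use E z w Some in auto)
    then show ?thesis using Some by simp
  next
    case None
    define q where "q = (\<Sum>S\<in>Pow E. monom (of_real (a S) * (\<Prod>e\<in>S. z e)) (d - card S))"
    have q: "poly q s = hom_poly E d a z s" for s
      by (simp add: q_def hom_poly_def poly_sum poly_monom)
    \<comment> \<open>The coefficient of w^d is \<open>a {}\<close>, so q is nonconstant and the
      strict sign is available.\<close>
    have "coeff q d = (\<Sum>S\<in>Pow E. if S = {} then of_real (a {}) else 0)"
      unfolding q_def coeff_sum
    proof (intro sum.cong refl)
      fix S assume "S \<in> Pow E"
      then have "finite S" using E finite_subset by auto
      then have "card S = 0 \<longleftrightarrow> S = {}" by simp
      then show "coeff (monom (of_real (a S) * (\<Prod>e\<in>S. z e)) (d - card S)) d = (if S = {} then of_real (a {}) else 0)"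
        using d by auto
    qed
    also have "\<dots> \<noteq> 0" using E pos[rule_format, of "{}"] by simp
    finally have "degree q > 0" using d le_degree[of q d] by auto
    moreover have "poly q s \<noteq> 0" if "Im s > 0" for s unfolding q using nz z that None by simp
    ultimately have "Im (poly (pderiv q) w / poly q w) < 0"
      using Im_logarithmic_derivative(2)[of q w] w by blast
    then have "poly (pderiv q) w \<noteq> 0" by auto
    also have "poly (pderiv q) w = hom_poly E (d - 1) (contract d None a) z w"
      unfolding q_def hom_poly_def
      by (simp add: higher_pderiv_sum[of 1, simplified] pderiv_monom poly_sum poly_monom mult.assoc)
    finally show ?thesis using None by simp
  qed
  then show ?thesis unfolding hom_stable_def using fin pos' by blast
qed

section \<open>Negative association for multiaffine weights\<close>

text \<open>The zero -A / B lies in the closed lower half plane, and Im (A / B) has the sign of Im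
  (A * cnj B).\<close>

lemma Im_mult_cnj_nonneg:
  assumes "\<And>x. Im x > 0 \<Longrightarrow> A + x * B \<noteq> 0"
  shows "Im (A * cnj B) \<ge> 0"
proof (cases "B = 0")
  case False
  have "\<not> Im (- A / B) > 0" using assms[of "- A / B"] False by auto
  moreover have "Im (- A / B) = - Im (A * cnj B) / (cmod B)\<^sup>2"
    by (simp add: Im_divide cmod_power2 diff_divide_distrib)
  moreover have "(cmod B)\<^sup>2 > 0" using False by simp
  ultimately show ?thesis by (smt (verit) divide_pos_pos)
qed simp

text \<open>Evaluation with x in place of the variable \<open>v\<close> and u everywhere else. Two
  parameters are kept because u has to reach 1 before the derivative in x is taken.\<close>

definition hom_line :: "'e set \<Rightarrow> nat \<Rightarrow> 'e option \<Rightarrow> ('e set \<Rightarrow> real) \<Rightarrow> complex \<Rightarrow> complex \<Rightarrow> complex" where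
  "hom_line E d v a u x = hom_poly E d a (\<lambda>e. if v = Some e then x else u) (if v = None then x else u)"

lemma hom_line_one: "hom_line E d v a 1 1 = of_real (wsum E a (\<lambda>_. 1))"
  by (auto simp: hom_line_def hom_poly_def wsum_def)

lemma hom_line_deriv:
  assumes "finite E" "v \<in> insert None (Some ` E)"
  shows "((\<lambda>x. hom_line E d v a 1 x) has_field_derivative of_real (wsum (remove v E) (contract d v a) (\<lambda>_. 1))) (at 1)"
proof (cases v)
  case None
  have "((\<lambda>x. \<Sum>S\<in>Pow E. of_real (a S) * x ^ (d - card S)) has_field_derivative
      (\<Sum>S\<in>Pow E. of_real (a S) * (of_nat (d - card S) * 1 ^ (d - card S - 1)))) (at (1::complex))"
    by (intro DERIV_sum DERIV_cmult) (auto intro!: derivative_eq_intros)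
  then show ?thesis using None by (simp add: hom_line_def hom_poly_def wsum_def mult.commute)
next
  case (Some e)
  then have e: "e \<in> E" using assms by auto
  have "hom_line E d v a 1 x = hom_poly (E - {e}) d a (\<lambda>_. 1) 1 + x * of_real (wsum (remove v E) (contract d v a) (\<lambda>_. 1))" for x
  proof -
    have "hom_poly (E - {e}) d' b (\<lambda>e. if v = Some e then x else 1) 1 = hom_poly (E - {e}) d' b (\<lambda>_. 1) 1" for d' b
      using Some by (intro hom_poly_cong) auto
    then show ?thesis unfolding hom_line_def hom_poly_split[OF assms(1) e] using Some
      by (simp add: hom_poly_def wsum_def)
  qed
  then show ?thesis by (auto intro!: derivative_eq_intros)
qed

text \<open>The Rayleigh inequality at (1, ..., 1). Writing the polynomial as A + z_j B, stability
  gives Im (A * cnj B) \<ge> 0 as long as the other variables are in the upper half plane. If only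
  \<open>v\<close> moves, along 1 + i t, this quantity is 0 at t = 0, so its derivative there, A1 *
  B0 - A0 * B1, is nonnegative.\<close>

lemma pair_negatively_correlated:
  assumes a: "hom_stable E d a" and j: "j \<in> E" and v: "v \<in> insert None (Some ` E)" "v \<noteq> Some j"
  defines "E' \<equiv> E - {j}" and "c \<equiv> contract d (Some j) a"
  shows "wsum E' a (\<lambda>_. 1) * wsum (remove v E') (contract (d - 1) v c) (\<lambda>_. 1)
     \<le> wsum (remove v E') (contract d v a) (\<lambda>_. 1) * wsum E' c (\<lambda>_. 1)"
proof -
  have E: "finite E" and nz: "\<And>z w. z \<in> upper_poly E \<Longrightarrow> Im w > 0 \<Longrightarrow> hom_poly E d a z w \<noteq> 0"
    using a unfolding hom_stable_def by blast+
  have fE': "finite E'" and v': "v \<in> insert None (Some ` E')" using E v by (auto simp: E'_def)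
  let ?A = "hom_line E' d v a" and ?B = "hom_line E' (d - 1) v c"
  have 1: "Im (?A (1 + \<i> * of_real \<epsilon>) (1 + \<i> * of_real \<delta>) * cnj (?B (1 + \<i> * of_real \<epsilon>) (1 + \<i> * of_real \<delta>))) \<ge> 0"
    if "\<epsilon> > 0" "\<delta> > 0" for \<epsilon> \<delta> :: real
  proof (rule Im_mult_cnj_nonneg)
    fix x assume x: "Im x > 0"
    let ?z = "\<lambda>e. if v = Some e then 1 + \<i> * of_real \<delta> else 1 + \<i> * of_real \<epsilon>"
    let ?w = "if v = None then 1 + \<i> * of_real \<delta> else 1 + \<i> * of_real \<epsilon>"
    have "hom_poly E d a (?z(j := x)) ?w \<noteq> 0" using that x by (intro nz) (auto simp: upper_poly_def)
    moreover have "hom_poly E' d' b (?z(j := x)) ?w = hom_poly E' d' b ?z ?w" for d' b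
      by (intro hom_poly_cong) (auto simp: E'_def)
    ultimately show "?A (1 + \<i> * of_real \<epsilon>) (1 + \<i> * of_real \<delta>) + x * ?B (1 + \<i> * of_real \<epsilon>) (1 + \<i> * of_real \<delta>) \<noteq> 0"
      unfolding hom_line_def hom_poly_split[OF E j] E'_def[symmetric] c_def[symmetric] by simp
  qed
  \<comment> \<open>All variables but \<open>v\<close> tend to 1, which keeps the weak
    inequality.\<close>
  have 2: "Im (?A 1 (1 + \<i> * of_real \<delta>) * cnj (?B 1 (1 + \<i> * of_real \<delta>))) \<ge> 0" if "\<delta> > 0" for \<delta> :: real
  proof (rule tendsto_lowerbound)
    have cont: "((\<lambda>\<epsilon>::real. hom_line E' d' v b (1 + \<i> * of_real \<epsilon>) x) \<longlongrightarrow> hom_line E' d' v b (1 + \<i> * of_real 0) x) (at_right 0)" for d' b x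
    proof -
      have "((\<lambda>\<epsilon>. if P then x else 1 + \<i> * of_real \<epsilon>) \<longlongrightarrow> (if P then x else 1 + \<i> * of_real 0)) (at_right 0)" for P
        by (cases P) (auto intro!: tendsto_eq_intros)
      then show ?thesis unfolding hom_line_def hom_poly_def
        by (intro tendsto_sum tendsto_mult tendsto_const tendsto_prod tendsto_power)
    qed
    show "((\<lambda>\<epsilon>. Im (?A (1 + \<i> * of_real \<epsilon>) (1 + \<i> * of_real \<delta>) * cnj (?B (1 + \<i> * of_real \<epsilon>) (1 + \<i> * of_real \<delta>))))
      \<longlongrightarrow> Im (?A 1 (1 + \<i> * of_real \<delta>) * cnj (?B 1 (1 + \<i> * of_real \<delta>)))) (at_right 0)"
      using tendsto_Im[OF tendsto_mult[OF cont tendsto_cnj[OF cont]]] by simp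
    show "\<forall>\<^sub>F \<epsilon> in at_right 0. 0 \<le> Im (?A (1 + \<i> * of_real \<epsilon>) (1 + \<i> * of_real \<delta>) * cnj (?B (1 + \<i> * of_real \<epsilon>) (1 + \<i> * of_real \<delta>)))"
      using eventually_at_right_less[of "0::real"] by eventually_elim (use 1 that in auto)
  qed simp
  define A0 A1 B0 B1 where d: "A0 = wsum E' a (\<lambda>_. 1)" "A1 = wsum (remove v E') (contract d v a) (\<lambda>_. 1)"
    "B0 = wsum E' c (\<lambda>_. 1)" "B1 = wsum (remove v E') (contract (d - 1) v c) (\<lambda>_. 1)"
  have path: "((\<lambda>t. 1 + \<i> * of_real t) has_vector_derivative \<i>) (at (0::real))"
    by (auto intro!: derivative_eq_intros)
  have dA: "((\<lambda>t. ?A 1 (1 + \<i> * of_real t)) has_vector_derivative \<i> * of_real A1) (at (0::real))"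
    using field_vector_diff_chain_at[OF path, of "?A 1" "of_real A1"] hom_line_deriv[OF fE' v', of d a]
    by (simp add: d o_def)
  have dB: "((\<lambda>t. ?B 1 (1 + \<i> * of_real t)) has_vector_derivative \<i> * of_real B1) (at (0::real))"
    using field_vector_diff_chain_at[OF path, of "?B 1" "of_real B1"] hom_line_deriv[OF fE' v', of "d - 1" c]
    by (simp add: d o_def)
  have "((\<lambda>t. ?A 1 (1 + \<i> * of_real t) * cnj (?B 1 (1 + \<i> * of_real t))) has_vector_derivative
      \<i> * of_real (A1 * B0 - A0 * B1)) (at (0::real))"
    using has_vector_derivative_mult[OF dA has_vector_derivative_cnj[OF dB]]
    by (simp add: hom_line_one d algebra_simps)
  then have "((\<lambda>t. Im (?A 1 (1 + \<i> * of_real t) * cnj (?B 1 (1 + \<i> * of_real t)))) has_real_derivative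
      (A1 * B0 - A0 * B1)) (at (0::real))"
    using has_derivative_Im unfolding has_vector_derivative_def has_field_derivative_def
    by (fastforce simp: mult_commute_abs)
  then have "A1 * B0 - A0 * B1 \<ge> 0"
  proof (rule contrapos_pp)
    define f where "f t = Im (?A 1 (1 + \<i> * of_real t) * cnj (?B 1 (1 + \<i> * of_real t)))" for t :: real
    assume n: "\<not> A1 * B0 - A0 * B1 \<ge> 0"
    have "\<not> (f has_real_derivative (A1 * B0 - A0 * B1)) (at (0::real))"
    proof
      assume "(f has_real_derivative (A1 * B0 - A0 * B1)) (at (0::real))"
      from DERIV_neg_dec_right[OF this] n obtain e where e: "e > 0" "\<And>h. h > 0 \<Longrightarrow> h < e \<Longrightarrow> f (0 + h) < f 0" by auto
      have "f (e / 2) < f 0" using e(1) e(2)[of "e / 2"] by simp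
      moreover have "f 0 = 0" by (simp add: f_def hom_line_one)
      moreover have "f (e / 2) \<ge> 0" unfolding f_def using 2[of "e / 2"] \<open>e > 0\<close> by simp
      ultimately show False by simp
    qed
    then show "\<not> ((\<lambda>t. Im (?A 1 (1 + \<i> * of_real t) * cnj (?B 1 (1 + \<i> * of_real t)))) has_real_derivative
      (A1 * B0 - A0 * B1)) (at (0::real))" unfolding f_def[abs_def] .
  qed
  then show ?thesis by (simp add: d)
qed

text \<open>Euler's identity for a homogeneous polynomial of degree d: a set S is counted
  \<open>card S\<close> times through its elements and \<open>d - card S\<close> times through
  \<open>None\<close>.\<close>

lemma wsum_homogeneous:
  assumes E: "finite E" and a: "\<And>S. S \<subseteq> E \<Longrightarrow> card S > d \<Longrightarrow> a S = 0"
  shows "(\<Sum>j\<in>E. wsum (E - {j}) (contract d (Some j) a) (\<lambda>S. F (insert j S))) + wsum E (contract d None a) F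
     = real d * wsum E a F"
proof -
  have "wsum (E - {j}) (contract d (Some j) a) (\<lambda>S. F (insert j S)) = (\<Sum>S\<in>Pow E. if j \<in> S then a S * F S else 0)"
    if "j \<in> E" for j
  proof -
    have "(\<Sum>S\<in>Pow E. if j \<in> S then a S * F S else 0) =
      (\<Sum>S\<in>Pow (E - {j}). if j \<in> S then a S * F S else 0) + (\<Sum>S\<in>Pow (E - {j}). a (insert j S) * F (insert j S))"
      using sum_Pow_insert[of "E - {j}" j "\<lambda>S. if j \<in> S then a S * F S else 0"] E that by (simp add: insert_absorb)
    moreover have "(\<Sum>S\<in>Pow (E - {j}). if j \<in> S then a S * F S else 0) = 0" by (intro sum.neutral) auto
    ultimately show ?thesis by (simp add: wsum_def)
  qed
  then have "(\<Sum>j\<in>E. wsum (E - {j}) (contract d (Some j) a) (\<lambda>S. F (insert j S))) =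
      (\<Sum>S\<in>Pow E. \<Sum>j\<in>E. if j \<in> S then a S * F S else 0)"
    by (simp add: sum.swap[of _ "Pow E"])
  also have "\<dots> = (\<Sum>S\<in>Pow E. real (card S) * (a S * F S))"
  proof (intro sum.cong refl)
    fix S assume "S \<in> Pow E"
    then have "E \<inter> {j. j \<in> S} = S" by auto
    then show "(\<Sum>j\<in>E. if j \<in> S then a S * F S else 0) = real (card S) * (a S * F S)"
      using E by (simp add: sum.If_cases)
  qed
  finally have "(\<Sum>j\<in>E. wsum (E - {j}) (contract d (Some j) a) (\<lambda>S. F (insert j S))) + wsum E (contract d None a) F
     = (\<Sum>S\<in>Pow E. (real (card S) + real (d - card S)) * (a S * F S))"
    by (simp add: wsum_def sum.distrib[symmetric] algebra_simps)
  also have "\<dots> = (\<Sum>S\<in>Pow E. real d * (a S * F S))"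
  proof (intro sum.cong refl)
    fix S assume "S \<in> Pow E"
    then show "(real (card S) + real (d - card S)) * (a S * F S) = real d * (a S * F S)"
      using a[of S] by (cases "card S \<le> d") auto
  qed
  finally show ?thesis by (simp add: wsum_def sum_distrib_left)
qed

text \<open>Index 1 means that a slot j is occupied, 0 that it is empty; \<phi> and \<beta> are the
  weights of F and of 1 given v, while \<psi> and \<alpha> are unconditioned. The claim holds in
  each case (\<open>0\<close>, \<open>1\<close>), and conditioning on v shifts mass
  (\<open>c\<close>) to the case j empty, where F has the smaller mean (\<open>m\<close>).\<close>

lemma mixture_ineq:
  fixes \<alpha>0 :: real
  assumes pos: "\<alpha>0 > 0" "\<alpha>1 > 0" "\<beta>0 > 0" "\<beta>1 > 0"
    and 1: "\<phi>1 * \<alpha>1 \<le> \<psi>1 * \<beta>1" and 0: "\<phi>0 * \<alpha>0 \<le> \<psi>0 * \<beta>0"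
    and c: "\<alpha>0 * \<beta>1 \<le> \<beta>0 * \<alpha>1" and m: "\<phi>0 * \<beta>1 \<le> \<phi>1 * \<beta>0"
  shows "(\<phi>0 + \<phi>1) * (\<alpha>0 + \<alpha>1) \<le> (\<psi>0 + \<psi>1) * (\<beta>0 + \<beta>1)"
proof -
  define f0 f1 where f: "f0 = \<phi>0 / \<beta>0" "f1 = \<phi>1 / \<beta>1"
  have \<phi>: "\<phi>0 = f0 * \<beta>0" "\<phi>1 = f1 * \<beta>1" using pos by (auto simp: f)
  have "f0 * \<alpha>0 * \<beta>0 \<le> \<psi>0 * \<beta>0" "f1 * \<alpha>1 * \<beta>1 \<le> \<psi>1 * \<beta>1" using 0 1 by (simp_all add: \<phi> mult_ac)
  then have \<psi>: "f0 * \<alpha>0 \<le> \<psi>0" "f1 * \<alpha>1 \<le> \<psi>1" using pos by simp_all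
  have "f0 * (\<beta>0 * \<beta>1) \<le> f1 * (\<beta>0 * \<beta>1)" using m by (simp add: \<phi> mult_ac)
  then have "f0 \<le> f1" using pos by simp
  then have "0 \<le> (f1 - f0) * (\<beta>0 * \<alpha>1 - \<alpha>0 * \<beta>1)" using c by simp
  then have "(f0 * \<beta>0 + f1 * \<beta>1) * (\<alpha>0 + \<alpha>1) \<le> (f0 * \<alpha>0 + f1 * \<alpha>1) * (\<beta>0 + \<beta>1)"
    by (simp add: algebra_simps)
  also have "\<dots> \<le> (\<psi>0 + \<psi>1) * (\<beta>0 + \<beta>1)" using \<psi> pos by (intro mult_right_mono) auto
  finally show ?thesis by (simp add: \<phi>)
qed

lemma contract_commute:
  assumes "finite S" "j \<notin> S"
  shows "contract (d - 1) (Some j) (contract d v a) S = contract (d - 1) v (contract d (Some j) a) S"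
  using assms by (cases v) (auto simp: insert_commute)

lemma wsum_cong: "(\<And>S. S \<subseteq> E \<Longrightarrow> a S * F S = a' S * F' S) \<Longrightarrow> wsum E a F = wsum E a' F'"
  unfolding wsum_def by (intro sum.cong) auto

lemma wsum_mono: "(\<And>S. S \<subseteq> E \<Longrightarrow> a S * F S \<le> a S * F' S) \<Longrightarrow> wsum E a F \<le> wsum E a F'"
  unfolding wsum_def by (intro sum_mono) auto

lemma hom_stable_weights:
  assumes "hom_stable E d a" "S \<subseteq> E"
  shows "a S \<ge> 0" "card S > d \<Longrightarrow> a S = 0"
proof -
  have "if card S \<le> d then a S > 0 else a S = 0" using assms unfolding hom_stable_def by blast
  then show "a S \<ge> 0" "card S > d \<Longrightarrow> a S = 0" by (simp_all split: if_splits)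
qed

text \<open>By Euler's identity the occupation numbers given v, \<open>None\<close> included, have
  constant sum. \<open>None\<close> is negatively correlated with F by induction, so some slot j is
  nonnegatively correlated with F given v, and splitting on j leads to smaller instances. The
  measure is \<open>card E + d\<close> because contracting \<open>None\<close> leaves
  \<open>E\<close> unchanged.\<close>

theorem increasing_negatively_correlated:
  assumes "hom_stable E d a" "1 \<le> d" "v \<in> insert None (Some ` E)" "mono F"
    and "\<And>e S. v = Some e \<Longrightarrow> F (insert e S) = F S"
  shows "wsum (remove v E) (contract d v a) F * wsum E a (\<lambda>_. 1)
     \<le> wsum E a F * wsum (remove v E) (contract d v a) (\<lambda>_. 1)"
  using assms
proof (induction "card E + d" arbitrary: E d a v F rule: less_induct)
  case less
  note a = less.prems(1) and d = less.prems(2) and v = less.prems(3) and F = less.prems(4,5)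
  have E: "finite E" using a by (simp add: hom_stable_def)
  define b where "b = contract d v a"
  define E1 where "E1 = remove v E"
  have E1: "E1 \<subseteq> E" "finite E1" "card E1 \<le> card E"
    using E by (cases v; auto simp: E1_def card_Diff1_le)+
  have b: "hom_stable E1 (d - 1) b" unfolding b_def E1_def by (rule hom_stable_contract[OF a v d])
  note b0 = hom_stable_wsum_pos[OF b]
  show ?case unfolding b_def[symmetric] E1_def[symmetric]
  proof (cases "d = 1 \<or> E1 = {}")
    case True
    \<comment> \<open>In this case only the empty set carries conditioned weight, and there F takes
      its smallest value.\<close>
    have "b S = 0" if "S \<subseteq> E1" "S \<noteq> {}" for S
    proof -
      have "card S > 0" using that E1 by (meson card_gt_0_iff finite_subset)
      with True hom_stable_weights(2)[OF b that(1)] show ?thesis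
        using that by (cases "d = 1") simp_all
    qed
    then have "b S * F S = b S * F {}" if "S \<subseteq> E1" for S using that by (cases "S = {}") simp_all
    then have "wsum E1 b F = wsum E1 b (\<lambda>_. F {})" by (rule wsum_cong)
    then have "wsum E1 b F = F {} * wsum E1 b (\<lambda>_. 1)" by (simp add: wsum_def sum_distrib_left mult.commute)
    moreover have "wsum E a (\<lambda>_. F {}) \<le> wsum E a F"
      using F(1) hom_stable_weights(1)[OF a] by (intro wsum_mono mult_left_mono) (auto dest: monoD[of F "{}"])
    then have "F {} * wsum E a (\<lambda>_. 1) \<le> wsum E a F" by (simp add: wsum_def sum_distrib_left mult.commute)
    ultimately show "wsum E1 b F * wsum E a (\<lambda>_. 1) \<le> wsum E a F * wsum E1 b (\<lambda>_. 1)"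
      using mult_right_mono[of "F {} * wsum E a (\<lambda>_. 1)" "wsum E a F" "wsum E1 b (\<lambda>_. 1)"] b0 by (simp add: mult_ac)
  next
    case False
    then have d1: "1 \<le> d - 1" and ne: "E1 \<noteq> {}" using d by auto
    have IH0: "wsum E1 (contract (d - 1) None b) F * wsum E1 b (\<lambda>_. 1)
       \<le> wsum E1 b F * wsum E1 (contract (d - 1) None b) (\<lambda>_. 1)"
      using less.hyps[of E1 "d - 1" b None F] b d1 F(1) E1 d by simp
    let ?f = "\<lambda>j. wsum (E1 - {j}) (contract (d - 1) (Some j) b) (\<lambda>S. F (insert j S))"
    let ?g = "\<lambda>j. wsum (E1 - {j}) (contract (d - 1) (Some j) b) (\<lambda>S. 1)"
    \<comment> \<open>If every j were strictly negatively correlated with F given v, then together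
      with \<open>IH0\<close> the two Euler sums would compare strictly, yet both are d - 1 times
      the same product.\<close>
    have "\<exists>j\<in>E1. wsum E1 b F * ?g j \<le> ?f j * wsum E1 b (\<lambda>_. 1)"
    proof (rule ccontr)
      assume "\<not> ?thesis"
      then have "(\<Sum>j\<in>E1. ?f j * wsum E1 b (\<lambda>_. 1)) < (\<Sum>j\<in>E1. wsum E1 b F * ?g j)"
        using E1 ne by (intro sum_strict_mono) (auto simp: not_le)
      then have "(sum ?f E1 + wsum E1 (contract (d - 1) None b) F) * wsum E1 b (\<lambda>_. 1)
         < wsum E1 b F * (sum ?g E1 + wsum E1 (contract (d - 1) None b) (\<lambda>_. 1))"
        using IH0 by (simp only: distrib_left distrib_right sum_distrib_left sum_distrib_right)
      moreover have "sum ?f E1 + wsum E1 (contract (d - 1) None b) F = real (d - 1) * wsum E1 b F"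
        by (rule wsum_homogeneous[OF E1(2)]) (use hom_stable_weights(2)[OF b] in auto)
      moreover have "sum ?g E1 + wsum E1 (contract (d - 1) None b) (\<lambda>_. 1) = real (d - 1) * wsum E1 b (\<lambda>_. 1)"
        by (rule wsum_homogeneous[OF E1(2)]) (use hom_stable_weights(2)[OF b] in auto)
      ultimately show False by (simp add: mult_ac)
    qed
    then obtain j where j: "j \<in> E1" "wsum E1 b F * ?g j \<le> ?f j * wsum E1 b (\<lambda>_. 1)" by auto
    have vj: "v \<noteq> Some j" and jE: "j \<in> E" using j E1 by (auto simp: E1_def)
    define c where "c = contract d (Some j) a"
    define Ej where "Ej = E - {j}"
    have vEj: "v \<in> insert None (Some ` Ej)" using v vj by (auto simp: Ej_def)
    have rem: "remove v Ej = E1 - {j}" by (cases v) (auto simp: Ej_def E1_def)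
    have fEj: "card Ej < card E" using card_Diff1_less[OF E jE] by (simp add: Ej_def)
    have c: "hom_stable Ej (d - 1) c" using hom_stable_contract[OF a _ d, of "Some j"] jE by (simp add: c_def Ej_def)
    have del: "hom_stable Ej d a" using hom_stable_delete[OF a jE] by (simp add: Ej_def)
    have bj: "hom_stable (E1 - {j}) (d - 1 - 1) (contract (d - 1) (Some j) b)"
      using hom_stable_contract[OF b _ d1, of "Some j"] j by simp
    have bd: "hom_stable (E1 - {j}) (d - 1) b" using hom_stable_delete[OF b] j by simp
    have comm: "wsum (E1 - {j}) (contract (d - 1) v c) G = wsum (E1 - {j}) (contract (d - 1) (Some j) b) G" for G
    proof (rule wsum_cong)
      fix S assume "S \<subseteq> E1 - {j}"
      then have "finite S" "j \<notin> S" using E1(2) finite_subset by auto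
      then show "contract (d - 1) v c S * G S = contract (d - 1) (Some j) b S * G S"
        unfolding b_def c_def using contract_commute by metis
    qed
    have FJ: "mono (\<lambda>S. F (insert j S))" using F(1) by (auto intro!: monoI elim!: monoD)
    have IH1: "?f j * wsum Ej c (\<lambda>_. 1) \<le> wsum Ej c (\<lambda>S. F (insert j S)) * ?g j"
    proof -
      have "wsum (remove v Ej) (contract (d - 1) v c) (\<lambda>S. F (insert j S)) * wsum Ej c (\<lambda>_. 1)
          \<le> wsum Ej c (\<lambda>S. F (insert j S)) * wsum (remove v Ej) (contract (d - 1) v c) (\<lambda>_. 1)"
      proof (rule less.hyps[OF _ c d1 vEj FJ])
        show "card Ej + (d - 1) < card E + d" using fEj d by simp
        show "F (insert j (insert e S)) = F (insert j S)" if "v = Some e" for e S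
          using F(2)[OF that] by (metis insert_commute)
      qed
      then show ?thesis by (simp only: rem comm)
    qed
    have IH2: "wsum (E1 - {j}) b F * wsum Ej a (\<lambda>_. 1) \<le> wsum Ej a F * wsum (E1 - {j}) b (\<lambda>_. 1)"
    proof -
      have "wsum (remove v Ej) (contract d v a) F * wsum Ej a (\<lambda>_. 1)
          \<le> wsum Ej a F * wsum (remove v Ej) (contract d v a) (\<lambda>_. 1)"
        by (rule less.hyps[OF _ del d vEj F]) (use fEj in simp)
      then show ?thesis by (simp only: rem b_def)
    qed
    have pair: "wsum Ej a (\<lambda>_. 1) * ?g j \<le> wsum (E1 - {j}) b (\<lambda>_. 1) * wsum Ej c (\<lambda>_. 1)"
      using pair_negatively_correlated[OF a jE v vj, folded Ej_def c_def] by (simp only: rem comm b_def)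
    have split: "wsum E1 b G = wsum (E1 - {j}) b G + wsum (E1 - {j}) (contract (d - 1) (Some j) b) (\<lambda>S. G (insert j S))" for G
      using wsum_split[OF E1(2) j(1), of b G] by simp
    have split': "wsum E a G = wsum Ej a G + wsum Ej c (\<lambda>S. G (insert j S))" for G
      using wsum_split[OF E jE, of a G] by (simp add: Ej_def c_def)
    show "wsum E1 b F * wsum E a (\<lambda>_. 1) \<le> wsum E a F * wsum E1 b (\<lambda>_. 1)"
      unfolding split split'
    proof (rule mixture_ineq)
      show "wsum (E1 - {j}) b F * ?g j \<le> ?f j * wsum (E1 - {j}) b (\<lambda>_. 1)"
        using j(2) unfolding split by (simp add: algebra_simps)
    qed (use hom_stable_wsum_pos[OF del] hom_stable_wsum_pos[OF c] hom_stable_wsum_pos[OF bd] hom_stable_wsum_pos[OF bj]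
          IH1 IH2 pair in auto)
  qed
qed

text \<open>Chebyshev's inequality for two cases, with X for the weights of F * G: when j becomes
  occupied, the mean of F rises (\<open>c\<close>) and that of G falls (\<open>m\<close>), so mixing
  the cases adds a nonpositive covariance.\<close>

lemma mixture_ineq_opposite:
  fixes \<alpha>0 :: real
  assumes pos: "\<alpha>0 > 0" "\<alpha>1 > 0"
    and 1: "X1 * \<alpha>1 \<le> \<psi>1 * \<gamma>1" and 0: "X0 * \<alpha>0 \<le> \<psi>0 * \<gamma>0"
    and c: "\<psi>0 * \<alpha>1 \<le> \<psi>1 * \<alpha>0" and m: "\<gamma>1 * \<alpha>0 \<le> \<gamma>0 * \<alpha>1"
  shows "(X0 + X1) * (\<alpha>0 + \<alpha>1) \<le> (\<psi>0 + \<psi>1) * (\<gamma>0 + \<gamma>1)"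
proof -
  define f0 f1 g0 g1 where f: "f0 = \<psi>0 / \<alpha>0" "f1 = \<psi>1 / \<alpha>1" "g0 = \<gamma>0 / \<alpha>0" "g1 = \<gamma>1 / \<alpha>1"
  have \<phi>: "\<psi>0 = f0 * \<alpha>0" "\<psi>1 = f1 * \<alpha>1" "\<gamma>0 = g0 * \<alpha>0" "\<gamma>1 = g1 * \<alpha>1" using pos by (auto simp: f)
  have "X0 * \<alpha>0 \<le> (f0 * g0 * \<alpha>0) * \<alpha>0" "X1 * \<alpha>1 \<le> (f1 * g1 * \<alpha>1) * \<alpha>1" using 0 1 by (simp_all add: \<phi> mult_ac)
  then have X: "X0 \<le> f0 * g0 * \<alpha>0" "X1 \<le> f1 * g1 * \<alpha>1" using pos by (simp_all only: mult_le_cancel_right_pos)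
  have "f0 * (\<alpha>0 * \<alpha>1) \<le> f1 * (\<alpha>0 * \<alpha>1)" "g1 * (\<alpha>0 * \<alpha>1) \<le> g0 * (\<alpha>0 * \<alpha>1)"
    using c m by (simp_all add: \<phi> mult_ac)
  then have "f0 \<le> f1" "g1 \<le> g0" using pos by simp_all
  then have "0 \<le> (\<alpha>0 * \<alpha>1) * ((f1 - f0) * (g0 - g1))" using pos by simp
  then have "(f0 * g0 * \<alpha>0 + f1 * g1 * \<alpha>1) * (\<alpha>0 + \<alpha>1) \<le> (f0 * \<alpha>0 + f1 * \<alpha>1) * (g0 * \<alpha>0 + g1 * \<alpha>1)"
    by (simp add: algebra_simps)
  moreover have "(X0 + X1) * (\<alpha>0 + \<alpha>1) \<le> (f0 * g0 * \<alpha>0 + f1 * g1 * \<alpha>1) * (\<alpha>0 + \<alpha>1)" using X pos by (intro mult_right_mono) auto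
  ultimately show ?thesis by (simp add: \<phi>)
qed

text \<open>The induction of Feder and Mihail.\<close>

theorem hom_stable_negatively_associated:
  assumes "hom_stable E d a" "mono F" "mono G" "\<And>S. F S = F (S \<inter> A)" "\<And>S. G S = G (S \<inter> B)" "A \<inter> B = {}"
  shows "wsum E a (\<lambda>S. F S * G S) * wsum E a (\<lambda>_. 1) \<le> wsum E a F * wsum E a G"
  using assms(1-5)
proof (induction "card E" arbitrary: E d a F G rule: less_induct)
  case less
  note a = less.prems(1) and F = less.prems(2,4) and G = less.prems(3,5)
  have E: "finite E" using a by (simp add: hom_stable_def)
  show ?case
  proof (cases "d = 0 \<or> A \<inter> E = {}")
    case True
    have "a S * F S = a S * F {}" if "S \<subseteq> E" for S
    proof (cases "S = {}")
      case False
      then have "card S > 0" using E that finite_subset by (auto simp: card_gt_0_iff)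
      moreover have "F S = F {}" if "A \<inter> E = {}"
      proof -
        have "S \<inter> A = {}" using that \<open>S \<subseteq> E\<close> by auto
        then show ?thesis using F(2)[of S] by simp
      qed
      ultimately show ?thesis using True hom_stable_weights(2)[OF a that] by auto
    qed simp
    then have "wsum E a F = wsum E a (\<lambda>S. F {})" "wsum E a (\<lambda>S. F S * G S) = wsum E a (\<lambda>S. F {} * G S)"
      by (auto intro!: wsum_cong simp: mult.assoc[symmetric])
    then have "wsum E a F = F {} * wsum E a (\<lambda>_. 1)" "wsum E a (\<lambda>S. F S * G S) = F {} * wsum E a G"
      by (simp_all add: wsum_def sum_distrib_left mult_ac)
    then show ?thesis by simp
  next
    case False
    then have d: "1 \<le> d" and ne: "A \<inter> E \<noteq> {}" by auto
    let ?f = "\<lambda>j. wsum (E - {j}) (contract d (Some j) a) (\<lambda>S. F (insert j S))"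
    let ?g = "\<lambda>j. wsum (E - {j}) (contract d (Some j) a) (\<lambda>S. 1)"
    \<comment> \<open>A slot outside A does not influence F, so F is negatively correlated with it,
      just as with \<open>None\<close>.\<close>
    have out: "?f j * wsum E a (\<lambda>_. 1) \<le> wsum E a F * ?g j" if "j \<in> E - A" for j
    proof -
      have ins: "F (insert j S) = F S" for S
      proof -
        have "insert j S \<inter> A = S \<inter> A" using that by auto
        then show ?thesis using F(2) by metis
      qed
      have "wsum (remove (Some j) E) (contract d (Some j) a) F * wsum E a (\<lambda>_. 1)
          \<le> wsum E a F * wsum (remove (Some j) E) (contract d (Some j) a) (\<lambda>_. 1)"
        by (rule increasing_negatively_correlated[OF a d _ F(1)]) (use that ins in auto)
      then show ?thesis by (simp only: ins remove.simps)
    qed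
    have None: "wsum E (contract d None a) F * wsum E a (\<lambda>_. 1) \<le> wsum E a F * wsum E (contract d None a) (\<lambda>_. 1)"
      using increasing_negatively_correlated[OF a d _ F(1), of None] by simp
    \<comment> \<open>As the Euler sums balance, some slot in A has to be nonnegatively correlated
      with F.\<close>
    have "\<exists>j\<in>A \<inter> E. wsum E a F * ?g j \<le> ?f j * wsum E a (\<lambda>_. 1)"
    proof (rule ccontr)
      assume "\<not> ?thesis"
      then have "(\<Sum>j\<in>E. ?f j * wsum E a (\<lambda>_. 1)) < (\<Sum>j\<in>E. wsum E a F * ?g j)"
        using E ne out by (intro sum_strict_mono_ex1) (auto simp: not_le less_imp_le, metis DiffI IntI less_imp_le not_le)
      then have "(sum ?f E + wsum E (contract d None a) F) * wsum E a (\<lambda>_. 1)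
         < wsum E a F * (sum ?g E + wsum E (contract d None a) (\<lambda>_. 1))"
        using None by (simp only: distrib_left distrib_right sum_distrib_left sum_distrib_right)
      moreover have "sum ?f E + wsum E (contract d None a) F = real d * wsum E a F"
        by (rule wsum_homogeneous[OF E]) (use hom_stable_weights(2)[OF a] in auto)
      moreover have "sum ?g E + wsum E (contract d None a) (\<lambda>_. 1) = real d * wsum E a (\<lambda>_. 1)"
        by (rule wsum_homogeneous[OF E]) (use hom_stable_weights(2)[OF a] in auto)
      ultimately show False by (simp add: mult_ac)
    qed
    then obtain j where j: "j \<in> A" "j \<in> E" "wsum E a F * ?g j \<le> ?f j * wsum E a (\<lambda>_. 1)" by auto
    define c where "c = contract d (Some j) a"
    define Ej where "Ej = E - {j}"
    have fEj: "card Ej < card E" using card_Diff1_less[OF E j(2)] by (simp add: Ej_def)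
    have c: "hom_stable Ej (d - 1) c" using hom_stable_contract[OF a _ d, of "Some j"] j by (simp add: c_def Ej_def)
    have del: "hom_stable Ej d a" using hom_stable_delete[OF a j(2)] by (simp add: Ej_def)
    have split: "wsum E a H = wsum Ej a H + wsum Ej c (\<lambda>S. H (insert j S))" for H
      using wsum_split[OF E j(2), of a H] by (simp add: Ej_def c_def)
    have ins: "mono (\<lambda>S. H (insert j S))" if "mono H" for H :: "'a set \<Rightarrow> real"
      using that by (auto intro!: monoI elim!: monoD)
    have Gj: "G (insert j S) = G S" for S
    proof -
      have "insert j S \<inter> B = S \<inter> B" using j assms(6) by auto
      then show ?thesis using G(2) by metis
    qed
    have Fj: "F (insert j S) = F (insert j (S \<inter> A))" for S
    proof -
      have "insert j S \<inter> A = insert j (S \<inter> A) \<inter> A" by auto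
      then show ?thesis using F(2) by metis
    qed
    have IH1: "wsum Ej c (\<lambda>S. F (insert j S) * G (insert j S)) * wsum Ej c (\<lambda>_. 1)
        \<le> wsum Ej c (\<lambda>S. F (insert j S)) * wsum Ej c (\<lambda>S. G (insert j S))"
      unfolding Gj by (rule less.hyps[OF fEj c ins[OF F(1)] G(1) Fj G(2)])
    have IH0: "wsum Ej a (\<lambda>S. F S * G S) * wsum Ej a (\<lambda>_. 1) \<le> wsum Ej a F * wsum Ej a G"
      by (rule less.hyps[OF fEj del F(1) G(1) F(2) G(2)])
    \<comment> \<open>j lies in A, so G ignores it and is negatively correlated with it: the mean of
      G falls when j is occupied.\<close>
    have "wsum Ej c G * wsum E a (\<lambda>_. 1) \<le> wsum E a G * wsum Ej c (\<lambda>_. 1)"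
    proof -
      have "wsum (remove (Some j) E) (contract d (Some j) a) G * wsum E a (\<lambda>_. 1)
          \<le> wsum E a G * wsum (remove (Some j) E) (contract d (Some j) a) (\<lambda>_. 1)"
        by (rule increasing_negatively_correlated[OF a d _ G(1)]) (use j Gj in auto)
      then show ?thesis by (simp only: c_def Ej_def remove.simps)
    qed
    then have m: "wsum Ej c (\<lambda>S. G (insert j S)) * wsum Ej a (\<lambda>_. 1) \<le> wsum Ej a G * wsum Ej c (\<lambda>_. 1)"
      unfolding split Gj by (simp add: algebra_simps)
    have k: "wsum Ej a F * wsum Ej c (\<lambda>_. 1) \<le> wsum Ej c (\<lambda>S. F (insert j S)) * wsum Ej a (\<lambda>_. 1)"
      using j(3) unfolding split c_def[symmetric] Ej_def[symmetric] by (simp add: algebra_simps)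
    show ?thesis unfolding split
      by (rule mixture_ineq_opposite[OF hom_stable_wsum_pos[OF del] hom_stable_wsum_pos[OF c] IH1 IH0 k m])
  qed
qed

section \<open>Homogenization of multiaffine polynomials with positive coefficients\<close>

lemma multiaffine_cnj: "multiaffine E (\<lambda>S. of_real (a S)) (\<lambda>e. cnj (z e)) = cnj (multiaffine E (\<lambda>S. of_real (a S)) z)"
  by (simp add: multiaffine_def)

lemma hom_poly_dehomogenize:
  assumes "finite E" "w \<noteq> 0"
  shows "hom_poly E (card E) a z w = w ^ card E * multiaffine E (\<lambda>S. of_real (a S)) (\<lambda>e. z e / w)"
proof -
  have "of_real (a S) * (\<Prod>e\<in>S. z e) * w ^ (card E - card S) = w ^ card E * (of_real (a S) * (\<Prod>e\<in>S. z e / w))"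
    if "S \<in> Pow E" for S
  proof -
    have "card S \<le> card E" using that assms by (simp add: card_mono)
    then have "w ^ card E = w ^ (card E - card S) * w ^ card S" by (simp flip: power_add)
    then show ?thesis using assms(2) by (simp add: prod_dividef)
  qed
  then show ?thesis unfolding hom_poly_def multiaffine_def sum_distrib_left by (intro sum.cong refl)
qed

lemma hom_poly_zero:
  assumes "finite E"
  shows "hom_poly E (card E) a z 0 = of_real (a E) * (\<Prod>e\<in>E. z e)"
proof -
  have "of_real (a S) * (\<Prod>e\<in>S. z e) * 0 ^ (card E - card S) = (if S = E then of_real (a E) * (\<Prod>e\<in>E. z e) else 0)"
    if "S \<in> Pow E" for S
  proof (cases "S = E")
    case False
    then have "card S < card E" using that assms by (intro psubset_card_mono) auto
    then show ?thesis using False by (simp add: power_0_left)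
  qed simp
  then have "hom_poly E (card E) a z 0 = (\<Sum>S\<in>Pow E. if S = E then of_real (a E) * (\<Prod>e\<in>E. z e) else 0)"
    unfolding hom_poly_def by (intro sum.cong refl)
  then show ?thesis using assms by simp
qed

text \<open>As a polynomial in s the leading coefficient is \<open>a {}\<close> and all roots lie in
  the closed lower half plane. The bound does not depend on z and thus passes to limits in
  z.\<close>

lemma hom_poly_lower_bound:
  assumes E: "finite E" and a: "a {} > 0" and nz: "\<And>s. Im s > 0 \<Longrightarrow> hom_poly E (card E) a z s \<noteq> 0"
    and s: "Im s > 0"
  shows "a {} * Im s ^ card E \<le> norm (hom_poly E (card E) a z s)"
proof -
  define q where "q = (\<Sum>S\<in>Pow E. monom (of_real (a S) * (\<Prod>e\<in>S. z e)) (card E - card S))"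
  have q: "poly q s = hom_poly E (card E) a z s" for s
    by (simp add: q_def hom_poly_def poly_sum poly_monom)
  have le: "degree q \<le> card E" unfolding q_def by (intro degree_sum_le order_trans[OF degree_monom_le]) (auto simp: E)
  have "coeff q (card E) = (\<Sum>S\<in>Pow E. if S = {} then of_real (a {}) else 0)"
    unfolding q_def coeff_sum
  proof (intro sum.cong refl)
    fix S assume "S \<in> Pow E"
    then have "finite S" "card S \<le> card E" using E finite_subset[of S E] card_mono[of E S] by auto
    then have "card E - card S = card E \<longleftrightarrow> S = {}"
    proof (cases "S = {}")
      case False
      then have "0 < card S" using \<open>finite S\<close> by (simp add: card_gt_0_iff)
      then show ?thesis using False \<open>card S \<le> card E\<close> by simp
    qed simp
    then show "coeff (monom (of_real (a S) * (\<Prod>e\<in>S. z e)) (card E - card S)) (card E) = (if S = {} then of_real (a {}) else 0)"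
      by auto
  qed
  then have c: "coeff q (card E) = of_real (a {})" using E by simp
  then have deg: "degree q = card E" using le le_degree[of q "card E"] a by simp
  have "norm (lead_coeff q) * Im s ^ degree q \<le> norm (poly q s)"
    by (rule norm_poly_ge_lead_coeff[OF _ s]) (use nz in \<open>simp add: q\<close>)
  then show ?thesis unfolding deg q c using a by simp
qed

text \<open>Cauchy's bound on roots: in s the leading term is \<open>a {}\<close> times s^n, and the
  others have degree at most n - 1. It keeps the roots in a compact set while z moves.\<close>

lemma hom_poly_root_bound:
  assumes E: "finite E" and a: "\<And>S. S \<subseteq> E \<Longrightarrow> a S > 0" and R: "R \<ge> 1" "\<And>e. e \<in> E \<Longrightarrow> norm (z e) \<le> R"
    and 0: "hom_poly E (card E) a z s = 0"
  shows "norm s \<le> 1 + R ^ card E * wsum E a (\<lambda>_. 1) / a {}"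
proof (cases "norm s \<le> 1")
  case True
  moreover have "0 \<le> R ^ card E * wsum E a (\<lambda>_. 1) / a {}"
  proof -
    have "0 \<le> wsum E a (\<lambda>_. 1)" unfolding wsum_def by (rule sum_nonneg) (simp add: a less_imp_le)
    then show ?thesis using R(1) a[of "{}"] by simp
  qed
  ultimately show ?thesis by simp
next
  case False
  let ?n = "card E"
  have sum: "hom_poly E ?n a z s = of_real (a {}) * s ^ ?n + (\<Sum>S\<in>Pow E - {{}}. of_real (a S) * (\<Prod>e\<in>S. z e) * s ^ (?n - card S))"
    unfolding hom_poly_def by (subst sum.remove[of _ "{}"]) (use E in auto)
  show ?thesis
  proof (cases "E = {}")
    case True
    then show ?thesis using 0 a[of "{}"] by (simp add: hom_poly_def)
  next
    case ne: False
    have "a {} * norm s ^ ?n = norm (of_real (a {}) * s ^ ?n)" using a[of "{}"] by (simp add: norm_mult norm_power)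
    also have "of_real (a {}) * s ^ ?n = - (\<Sum>S\<in>Pow E - {{}}. of_real (a S) * (\<Prod>e\<in>S. z e) * s ^ (?n - card S))"
      using 0 sum by (simp add: eq_neg_iff_add_eq_0)
    also have "norm \<dots> \<le> (\<Sum>S\<in>Pow E - {{}}. a S * (R ^ ?n * norm s ^ (?n - 1)))"
      unfolding norm_minus_cancel
    proof (rule sum_norm_le)
      fix S assume S: "S \<in> Pow E - {{}}"
      then have fS: "finite S" "card S \<noteq> 0" "card S \<le> ?n" using E finite_subset[of S E] by (auto simp: card_mono)
      have le: "?n - card S \<le> ?n - 1" using fS(2) by linarith
      have "norm (\<Prod>e\<in>S. z e) \<le> (\<Prod>e\<in>S. R)" unfolding prod_norm[symmetric]
        using S R by (intro prod_mono) auto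
      also have "\<dots> \<le> R ^ ?n" using R fS by (simp add: power_increasing)
      finally have "norm (\<Prod>e\<in>S. z e) * norm s ^ (?n - card S) \<le> R ^ ?n * norm s ^ (?n - 1)"
        using False R(1) by (intro mult_mono power_increasing le) auto
      then show "norm (of_real (a S) * (\<Prod>e\<in>S. z e) * s ^ (?n - card S)) \<le> a S * (R ^ ?n * norm s ^ (?n - 1))"
        using a[of S] S by (simp add: norm_mult norm_power mult.assoc)
    qed
    also have "\<dots> \<le> (\<Sum>S\<in>Pow E. a S * (R ^ ?n * norm s ^ (?n - 1)))"
      by (rule sum_mono2) (use E R(1) in \<open>simp_all add: a less_imp_le\<close>)
    also have "\<dots> = wsum E a (\<lambda>_. 1) * R ^ ?n * norm s ^ (?n - 1)"
      by (simp add: wsum_def sum_distrib_right mult.assoc)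
    finally have "a {} * norm s ^ ?n \<le> wsum E a (\<lambda>_. 1) * R ^ ?n * norm s ^ (?n - 1)" .
    moreover have "norm s ^ ?n = norm s * norm s ^ (?n - 1)"
    proof -
      have "card E > 0" using ne E by (simp add: card_gt_0_iff)
      then show ?thesis by (cases "card E") auto
    qed
    moreover have "norm s ^ (?n - 1) > 0" using False by (intro zero_less_power) linarith
    ultimately have "(a {} * norm s) * norm s ^ (?n - 1) \<le> (wsum E a (\<lambda>_. 1) * R ^ ?n) * norm s ^ (?n - 1)"
      by (simp add: mult.assoc)
    then have "a {} * norm s \<le> wsum E a (\<lambda>_. 1) * R ^ ?n"
      using \<open>norm s ^ (?n - 1) > 0\<close> by (simp only: mult_le_cancel_right_pos)
    then have "norm s \<le> R ^ ?n * wsum E a (\<lambda>_. 1) / a {}"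
      using a[of "{}"] by (simp add: pos_le_divide_eq mult.commute)
    then show ?thesis by simp
  qed
qed

text \<open>
  Move \<open>z\<close> along a segment to the diagonal. The roots of \<open>s \<mapsto> hom_poly E n a z s\<close> cannot cross the
  real axis, and on the diagonal they lie in the lower half plane because the coefficients are
  positive.
\<close>

lemma hom_stable_homogenization:
  fixes a :: "'e set \<Rightarrow> real"
  assumes E: "finite E" and a: "\<And>S. S \<subseteq> E \<Longrightarrow> a S > 0"
    and nz: "\<And>z. z \<in> upper_poly E \<Longrightarrow> multiaffine E (\<lambda>S. of_real (a S)) z \<noteq> 0"
  shows "hom_stable E (card E) a"
proof -
  let ?n = "card E"
  let ?f = "multiaffine E (\<lambda>S. of_real (a S))"
  have nz': "?f z \<noteq> 0" if "\<And>e. e \<in> E \<Longrightarrow> Im (z e) < 0" for z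
  proof -
    have "?f (\<lambda>e. cnj (z e)) \<noteq> 0" using that by (intro nz) (auto simp: upper_poly_def)
    then show ?thesis by (simp add: multiaffine_cnj)
  qed
  \<comment> \<open>For real s \<noteq> 0 all z_e / s lie in one half plane, upper or lower; for s =
    0 only the monomial of the full set remains.\<close>
  have real: "hom_poly E ?n a z s \<noteq> 0" if z: "z \<in> upper_poly E" and s: "Im s = 0" for z s
  proof (cases "s = 0")
    case True
    have "(\<Prod>e\<in>E. z e) \<noteq> 0" using z E by (force simp: upper_poly_def)
    then show ?thesis using True a[of E] by (simp add: hom_poly_zero[OF E])
  next
    case False
    have sr: "s = of_real (Re s)" using s by (simp add: complex_eq_iff)
    have "?f (\<lambda>e. z e / s) \<noteq> 0"
    proof (cases "Re s > 0")
      case True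
      then show ?thesis using z by (subst sr, intro nz) (auto simp: upper_poly_def Im_divide_of_real)
    next
      case False
      then have "Re s < 0" using sr \<open>s \<noteq> 0\<close> by (metis linorder_neqE_linordered_idom of_real_0)
      then show ?thesis using z by (subst sr, intro nz') (auto simp: upper_poly_def Im_divide_of_real divide_pos_neg)
    qed
    then show ?thesis using False by (simp add: hom_poly_dehomogenize[OF E])
  qed
  \<comment> \<open>Im s > 0 makes Re (i / s) positive. If i / s is real, the value is a positive
    sum; otherwise stability, up to conjugation, excludes a zero.\<close>
  have diag: "hom_poly E ?n a (\<lambda>_. \<i>) s \<noteq> 0" if s: "Im s > 0" for s
  proof -
    have s0: "s \<noteq> 0" using s by auto
    have re: "Re (\<i> / s) > 0" using s by (auto simp: Re_divide intro!: divide_pos_pos sum_power2_gt_zero_iff[THEN iffD2])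
    consider "Im (\<i> / s) > 0" | "Im (\<i> / s) < 0" | "Im (\<i> / s) = 0" by linarith
    then have "?f (\<lambda>_. \<i> / s) \<noteq> 0"
    proof cases
      case 3
      define x where "x = Re (\<i> / s)"
      have x: "\<i> / s = of_real x" "x > 0" using 3 re by (simp_all add: complex_eq_iff x_def)
      have "?f (\<lambda>_. \<i> / s) = of_real (\<Sum>S\<in>Pow E. a S * x ^ card S)"
        unfolding x by (simp add: multiaffine_def)
      moreover have "(\<Sum>S\<in>Pow E. a S * x ^ card S) > 0"
        using E a x by (intro sum_pos) auto
      ultimately show ?thesis by (simp only: of_real_eq_0_iff)
    qed (use nz nz' in \<open>auto simp: upper_poly_def\<close>)
    then show ?thesis using s0 by (simp add: hom_poly_dehomogenize[OF E])
  qed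
  have "hom_poly E ?n a z w \<noteq> 0" if z: "z \<in> upper_poly E" and w: "Im w > 0" for z w
  proof -
    define Z where "Z l e = (1 - of_real l) * \<i> + of_real l * z e" for l :: real and e
    have Zu: "Z l \<in> upper_poly E" if "l \<in> {0..1}" for l
    proof -
      have "0 < (1 - l) + l * Im (z e)" if "e \<in> E" for e
      proof (cases "l = 1")
        case False
        then have "0 < 1 - l" "0 \<le> l * Im (z e)" using \<open>l \<in> {0..1}\<close> z \<open>e \<in> E\<close> by (auto simp: upper_poly_def less_imp_le)
        then show ?thesis by linarith
      qed (use z that in \<open>simp add: upper_poly_def\<close>)
      then show ?thesis by (auto simp: Z_def upper_poly_def)
    qed
    define R where "R = 1 + (\<Sum>e\<in>E. norm (z e))"
    have R: "R \<ge> 1" by (simp add: R_def sum_nonneg)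
    have ZR: "norm (Z l e) \<le> R" if "l \<in> {0..1}" "e \<in> E" for l e
    proof -
      have "norm (Z l e) \<le> norm ((1 - of_real l) * \<i>) + norm (of_real l * z e)"
        unfolding Z_def by (rule norm_triangle_ineq)
      also have "\<dots> = norm (of_real (1 - l) :: complex) + \<bar>l\<bar> * norm (z e)" by (simp add: norm_mult)
      also have "\<dots> = (1 - l) + l * norm (z e)" using that by (simp only: norm_of_real) simp
      also have "\<dots> \<le> 1 + norm (z e)" using that by (intro add_mono mult_left_le_one_le) auto
      also have "norm (z e) \<le> (\<Sum>e\<in>E. norm (z e))" using E that by (intro member_le_sum) auto
      finally show ?thesis by (simp add: R_def)
    qed
    have cont: "(\<lambda>n. hom_poly E ?n a (Z (x n)) (s n)) \<longlonglongrightarrow> hom_poly E ?n a (Z l) t"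
      if "x \<longlonglongrightarrow> l" "s \<longlonglongrightarrow> t" for x l s t
      unfolding hom_poly_def Z_def by (intro tendsto_intros that)
    \<comment> \<open>Both \<open>good\<close> and its complement in [0, 1] are closed; as [0, 1] is
      connected and 0 is good, so is 1.\<close>
    define good where "good = {l \<in> {0..1}. \<forall>s. Im s > 0 \<longrightarrow> hom_poly E ?n a (Z l) s \<noteq> 0}"
    define bad where "bad = {0..1} - good"
    have "closed good" unfolding closed_sequential_limits
    proof safe
      fix x l assume x: "\<forall>n. x n \<in> good" "x \<longlonglongrightarrow> l"
      have l: "l \<in> {0..1}" using x closed_sequentially[of "{0..1::real}" x l] by (auto simp: good_def)
      have "hom_poly E ?n a (Z l) s \<noteq> 0" if s: "Im s > 0" for s
      proof -
        have "a {} * Im s ^ ?n \<le> norm (hom_poly E ?n a (Z (x n)) s)" for n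
          using x(1) s a by (intro hom_poly_lower_bound E) (auto simp: good_def)
        then have "a {} * Im s ^ ?n \<le> norm (hom_poly E ?n a (Z l) s)"
          using tendsto_lowerbound[OF tendsto_norm[OF cont[OF x(2) tendsto_const[of s]]]] by simp
        moreover have "a {} * Im s ^ ?n > 0" using a[of "{}"] s by simp
        ultimately show ?thesis by (metis norm_zero not_less)
      qed
      then show "l \<in> good" using l by (auto simp: good_def)
    qed
    moreover have "closed bad" unfolding closed_sequential_limits
    proof safe
      fix x l assume x: "\<forall>n. x n \<in> bad" "x \<longlonglongrightarrow> l"
      have l: "l \<in> {0..1}" using x closed_sequentially[of "{0..1::real}" x l] by (auto simp: bad_def)
      have "\<exists>s. Im s > 0 \<and> hom_poly E ?n a (Z (x n)) s = 0" for n
        using x(1) by (auto simp: bad_def good_def)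
      then obtain s where s: "\<And>n. Im (s n) > 0" "\<And>n. hom_poly E ?n a (Z (x n)) (s n) = 0" by metis
      have "s n \<in> cball 0 (1 + R ^ ?n * wsum E a (\<lambda>_. 1) / a {})" for n
        using hom_poly_root_bound[OF E a R _ s(2)] ZR x(1) by (simp add: bad_def)
      then obtain t r where t: "strict_mono (r :: nat \<Rightarrow> nat)" "(s \<circ> r) \<longlonglongrightarrow> t"
        using compact_cball[unfolded compact_def] by metis
      have "(\<lambda>n. hom_poly E ?n a (Z ((x \<circ> r) n)) ((s \<circ> r) n)) \<longlonglongrightarrow> hom_poly E ?n a (Z l) t"
        by (intro cont t LIMSEQ_subseq_LIMSEQ[OF x(2) t(1)])
      then have 0: "hom_poly E ?n a (Z l) t = 0"
        using s(2) LIMSEQ_unique[OF tendsto_const] by (metis (mono_tags, lifting) comp_apply tendsto_cong always_eventually)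
      \<comment> \<open>A limit of roots in the upper half plane could leave it only through the
        real axis, which \<open>real\<close> forbids.\<close>
      have "Im t \<ge> 0"
        by (rule tendsto_lowerbound[OF tendsto_Im[OF t(2)]]) (use s(1) in \<open>simp_all add: less_imp_le\<close>)
      then have "Im t > 0" using real[OF Zu[OF l]] 0 by (cases "Im t = 0") auto
      then show "l \<in> bad" using 0 l by (auto simp: bad_def good_def)
    qed
    ultimately have "good \<inter> {0..1} = {} \<or> bad \<inter> {0..1} = {}"
      by (intro connected_closedD) (auto simp: bad_def)
    moreover have "Z 0 = (\<lambda>_. \<i>)" by (simp add: Z_def fun_eq_iff)
    then have "0 \<in> good" using diag by (simp add: good_def)
    moreover have "bad \<inter> {0..1} = bad" by (auto simp: bad_def)
    ultimately have "bad = {}" by auto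
    then have "1 \<in> good" by (auto simp: bad_def)
    moreover have "Z 1 = z" by (simp add: Z_def fun_eq_iff)
    ultimately show ?thesis using w by (simp add: good_def)
  qed
  then show ?thesis unfolding hom_stable_def using E a by (auto simp: card_mono)
qed

text \<open>Flipping each site with a small weight makes all coefficients positive; on the generating
  polynomial this is the Moebius map \<open>z \<mapsto> (z + \<epsilon>) / (1 + \<epsilon> z)\<close> in each variable.\<close>

lemma multiaffine_flip:
  assumes E: "finite E" and z: "\<And>e. e \<in> E \<Longrightarrow> 1 + \<epsilon> * z e \<noteq> 0"
  shows "multiaffine E (\<lambda>S. \<Sum>T\<in>Pow E. b T * (\<Prod>e\<in>E. if (e \<in> T) = (e \<in> S) then 1 else \<epsilon>)) z
    = (\<Prod>e\<in>E. 1 + \<epsilon> * z e) * multiaffine E b (\<lambda>e. (z e + \<epsilon>) / (1 + \<epsilon> * z e))"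
proof -
  have "(\<Sum>S\<in>Pow E. (\<Prod>e\<in>E. if (e \<in> T) = (e \<in> S) then 1 else \<epsilon>) * (\<Prod>e\<in>S. z e))
      = (\<Prod>e\<in>E. 1 + \<epsilon> * z e) * (\<Prod>e\<in>T. (z e + \<epsilon>) / (1 + \<epsilon> * z e))" if T: "T \<subseteq> E" for T
  proof -
    have "(\<Prod>e\<in>E. if (e \<in> T) = (e \<in> S) then 1 else \<epsilon>) * (\<Prod>e\<in>S. z e) =
        (\<Prod>e\<in>S. if e \<in> T then z e else \<epsilon> * z e) * (\<Prod>e\<in>E - S. if e \<in> T then \<epsilon> else 1)" if S: "S \<subseteq> E" for S
    proof -
      define u where "u = (\<lambda>e. if (e \<in> T) = (e \<in> S) then 1 else \<epsilon>)"
      have 1: "prod u E = prod u S * prod u (E - S)"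
        by (subst prod.subset_diff[OF S E]) (rule mult.commute)
      have 2: "prod u S * prod z S = (\<Prod>e\<in>S. if e \<in> T then z e else \<epsilon> * z e)"
        unfolding prod.distrib[symmetric] by (rule prod.cong) (simp_all add: u_def)
      have 3: "prod u (E - S) = (\<Prod>e\<in>E - S. if e \<in> T then \<epsilon> else 1)"
        by (rule prod.cong) (simp_all add: u_def)
      have "prod u E * prod z S = (prod u S * prod z S) * prod u (E - S)" unfolding 1 by (simp only: mult_ac)
      then show ?thesis unfolding 2 3 unfolding u_def .
    qed
    then have "(\<Sum>S\<in>Pow E. (\<Prod>e\<in>E. if (e \<in> T) = (e \<in> S) then 1 else \<epsilon>) * (\<Prod>e\<in>S. z e)) =
        (\<Prod>e\<in>E. (if e \<in> T then z e else \<epsilon> * z e) + (if e \<in> T then \<epsilon> else 1))"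
      unfolding prod_add[OF E] by (intro sum.cong) auto
    also have "\<dots> = (\<Prod>e\<in>E. (1 + \<epsilon> * z e) * (if e \<in> T then (z e + \<epsilon>) / (1 + \<epsilon> * z e) else 1))"
      using z by (intro prod.cong refl) simp
    also have "\<dots> = (\<Prod>e\<in>E. 1 + \<epsilon> * z e) * (\<Prod>e\<in>T. (z e + \<epsilon>) / (1 + \<epsilon> * z e))"
      using T E by (simp add: prod.distrib prod.inter_restrict[symmetric] Int_absorb1)
    finally show ?thesis .
  qed
  note * = this
  have "multiaffine E (\<lambda>S. \<Sum>T\<in>Pow E. b T * (\<Prod>e\<in>E. if (e \<in> T) = (e \<in> S) then 1 else \<epsilon>)) z =
    (\<Sum>T\<in>Pow E. b T * (\<Sum>S\<in>Pow E. (\<Prod>e\<in>E. if (e \<in> T) = (e \<in> S) then 1 else \<epsilon>) * (\<Prod>e\<in>S. z e)))"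
    unfolding multiaffine_def sum_distrib_right sum_distrib_left by (subst sum.swap) (simp add: mult.assoc)
  also have "\<dots> = (\<Sum>T\<in>Pow E. b T * ((\<Prod>e\<in>E. 1 + \<epsilon> * z e) * (\<Prod>e\<in>T. (z e + \<epsilon>) / (1 + \<epsilon> * z e))))"
    using * by (intro sum.cong) auto
  finally show ?thesis by (simp add: multiaffine_def sum_distrib_left mult_ac)
qed

text \<open>A Moebius map with real coefficients and determinant 1 - \<epsilon>^2 > 0.\<close>

lemma Moebius_Im_pos:
  fixes \<epsilon> :: real
  assumes "0 < \<epsilon>" "\<epsilon> < 1" "Im x > 0"
  shows "1 + of_real \<epsilon> * x \<noteq> 0" "Im ((x + of_real \<epsilon>) / (1 + of_real \<epsilon> * x)) > 0"
proof -
  have "Im (1 + of_real \<epsilon> * x) > 0" using assms by simp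
  then show nz: "1 + of_real \<epsilon> * x \<noteq> 0" by (metis less_irrefl zero_complex.simps(2))
  have "Im ((x + of_real \<epsilon>) / (1 + of_real \<epsilon> * x)) = (1 - \<epsilon>\<^sup>2) * Im x / (cmod (1 + of_real \<epsilon> * x))\<^sup>2"
  proof -
    have "Im (x + of_real \<epsilon>) * Re (1 + of_real \<epsilon> * x) - Re (x + of_real \<epsilon>) * Im (1 + of_real \<epsilon> * x) = (1 - \<epsilon>\<^sup>2) * Im x"
      by (simp add: algebra_simps power2_eq_square)
    then show ?thesis unfolding Im_divide cmod_power2 by (simp only:)
  qed
  moreover have "\<epsilon>\<^sup>2 < 1" using assms power_strict_mono[of \<epsilon> 1 2] by simp
  moreover have "(cmod (1 + of_real \<epsilon> * x))\<^sup>2 > 0" using nz by (simp only: zero_less_power2 norm_eq_zero not_False_eq_True)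
  ultimately show "Im ((x + of_real \<epsilon>) / (1 + of_real \<epsilon> * x)) > 0"
    using assms(3) by (simp only: divide_pos_pos mult_pos_pos diff_gt_0_iff_gt)
qed

theorem multiaffine_negatively_associated:
  fixes b :: "'e set \<Rightarrow> real"
  assumes E: "finite E" and b: "\<And>S. S \<subseteq> E \<Longrightarrow> b S \<ge> 0"
    and nz: "\<And>z. z \<in> upper_poly E \<Longrightarrow> multiaffine E (\<lambda>S. of_real (b S)) z \<noteq> 0"
    and FG: "mono F" "mono G" "\<And>S. F S = F (S \<inter> A)" "\<And>S. G S = G (S \<inter> B)" "A \<inter> B = {}"
  shows "wsum E b (\<lambda>S. F S * G S) * wsum E b (\<lambda>_. 1) \<le> wsum E b F * wsum E b G"
proof -
  define c where "c \<epsilon> S = (\<Sum>T\<in>Pow E. b T * (\<Prod>e\<in>E. if (e \<in> T) = (e \<in> S) then 1 else \<epsilon>))" for \<epsilon> :: real and S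
  have ineq: "wsum E (c \<epsilon>) (\<lambda>S. F S * G S) * wsum E (c \<epsilon>) (\<lambda>_. 1) \<le> wsum E (c \<epsilon>) F * wsum E (c \<epsilon>) G"
    if \<epsilon>: "0 < \<epsilon>" "\<epsilon> < 1" for \<epsilon>
  proof (rule hom_stable_negatively_associated[OF hom_stable_homogenization[OF E] FG])
    have "\<exists>T\<in>Pow E. b T > 0"
    proof (rule ccontr)
      assume "\<not> ?thesis"
      then have "\<not> b T > 0" if "T \<subseteq> E" for T using that by blast
      then have "b T = 0" if "T \<subseteq> E" for T using b[OF that] that by (metis less_eq_real_def)
      then have "multiaffine E (\<lambda>S. of_real (b S)) (\<lambda>_. \<i>) = 0" by (simp add: multiaffine_def)
      then show False using nz[of "\<lambda>_. \<i>"] by (simp add: upper_poly_def)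
    qed
    then obtain T where T: "T \<in> Pow E" "b T > 0" by auto
    have p: "(\<Prod>e\<in>E. if (e \<in> T) = (e \<in> S) then 1 else \<epsilon>) > 0" for T S using \<epsilon> by (intro prod_pos) auto
    show "c \<epsilon> S > 0" if "S \<subseteq> E" for S
    proof -
      have "0 \<le> b T' * (\<Prod>e\<in>E. if (e \<in> T') = (e \<in> S) then 1 else \<epsilon>)" if "T' \<in> Pow E" for T'
        using b[of T'] p[of T' S] that by (intro mult_nonneg_nonneg less_imp_le[of 0 "\<Prod>e\<in>E. _ e"]) simp_all
      then show ?thesis
        unfolding c_def using T p[of T S] E by (intro sum_pos2[of _ T]) simp_all
    qed
    show "multiaffine E (\<lambda>S. of_real (c \<epsilon> S)) z \<noteq> 0" if z: "z \<in> upper_poly E" for z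
    proof -
      have "(\<lambda>S. of_real (c \<epsilon> S)) = (\<lambda>S. \<Sum>T\<in>Pow E. of_real (b T) * (\<Prod>e\<in>E. if (e \<in> T) = (e \<in> S) then 1 else of_real \<epsilon> :: complex))"
        by (simp add: c_def if_distrib cong: if_cong)
      moreover have "1 + of_real \<epsilon> * z e \<noteq> 0" if "e \<in> E" for e
        using Moebius_Im_pos(1)[OF \<epsilon>] z that by (auto simp: upper_poly_def)
      moreover have "multiaffine E (\<lambda>S. of_real (b S)) (\<lambda>e. (z e + of_real \<epsilon>) / (1 + of_real \<epsilon> * z e)) \<noteq> 0"
        using Moebius_Im_pos(2)[OF \<epsilon>] z by (intro nz) (auto simp: upper_poly_def)
      ultimately show ?thesis using E by (simp add: multiaffine_flip)
    qed
  qed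
  have lim: "((\<lambda>\<epsilon>. wsum E (c \<epsilon>) H) \<longlongrightarrow> wsum E b H) (at_right 0)" for H
  proof -
    have "((\<lambda>\<epsilon>. c \<epsilon> S) \<longlongrightarrow> b S) (at_right 0)" if S: "S \<in> Pow E" for S
    proof -
      have "((\<lambda>\<epsilon>. if P then 1 else \<epsilon>) \<longlongrightarrow> (if P then 1 else 0)) (at_right (0::real))" for P by (cases P) auto
      then have "((\<lambda>\<epsilon>. c \<epsilon> S) \<longlongrightarrow> (\<Sum>T\<in>Pow E. b T * (\<Prod>e\<in>E. if (e \<in> T) = (e \<in> S) then 1 else 0))) (at_right 0)"
        unfolding c_def by (intro tendsto_sum tendsto_mult tendsto_const tendsto_prod)
      also have "(\<Sum>T\<in>Pow E. b T * (\<Prod>e\<in>E. if (e \<in> T) = (e \<in> S) then 1 else 0)) = (\<Sum>T\<in>Pow E. if T = S then b T else 0)"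
      proof (intro sum.cong refl)
        fix T assume T: "T \<in> Pow E"
        show "b T * (\<Prod>e\<in>E. if (e \<in> T) = (e \<in> S) then 1 else 0) = (if T = S then b T else 0)"
        proof (cases "T = S")
          case False
          then have "\<exists>e\<in>E. (e \<in> T) \<noteq> (e \<in> S)" using S T by auto
          then have "(\<Prod>e\<in>E. if (e \<in> T) = (e \<in> S) then 1 else 0 :: real) = 0" using E by (intro prod_zero) auto
          then show ?thesis using False by simp
        qed simp
      qed
      also have "\<dots> = b S" using E S by simp
      finally show ?thesis .
    qed
    then show ?thesis unfolding wsum_def by (intro tendsto_sum tendsto_mult tendsto_const)
  qed
  show ?thesis
  proof (rule tendsto_le[OF _ tendsto_mult[OF lim lim] tendsto_mult[OF lim lim]])
    have "\<forall>\<^sub>F \<epsilon> in at_right (0::real). \<epsilon> \<in> {0<..<1}" by (rule eventually_at_right_real) simp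
    then show "\<forall>\<^sub>F \<epsilon> in at_right 0. wsum E (c \<epsilon>) (\<lambda>S. F S * G S) * wsum E (c \<epsilon>) (\<lambda>_. 1) \<le> wsum E (c \<epsilon>) F * wsum E (c \<epsilon>) G"
      by eventually_elim (use ineq in auto)
  qed simp
qed

section \<open>From configurations to occupied slots\<close>

lemma polynomial_function_box:
  assumes A: "finite A" and p: "polynomial_function_on A p"
  obtains D c where "in_box A D c" "\<And>z. z \<in> A \<rightarrow>\<^sub>E UNIV \<Longrightarrow> p z = box_poly A D c z"
proof -
  from p obtain K c where Kc: "finite K \<and> K \<subseteq> A \<rightarrow>\<^sub>E (UNIV :: nat set) \<and>
      (\<forall>z \<in> A \<rightarrow>\<^sub>E UNIV. p z = (\<Sum>k\<in>K. c k * (\<Prod>a\<in>A. z a ^ k a)))"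
    unfolding polynomial_function_on_def by (elim exE)
  note K = Kc[THEN conjunct1] Kc[THEN conjunct2, THEN conjunct1]
  note p = Kc[THEN conjunct2, THEN conjunct2, rule_format]
  define D where "D = Max (insert 0 ((\<lambda>(k, a). k a) ` (K \<times> A)))"
  have D: "k a \<le> D" if "k \<in> K" "a \<in> A" for k a
    unfolding D_def using that A K by (intro Max_ge) (auto intro!: rev_image_eqI[of "(k, a)"])
  define c' where "c' k = (if k \<in> K then c k else 0)" for k
  have KB: "K \<subseteq> PiE A (\<lambda>_. {..D})" 
  proof
    fix k assume "k \<in> K"
    then have "k \<in> A \<rightarrow>\<^sub>E UNIV" "\<forall>a\<in>A. k a \<le> D" using K(2) D by auto
    then show "k \<in> PiE A (\<lambda>_. {..D})" by (simp add: PiE_iff)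
  qed
  show ?thesis
  proof
    show "in_box A D c'" unfolding in_box_def
    proof (intro allI impI)
      fix k a assume "a \<in> A" "k a > D"
      then have "k \<notin> K" using D[of k a] by auto
      then show "c' k = 0" by (simp add: c'_def)
    qed
    fix z :: "'a \<Rightarrow> complex" assume z: "z \<in> A \<rightarrow>\<^sub>E UNIV"
    have "box_poly A D c' z = (\<Sum>k\<in>K. c' k * (\<Prod>a\<in>A. z a ^ k a))"
      unfolding box_poly_def
    proof (rule sum.mono_neutral_right[OF _ KB])
      show "finite (PiE A (\<lambda>_. {..D}))" using A by (rule finite_PiE) simp
    qed (simp add: c'_def)
    then show "p z = box_poly A D c' z" using p[OF z] by (simp add: c'_def)
  qed
qed

lemma box_poly_restrict: "box_poly A D c (restrict x A) = box_poly A D c x"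
  unfolding box_poly_def by (intro sum.cong arg_cong2[of _ _ _ _ "(*)"] prod.cong refl) auto

lemma box_poly_has_sum:
  assumes A: "finite A" and c: "in_box A D c"
  shows "((\<lambda>k. c k * (\<Prod>a\<in>A. z a ^ k a)) has_sum box_poly A D c z) (A \<rightarrow>\<^sub>E UNIV)"
    and "(\<lambda>k. norm (c k)) summable_on (A \<rightarrow>\<^sub>E UNIV)"
proof -
  let ?B = "PiE A (\<lambda>_. {..D})"
  have B: "finite ?B" "?B \<subseteq> A \<rightarrow>\<^sub>E UNIV" using A by (auto intro: finite_PiE)
  have 0: "c k = 0" if k: "k \<in> (A \<rightarrow>\<^sub>E UNIV) - ?B" for k
  proof -
    obtain a where "a \<in> A" "k a > D" using k by (force simp: PiE_iff)
    then show ?thesis using c unfolding in_box_def by blast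
  qed
  show "((\<lambda>k. c k * (\<Prod>a\<in>A. z a ^ k a)) has_sum box_poly A D c z) (A \<rightarrow>\<^sub>E UNIV)"
    unfolding box_poly_def by (rule has_sum_finite_neutralI[OF B]) (simp_all add: 0)
  show "(\<lambda>k. norm (c k)) summable_on (A \<rightarrow>\<^sub>E UNIV)"
  proof (rule has_sum_imp_summable)
    show "((\<lambda>k. norm (c k)) has_sum (\<Sum>k\<in>?B. norm (c k))) (A \<rightarrow>\<^sub>E UNIV)"
      by (rule has_sum_finite_neutralI[OF B]) (simp_all add: 0)
  qed
qed

lemma compactin_polydisc: "compactin (product_topology (\<lambda>_. euclidean) A) (A \<rightarrow>\<^sub>E cball (0::complex) R)"
  by (simp add: compactin_PiE)

lemma compactin_polydisc_bound:
  fixes K :: "('v \<Rightarrow> complex) set"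
  assumes A: "finite A" and K: "compactin (product_topology (\<lambda>_. euclidean) A) K"
  obtains R where "R > 0" "K \<subseteq> A \<rightarrow>\<^sub>E cball 0 R"
proof -
  have KA: "K \<subseteq> A \<rightarrow>\<^sub>E UNIV" using compactin_subset_topspace[OF K] by simp
  have "\<exists>R. \<forall>z\<in>K. norm (z a) \<le> R" if "a \<in> A" for a
  proof -
    have "compactin euclidean ((\<lambda>z. z a) ` K)"
      by (rule image_compactin[OF K continuous_map_product_projection[OF that]])
    then have "bounded ((\<lambda>z. z a) ` K)" by (auto intro: compact_imp_bounded)
    then show ?thesis by (auto simp: bounded_iff)
  qed
  then obtain r where r: "\<And>a z. a \<in> A \<Longrightarrow> z \<in> K \<Longrightarrow> norm (z a) \<le> r a" by metis
  show ?thesis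
  proof (rule that[of "1 + (\<Sum>a\<in>A. \<bar>r a\<bar>)"])
    show "K \<subseteq> A \<rightarrow>\<^sub>E cball 0 (1 + (\<Sum>a\<in>A. \<bar>r a\<bar>))"
    proof
      fix z assume z: "z \<in> K"
      have "norm (z a) \<le> 1 + (\<Sum>a\<in>A. \<bar>r a\<bar>)" if a: "a \<in> A" for a
      proof -
        have "\<bar>r a\<bar> \<le> (\<Sum>a\<in>A. \<bar>r a\<bar>)" by (rule member_le_sum) (use a A in auto)
        then show ?thesis using r[OF a z] by linarith
      qed
      then show "z \<in> A \<rightarrow>\<^sub>E cball 0 (1 + (\<Sum>a\<in>A. \<bar>r a\<bar>))" using KA z by (auto simp: PiE_iff)
    qed
  qed (simp add: sum_nonneg add_pos_nonneg)
qed

text \<open>Closed polydiscs are compact, and every compact set lies in one because its projections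
  are bounded.\<close>

lemma t_stable_function_polydisc:
  assumes "finite A"
  shows "t_stable_function A f \<longleftrightarrow> (\<exists>p. (\<forall>m. stable_polynomial A (p m)) \<and>
    (\<forall>R. uniform_limit (A \<rightarrow>\<^sub>E cball 0 R) p f sequentially))"
proof -
  have "(\<forall>K. compactin (product_topology (\<lambda>_. euclidean) A) K \<longrightarrow> uniform_limit K p f sequentially) \<longleftrightarrow>
      (\<forall>R. uniform_limit (A \<rightarrow>\<^sub>E cball 0 R) p f sequentially)" (is "?L \<longleftrightarrow> ?R") for p
  proof
    assume ?L then show ?R using compactin_polydisc by blast
  next
    assume R: ?R
    show ?L
    proof safe
      fix K :: "('a \<Rightarrow> complex) set" assume "compactin (product_topology (\<lambda>_. euclidean) A) K"
      then obtain r where "K \<subseteq> A \<rightarrow>\<^sub>E cball 0 r" using compactin_polydisc_bound[OF assms] by metis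
      then show "uniform_limit K p f sequentially" using R uniform_limit_on_subset by blast
    qed
  qed
  then show ?thesis unfolding t_stable_function_def by simp
qed

text \<open>At a site with k particles, a given set of k slots can be filled by labelled particles
  in k! orders, each of probability 1 / N^k. The weight depends on S only through its occupation
  numbers.\<close>

definition occ_weight :: "'v set \<Rightarrow> nat \<Rightarrow> (('v \<Rightarrow> nat) \<Rightarrow> real) \<Rightarrow> ('v \<times> nat) set \<Rightarrow> real" where
  "occ_weight A N a S = a (restrict (occ S) A) * (\<Prod>x\<in>A. fact (occ S x) / of_nat N ^ occ S x)"

lemma prod_occ:
  assumes "finite A" "finite S" "S \<subseteq> A \<times> UNIV"
  shows "(\<Prod>x\<in>A. c ^ occ S x) = (c :: 'b :: comm_monoid_mult) ^ card S"
proof -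
  have "(\<Prod>x\<in>A. c ^ occ S x) = (\<Prod>x\<in>A. \<Prod>e\<in>{e. e \<in> S \<and> fst e = x}. c)" by (simp add: occ_def)
  also have "\<dots> = (\<Prod>e\<in>S. c)" using assms by (intro prod.group) auto
  finally show ?thesis by simp
qed

text \<open>
  \<open>A \<times> {..<N}\<close> gives every variable \<open>N\<close> slots. The law of the occupied slots, when a
  configuration with law \<open>a\<close> is thrown into the slots and multiple occupation is forbidden, has a
  stable multiaffine generating polynomial.
\<close>

lemma t_stable_multiaffine:
  fixes a :: "('v \<Rightarrow> nat) \<Rightarrow> real"
  assumes A: "finite A" and f: "t_stable_function A f"
    and a: "\<And>z. z \<in> A \<rightarrow>\<^sub>E UNIV \<Longrightarrow> ((\<lambda>k. of_real (a k) * (\<Prod>x\<in>A. z x ^ k x)) has_sum f z) (A \<rightarrow>\<^sub>E UNIV)"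
    and N: "N > 0" and nz: "wsum (A \<times> {..<N}) (occ_weight A N a) (\<lambda>_. 1) \<noteq> 0"
    and y: "y \<in> upper_poly (A \<times> {..<N})"
  shows "multiaffine (A \<times> {..<N}) (\<lambda>S. of_real (occ_weight A N a S)) y \<noteq> 0"
proof -
  let ?E = "A \<times> {..<N}"
  let ?I = "A \<rightarrow>\<^sub>E (UNIV :: nat set)"
  have E: "finite ?E" "?E \<subseteq> A \<times> UNIV" using A by auto
  let ?\<phi> = "\<lambda>S. (\<Prod>x\<in>A. fact (occ S x)) :: complex"
  define b where "b S = ?\<phi> S * of_real (a (restrict (occ S) A))" for S
  \<comment> \<open>The powers of N are absorbed by y_e / N, which preserves the upper half plane;
    what remains are the coefficients produced by the operators 1 + y d/dx.\<close>
  have scale: "multiaffine ?E (\<lambda>S. of_real (occ_weight A N a S)) y = multiaffine ?E b (\<lambda>e. y e / of_nat N)" for y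
    unfolding multiaffine_def
  proof (intro sum.cong refl)
    fix S assume "S \<in> Pow ?E"
    then have S: "finite S" "S \<subseteq> A \<times> UNIV" using E finite_subset by auto
    have "of_real (occ_weight A N a S) = b S / (\<Prod>x\<in>A. of_nat N ^ occ S x)"
      by (simp add: occ_weight_def b_def prod_dividef mult.commute)
    also have "(\<Prod>x\<in>A. of_nat N ^ occ S x) = (of_nat N ^ card S :: complex)" by (rule prod_occ[OF A S])
    finally show "of_real (occ_weight A N a S) * prod y S = b S * (\<Prod>e\<in>S. y e / of_nat N)"
      by (simp add: prod_dividef)
  qed
  obtain p where p: "\<And>m. stable_polynomial A (p m)" and lim: "\<And>R. uniform_limit (A \<rightarrow>\<^sub>E cball 0 R) p f sequentially"
    using f unfolding t_stable_function_polydisc[OF A] by blast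
  have "\<exists>D c. in_box A D c \<and> (\<forall>z. z \<in> A \<rightarrow>\<^sub>E UNIV \<longrightarrow> p m z = box_poly A D c z)" for m
    using polynomial_function_box[OF A, of "p m"] p[of m] unfolding stable_polynomial_def by metis
  then obtain D c where c: "\<And>m. in_box A (D m) (c m)" and pc: "\<And>m z. z \<in> A \<rightarrow>\<^sub>E UNIV \<Longrightarrow> p m z = box_poly A (D m) (c m) z"
    by metis
  have pnz: "box_poly A (D m) (c m) x \<noteq> 0" if "x \<in> upper_poly A" for m x
  proof -
    have "p m (restrict x A) \<noteq> 0" using p[of m] that unfolding stable_polynomial_def upper_poly_def by auto
    then show ?thesis using pc[of "restrict x A" m] by (simp add: box_poly_restrict)
  qed
  have as: "(\<lambda>k. norm (of_real (a k) :: complex)) summable_on ?I"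
  proof -
    have "(\<lambda>k. of_real (a k) * (\<Prod>x\<in>A. (\<lambda>x\<in>A. 1) x ^ k x) :: complex) summable_on ?I"
      using a[of "\<lambda>x\<in>A. 1"] by (auto simp: summable_on_def)
    then have "(\<lambda>k. of_real (a k) :: complex) summable_on ?I" by simp
    then show ?thesis by (simp only: summable_on_iff_abs_summable_on_complex[of "\<lambda>k. of_real (a k)" ?I])
  qed
  \<comment> \<open>Uniform closeness on the torus bounds all coefficients at once.\<close>
  have coeff: "\<exists>m. \<forall>k\<in>?I. norm (c m k - of_real (a k)) \<le> \<delta>" if "\<delta> > 0" for \<delta> :: real
  proof -
    have "\<forall>\<^sub>F m in sequentially. \<forall>z\<in>A \<rightarrow>\<^sub>E cball 0 1. dist (p m z) (f z) < \<delta>"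
      by (rule uniform_limitD[OF lim \<open>\<delta> > 0\<close>])
    then obtain m where m: "\<And>z. z \<in> A \<rightarrow>\<^sub>E cball 0 1 \<Longrightarrow> dist (p m z) (f z) < \<delta>"
      using eventually_happens'[OF sequentially_bot] by blast
    have "norm (c m k - of_real (a k)) \<le> \<delta>" if k: "k \<in> ?I" for k
    proof (rule coeff_bound_torus[OF A _ _ _ k, where c = "\<lambda>k. c m k - of_real (a k)" and g = "\<lambda>z. p m z - f z"])
      show "(\<lambda>k. norm (c m k - of_real (a k))) summable_on ?I"
      proof (rule summable_on_comparison_test[OF summable_on_add[OF box_poly_has_sum(2)[OF A c] as]])
        show "norm (c m k - of_real (a k)) \<le> norm (c m k) + norm (of_real (a k) :: complex)" for k
          by (rule norm_triangle_ineq4)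
      qed auto
      fix z :: "'v \<Rightarrow> complex" assume z: "z \<in> A \<rightarrow>\<^sub>E sphere 0 1"
      then have z': "z \<in> A \<rightarrow>\<^sub>E UNIV" "z \<in> A \<rightarrow>\<^sub>E cball 0 1" by (auto simp: PiE_iff)
      show "((\<lambda>k. (c m k - of_real (a k)) * (\<Prod>a\<in>A. z a ^ k a)) has_sum p m z - f z) ?I"
        using has_sum_add[OF box_poly_has_sum(1)[OF A c, of m z] has_sum_cmult_right[OF a[OF z'(1)], of "-1"]]
          pc[OF z'(1), of m] by (simp add: left_diff_distrib)
      show "norm (p m z - f z) \<le> \<delta>" using m[OF z'(2)] by (simp add: dist_norm)
    qed
    then show ?thesis by blast
  qed
  then have "\<exists>m. \<forall>k\<in>?I. norm (c m k - of_real (a k)) \<le> inverse (real (Suc n))" for n by simp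
  then obtain m where m: "\<And>n k. k \<in> ?I \<Longrightarrow> norm (c (m n) k - of_real (a k)) \<le> inverse (real (Suc n))" by metis
  have "\<exists>b. (\<forall>y\<in>upper_poly ?E. multiaffine ?E b y \<noteq> 0) \<and>
    (\<forall>S\<subseteq>?E. norm (b S - ?\<phi> S * c (m n) (restrict (occ S) A)) < inverse (real (Suc n)))" for n
    using multiaffine_approximation[OF A E c pnz, of "inverse (real (Suc n))" "m n"] by (metis inverse_positive_iff_positive of_nat_0_less_iff zero_less_Suc)
  then obtain B where B: "\<And>n y. y \<in> upper_poly ?E \<Longrightarrow> multiaffine ?E (B n) y \<noteq> 0"
    "\<And>n S. S \<subseteq> ?E \<Longrightarrow> norm (B n S - ?\<phi> S * c (m n) (restrict (occ S) A)) < inverse (real (Suc n))" by metis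
  have Blim: "(\<lambda>n. B n S) \<longlonglongrightarrow> b S" if S: "S \<subseteq> ?E" for S
  proof (rule LIMSEQ_I)
    fix r :: real assume "r > 0"
    have "(\<lambda>n. inverse (real (Suc n)) * (1 + norm (?\<phi> S))) \<longlonglongrightarrow> 0 * (1 + norm (?\<phi> S))"
      by (intro tendsto_mult LIMSEQ_inverse_real_of_nat tendsto_const)
    then have "\<forall>\<^sub>F n in sequentially. inverse (real (Suc n)) * (1 + norm (?\<phi> S)) < r"
      using \<open>r > 0\<close> by (intro order_tendstoD(2)[of _ 0]) simp
    then obtain n0 where n0: "\<And>n. n \<ge> n0 \<Longrightarrow> inverse (real (Suc n)) * (1 + norm (?\<phi> S)) < r"
      unfolding eventually_sequentially by blast
    have "norm (B n S - b S) < r" if "n \<ge> n0" for n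
    proof -
      let ?k = "restrict (occ S) A"
      have "B n S - b S = (B n S - ?\<phi> S * c (m n) ?k) + ?\<phi> S * (c (m n) ?k - of_real (a ?k))"
        by (simp add: b_def algebra_simps)
      then have "norm (B n S - b S) \<le> norm (B n S - ?\<phi> S * c (m n) ?k) + norm (?\<phi> S) * norm (c (m n) ?k - of_real (a ?k))"
        by (metis norm_triangle_ineq norm_mult)
      also have "\<dots> \<le> inverse (real (Suc n)) + norm (?\<phi> S) * inverse (real (Suc n))"
        by (intro add_mono mult_left_mono less_imp_le[OF B(2)[OF S]] m) auto
      also have "\<dots> < r" using n0[OF that] by (simp add: algebra_simps)
      finally show ?thesis .
    qed
    then show "\<exists>n0. \<forall>n\<ge>n0. norm (B n S - b S) < r" by blast
  qed
  have div: "(\<lambda>e. y e / of_nat N) \<in> upper_poly ?E" if "y \<in> upper_poly ?E" for y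
    using that N by (auto simp: upper_poly_def Im_divide_of_nat)
  \<comment> \<open>Nonzero total weight provides the point that Hurwitz's theorem needs.\<close>
  have "(\<Sum>S\<in>Pow ?E. complex_of_real (occ_weight A N a S)) \<noteq> 0"
    using nz by (simp add: wsum_def flip: of_real_sum)
  then obtain v where v: "v \<in> upper_poly ?E" "multiaffine ?E (\<lambda>S. of_real (occ_weight A N a S)) v \<noteq> 0"
    using multiaffine_nonzero_near_one[OF E(1)] by metis
  show ?thesis unfolding scale
    by (rule multiaffine_hurwitz[OF E(1) Blim B(1) div[OF v(1)] v(2)[unfolded scale] div[OF y]])
qed

text \<open>A set of slots is the family of its slices: for each x, a subset of size
  \<open>k x\<close> of the N slots.\<close>

lemma card_occ_fiber:
  assumes A: "finite A" and k: "k \<in> A \<rightarrow>\<^sub>E UNIV"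
  shows "card {S \<in> Pow (A \<times> {..<N}). restrict (occ S) A = k} = (\<Prod>x\<in>A. N choose k x)"
proof -
  have "bij_betw (\<lambda>S. \<lambda>x\<in>A. {i. (x, i) \<in> S}) {S \<in> Pow (A \<times> {..<N}). restrict (occ S) A = k}
     (\<Pi>\<^sub>E x\<in>A. {B. B \<subseteq> {..<N} \<and> card B = k x})"
  proof (rule bij_betw_byWitness[where f' = "\<lambda>\<sigma>. Sigma A \<sigma>"])
    have occ: "occ S x = card {i. (x, i) \<in> S}" for S and x :: 'a
    proof -
      have "{e \<in> S. fst e = x} = Pair x ` {i. (x, i) \<in> S}" by force
      then show ?thesis unfolding occ_def by (simp add: card_image inj_on_def)
    qed
    show "\<forall>S\<in>{S \<in> Pow (A \<times> {..<N}). restrict (occ S) A = k}. Sigma A (\<lambda>x\<in>A. {i. (x, i) \<in> S}) = S" by auto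
    show "\<forall>\<sigma>\<in>\<Pi>\<^sub>E x\<in>A. {B. B \<subseteq> {..<N} \<and> card B = k x}. (\<lambda>x\<in>A. {i. (x, i) \<in> Sigma A \<sigma>}) = \<sigma>"
      by (auto simp: fun_eq_iff PiE_iff extensional_def)
    show "(\<lambda>S. \<lambda>x\<in>A. {i. (x, i) \<in> S}) ` {S \<in> Pow (A \<times> {..<N}). restrict (occ S) A = k}
        \<subseteq> (\<Pi>\<^sub>E x\<in>A. {B. B \<subseteq> {..<N} \<and> card B = k x})"
      by (auto simp: occ[symmetric])
    show "Sigma A ` (\<Pi>\<^sub>E x\<in>A. {B. B \<subseteq> {..<N} \<and> card B = k x}) \<subseteq> {S \<in> Pow (A \<times> {..<N}). restrict (occ S) A = k}"
    proof safe
      fix \<sigma> assume \<sigma>: "\<sigma> \<in> (\<Pi>\<^sub>E x\<in>A. {B. B \<subseteq> {..<N} \<and> card B = k x})"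
      show "restrict (occ (Sigma A \<sigma>)) A = k"
      proof (rule extensionalityI[of _ A])
        show "restrict (occ (Sigma A \<sigma>)) A x = k x" if "x \<in> A" for x using \<sigma> that by (auto simp: occ)
      qed (use k in \<open>auto simp: PiE_iff\<close>)
      fix x i assume "x \<in> A" "i \<in> \<sigma> x"
      then show "i < N" using \<sigma> by auto
    qed
  qed
  then have "card {S \<in> Pow (A \<times> {..<N}). restrict (occ S) A = k} = card (\<Pi>\<^sub>E x\<in>A. {B. B \<subseteq> {..<N} \<and> card B = k x})"
    by (rule bij_betw_same_card)
  also have "\<dots> = (\<Prod>x\<in>A. N choose k x)" using A by (simp add: card_PiE n_subsets)
  finally show ?thesis .
qed

text \<open>For N > 0, the probability that at every x the k x particles, thrown independently and
  uniformly into N slots, fall into different slots.\<close>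

definition no_collision :: "'v set \<Rightarrow> nat \<Rightarrow> ('v \<Rightarrow> nat) \<Rightarrow> real" where
  "no_collision A N k = (\<Prod>x\<in>A. of_nat (N choose k x) * fact (k x) / of_nat N ^ k x)"

lemma wsum_occ_weight:
  assumes A: "finite A"
  shows "wsum (A \<times> {..<N}) (occ_weight A N a) (\<lambda>S. \<phi> (restrict (occ S) A))
     = (\<Sum>k\<in>A \<rightarrow>\<^sub>E {..N}. a k * no_collision A N k * \<phi> k)"
proof -
  let ?E = "A \<times> {..<N}"
  let ?h = "\<lambda>S. occ_weight A N a S * \<phi> (restrict (occ S) A)"
  have "occ S x \<le> N" if "S \<in> Pow ?E" for S x
  proof -
    have "{e \<in> S. fst e = x} \<subseteq> Pair x ` {..<N}" using that by auto
    then have "card {e \<in> S. fst e = x} \<le> card (Pair x ` {..<N})" by (intro card_mono) auto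
    then show ?thesis unfolding occ_def using card_image_le[of "{..<N}" "Pair x"] by simp
  qed
  then have im: "(\<lambda>S. restrict (occ S) A) ` Pow ?E \<subseteq> A \<rightarrow>\<^sub>E {..N}" by auto
  have "wsum ?E (occ_weight A N a) (\<lambda>S. \<phi> (restrict (occ S) A)) =
      (\<Sum>k\<in>A \<rightarrow>\<^sub>E {..N}. \<Sum>S\<in>{S. S \<in> Pow ?E \<and> restrict (occ S) A = k}. ?h S)"
    unfolding wsum_def using A by (subst sum.group[OF _ _ im]) (auto intro: finite_PiE)
  also have "\<dots> = (\<Sum>k\<in>A \<rightarrow>\<^sub>E {..N}. a k * no_collision A N k * \<phi> k)"
  proof (intro sum.cong refl)
    fix k assume k: "k \<in> A \<rightarrow>\<^sub>E {..N}"
    have "?h S = a k * (\<Prod>x\<in>A. fact (k x) / of_nat N ^ k x) * \<phi> k" if "restrict (occ S) A = k" for S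
      unfolding occ_weight_def that[symmetric] by (simp cong: prod.cong)
    then have "(\<Sum>S\<in>{S. S \<in> Pow ?E \<and> restrict (occ S) A = k}. ?h S) =
        (\<Sum>S\<in>{S. S \<in> Pow ?E \<and> restrict (occ S) A = k}. a k * (\<Prod>x\<in>A. fact (k x) / of_nat N ^ k x) * \<phi> k)"
      by (intro sum.cong refl) blast
    also have "\<dots> = real (card {S. S \<in> Pow ?E \<and> restrict (occ S) A = k}) * (a k * (\<Prod>x\<in>A. fact (k x) / of_nat N ^ k x) * \<phi> k)"
      by (simp only: sum_constant)
    also have "card {S. S \<in> Pow ?E \<and> restrict (occ S) A = k} = (\<Prod>x\<in>A. N choose k x)"
      using card_occ_fiber[OF A, of k N] k by (auto simp: PiE_iff)
    also have "real (\<Prod>x\<in>A. N choose k x) * (a k * (\<Prod>x\<in>A. fact (k x) / of_nat N ^ k x) * \<phi> k) = a k * no_collision A N k * \<phi> k"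
      by (simp add: no_collision_def prod_dividef prod.distrib)
    finally show "(\<Sum>S\<in>{S. S \<in> Pow ?E \<and> restrict (occ S) A = k}. ?h S) = a k * no_collision A N k * \<phi> k" .
  qed
  finally show ?thesis .
qed

lemma no_collision_bounds: "0 \<le> no_collision A N k" "no_collision A N k \<le> 1"
proof -
  have "real (N choose j) * fact j / real N ^ j \<le> 1" for j
  proof (cases "N = 0 \<and> j > 0")
    case False
    then have "real N ^ j > 0" by (cases j) auto
    moreover have "real ((N choose j) * fact j) \<le> real (N ^ j)" using binomial_fact_pow of_nat_mono by blast
    ultimately show ?thesis by (simp add: divide_le_eq)
  qed (auto simp: power_0_left)
  then show "0 \<le> no_collision A N k" "no_collision A N k \<le> 1"
    unfolding no_collision_def by (auto intro!: prod_nonneg prod_le_1)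
qed

lemma no_collision_eq_0: "finite A \<Longrightarrow> k \<in> (A \<rightarrow>\<^sub>E UNIV) - (A \<rightarrow>\<^sub>E {..N}) \<Longrightarrow> no_collision A N k = 0"
  unfolding no_collision_def by (auto simp: PiE_iff not_le intro!: prod_zero)

lemma no_collision_tendsto: "(\<lambda>N. no_collision A N k) \<longlonglongrightarrow> 1"
proof -
  have "(\<lambda>N. real (N choose j) * fact j / real N ^ j) \<longlonglongrightarrow> 1" for j
  proof -
    have eq: "real (N choose j) * fact j / real N ^ j = (\<Prod>i<j. 1 - real i / real N)" if "N > 0" for N
    proof -
      have "real (N choose j) * fact j = (\<Prod>i<j. real N - real i)"
        by (simp add: binomial_gbinomial gbinomial_prod_rev atLeast0LessThan)
      also have "\<dots> = (\<Prod>i<j. (1 - real i / real N) * real N)" using that by (intro prod.cong) (auto simp: field_simps)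
      finally show ?thesis using that by (simp add: prod.distrib)
    qed
    have "(\<lambda>N. \<Prod>i<j. 1 - real i / real N) \<longlonglongrightarrow> (\<Prod>i<j. 1 - 0)"
      by (intro tendsto_prod tendsto_diff tendsto_const lim_const_over_n)
    then have "(\<lambda>N. \<Prod>i<j. 1 - real i / real N) \<longlonglongrightarrow> 1" by simp
    then show ?thesis
      by (rule Lim_transform_eventually) (rule eventually_mono[OF eventually_gt_at_top[of 0]], simp add: eq)
  qed
  then have "(\<lambda>N. no_collision A N k) \<longlonglongrightarrow> (\<Prod>x\<in>A. 1)" unfolding no_collision_def by (intro tendsto_prod)
  then show ?thesis by simp
qed

section \<open>Generating functions of random configurations\<close>

lemma (in prob_space) expectation_finite_values:
  fixes \<psi> :: "'b \<Rightarrow> real"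
  assumes B: "finite B" and Y: "\<And>k. k \<in> B \<Longrightarrow> {\<omega>\<in>space M. Y \<omega> = k} \<in> events"
    and \<psi>: "\<And>\<omega>. \<omega> \<in> space M \<Longrightarrow> Y \<omega> \<notin> B \<Longrightarrow> \<psi> (Y \<omega>) = 0"
  shows "expectation (\<lambda>\<omega>. \<psi> (Y \<omega>)) = (\<Sum>k\<in>B. prob {\<omega>\<in>space M. Y \<omega> = k} * \<psi> k)"
proof -
  have "expectation (\<lambda>\<omega>. \<psi> (Y \<omega>)) = expectation (\<lambda>\<omega>. \<Sum>k\<in>B. \<psi> k * indicator {\<omega>\<in>space M. Y \<omega> = k} \<omega>)"
  proof (rule Bochner_Integration.integral_cong)
    fix \<omega> assume \<omega>: "\<omega> \<in> space M"
    have "(\<Sum>k\<in>B. \<psi> k * indicator {\<omega>\<in>space M. Y \<omega> = k} \<omega>) = (\<Sum>k\<in>B. if k = Y \<omega> then \<psi> (Y \<omega>) else 0)"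
      using \<omega> by (intro sum.cong) (auto simp: indicator_def)
    then show "\<psi> (Y \<omega>) = (\<Sum>k\<in>B. \<psi> k * indicator {\<omega>\<in>space M. Y \<omega> = k} \<omega>)"
      using B \<psi>[OF \<omega>] by simp
  qed simp
  also have "\<dots> = (\<Sum>k\<in>B. expectation (\<lambda>\<omega>. \<psi> k * indicator {\<omega>\<in>space M. Y \<omega> = k} \<omega>))"
    using Y by (intro Bochner_Integration.integral_sum integrable_mult_right) (auto simp: emeasure_eq_measure)
  also have "\<dots> = (\<Sum>k\<in>B. prob {\<omega>\<in>space M. Y \<omega> = k} * \<psi> k)"
  proof (intro sum.cong refl)
    fix k assume "k \<in> B"
    have "{\<omega>\<in>space M. Y \<omega> = k} \<inter> space M = {\<omega>\<in>space M. Y \<omega> = k}" by auto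
    then show "expectation (\<lambda>\<omega>. \<psi> k * indicator {\<omega>\<in>space M. Y \<omega> = k} \<omega>) = prob {\<omega>\<in>space M. Y \<omega> = k} * \<psi> k"
      by simp
  qed
  finally show ?thesis .
qed

text \<open>For complex terms unconditional summability is absolute summability, that is,
  integrability for the counting measure; hence an equivalence.\<close>

lemma (in prob_space) discrete_expectation:
  fixes \<phi> :: "'b \<Rightarrow> complex"
  assumes I: "countable I" and Y: "Y \<in> measurable M (count_space I)"
  shows "integrable M (\<lambda>\<omega>. \<phi> (Y \<omega>)) \<longleftrightarrow> (\<lambda>k. of_real (prob {\<omega>\<in>space M. Y \<omega> = k}) * \<phi> k) summable_on I"
    and "integrable M (\<lambda>\<omega>. \<phi> (Y \<omega>)) \<Longrightarrow>
      ((\<lambda>k. of_real (prob {\<omega>\<in>space M. Y \<omega> = k}) * \<phi> k) has_sum expectation (\<lambda>\<omega>. \<phi> (Y \<omega>))) I"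
proof -
  let ?p = "\<lambda>k. prob {\<omega>\<in>space M. Y \<omega> = k}"
  have D: "distr M (count_space I) Y = density (count_space I) ?p"
  proof (rule measure_eqI_countable[OF _ _ I])
    fix k assume k: "k \<in> I"
    have "emeasure (distr M (count_space I) Y) {k} = emeasure M (Y -` {k} \<inter> space M)"
      using Y k by (intro emeasure_distr) auto
    also have "Y -` {k} \<inter> space M = {\<omega>\<in>space M. Y \<omega> = k}" by auto
    also have "emeasure M \<dots> = ennreal (?p k)" by (simp add: emeasure_eq_measure)
    also have "\<dots> = emeasure (density (count_space I) ?p) {k}"
    proof -
      have "emeasure (density (count_space I) ?p) {k} = (\<integral>\<^sup>+x. ennreal (?p x) * indicator {k} x \<partial>count_space I)"
        using k by (subst emeasure_density) auto
      also have "\<dots> = (\<integral>\<^sup>+x. ennreal (?p k) * indicator {k} x \<partial>count_space I)"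
        by (intro nn_integral_cong) (auto simp: indicator_def)
      also have "\<dots> = ennreal (?p k) * emeasure (count_space I) {k}"
        using k by (intro nn_integral_cmult_indicator) auto
      finally show ?thesis using k by simp
    qed
    finally show "emeasure (distr M (count_space I) Y) {k} = emeasure (density (count_space I) ?p) {k}" .
  qed auto
  have 1: "integrable M (\<lambda>\<omega>. \<phi> (Y \<omega>)) \<longleftrightarrow> integrable (count_space I) (\<lambda>k. of_real (?p k) * \<phi> k)"
  proof -
    have "integrable M (\<lambda>\<omega>. \<phi> (Y \<omega>)) \<longleftrightarrow> integrable (density (count_space I) ?p) \<phi>"
      using integrable_distr_eq[OF Y, of \<phi>] by (simp add: D)
    also have "\<dots> \<longleftrightarrow> integrable (count_space I) (\<lambda>k. ?p k *\<^sub>R \<phi> k)"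
      by (rule integrable_density) auto
    finally show ?thesis by (simp add: scaleR_conv_of_real)
  qed
  have 2: "integrable (count_space I) g \<longleftrightarrow> g summable_on I" for g :: "'b \<Rightarrow> complex"
    using abs_summable_equivalent[of g I] summable_on_iff_abs_summable_on_complex[of g I]
    by (simp add: abs_summable_on_def)
  show "integrable M (\<lambda>\<omega>. \<phi> (Y \<omega>)) \<longleftrightarrow> (\<lambda>k. of_real (?p k) * \<phi> k) summable_on I" using 1 2 by simp
  assume int: "integrable M (\<lambda>\<omega>. \<phi> (Y \<omega>))"
  have "expectation (\<lambda>\<omega>. \<phi> (Y \<omega>)) = integral\<^sup>L (density (count_space I) ?p) \<phi>"
    using integral_distr[OF Y, of \<phi>] by (simp add: D)
  also have "\<dots> = integral\<^sup>L (count_space I) (\<lambda>k. ?p k *\<^sub>R \<phi> k)"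
    by (rule integral_density) auto
  also have "\<dots> = infsum (\<lambda>k. of_real (?p k) * \<phi> k) I"
  proof -
    have "integrable (count_space I) (\<lambda>k. of_real (?p k) * \<phi> k)" using int 1 by simp
    then show ?thesis using infsetsum_infsum[of "\<lambda>k. of_real (?p k) * \<phi> k" I]
      by (simp add: abs_summable_on_def infsetsum_def scaleR_conv_of_real)
  qed
  finally show "((\<lambda>k. of_real (?p k) * \<phi> k) has_sum expectation (\<lambda>\<omega>. \<phi> (Y \<omega>))) I"
    using int 1 2 by (simp add: has_sum_infsum)
qed

text \<open>The series has to converge at every z, so finiteness of all exponential moments of the
  coordinates in A is included.\<close>

definition has_gf :: "'w measure \<Rightarrow> 's set \<Rightarrow> ('w \<Rightarrow> 's \<Rightarrow> nat) \<Rightarrow> (('s \<Rightarrow> complex) \<Rightarrow> complex) \<Rightarrow> bool" where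
  "has_gf M A \<eta> f \<longleftrightarrow> (\<forall>z \<in> A \<rightarrow>\<^sub>E UNIV.
     ((\<lambda>k. of_real (measure M {\<omega>\<in>space M. restrict (\<eta> \<omega>) A = k}) * (\<Prod>a\<in>A. z a ^ k a)) has_sum f z) (A \<rightarrow>\<^sub>E UNIV))"

lemma restrict_measurable_count:
  fixes \<eta> :: "'w \<Rightarrow> 's \<Rightarrow> nat"
  assumes A: "finite A" and \<eta>: "\<And>x. (\<lambda>\<omega>. \<eta> \<omega> x) \<in> measurable M (count_space UNIV)"
  shows "(\<lambda>\<omega>. restrict (\<eta> \<omega>) A) \<in> measurable M (count_space (A \<rightarrow>\<^sub>E UNIV))"
    and "{\<omega>\<in>space M. restrict (\<eta> \<omega>) A = k} \<in> sets M"
proof -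
  have *: "{\<omega>\<in>space M. restrict (\<eta> \<omega>) A = k} \<in> sets M" for k
  proof (cases "k \<in> A \<rightarrow>\<^sub>E UNIV")
    case True
    have "{\<omega>\<in>space M. restrict (\<eta> \<omega>) A = k} = {\<omega>\<in>space M. \<forall>x\<in>A. \<eta> \<omega> x = k x}"
      using True by (auto simp: fun_eq_iff PiE_iff extensional_def)
    also have "\<dots> \<in> sets M"
      using A \<eta> by (intro sets.sets_Collect_finite_All) (auto intro!: measurable_sets_Collect[OF \<eta>] simp: pred_def)
    finally show ?thesis .
  next
    case False
    then have "{\<omega>\<in>space M. restrict (\<eta> \<omega>) A = k} = {}" by auto
    then show ?thesis by (simp only: sets.empty_sets)
  qed
  show "{\<omega>\<in>space M. restrict (\<eta> \<omega>) A = k} \<in> sets M" by (rule *)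
  have "countable (A \<rightarrow>\<^sub>E (UNIV :: nat set))" using A by (intro countable_PiE) auto
  then show "(\<lambda>\<omega>. restrict (\<eta> \<omega>) A) \<in> measurable M (count_space (A \<rightarrow>\<^sub>E UNIV))"
  proof (subst measurable_count_space_eq_countable, safe)
    fix k assume "k \<in> A \<rightarrow>\<^sub>E (UNIV :: nat set)"
    have "(\<lambda>\<omega>. restrict (\<eta> \<omega>) A) -` {k} \<inter> space M = {\<omega>\<in>space M. restrict (\<eta> \<omega>) A = k}" by auto
    then show "(\<lambda>\<omega>. restrict (\<eta> \<omega>) A) -` {k} \<inter> space M \<in> sets M" using * by simp
  qed auto
qed

text \<open>Trades power series for expectations, to which dominated convergence and independence
  apply.\<close>

lemma (in prob_space) has_gf_expectation:
  fixes \<eta> :: "'a \<Rightarrow> 's \<Rightarrow> nat"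
  assumes A: "finite A" and \<eta>: "\<And>x. (\<lambda>\<omega>. \<eta> \<omega> x) \<in> measurable M (count_space UNIV)"
  shows "has_gf M A \<eta> f \<longleftrightarrow> (\<forall>z \<in> A \<rightarrow>\<^sub>E UNIV. integrable M (\<lambda>\<omega>. \<Prod>a\<in>A. z a ^ \<eta> \<omega> a) \<and>
     f z = expectation (\<lambda>\<omega>. \<Prod>a\<in>A. z a ^ \<eta> \<omega> a))"
proof -
  let ?I = "A \<rightarrow>\<^sub>E (UNIV :: nat set)"
  have I: "countable ?I" using A by (intro countable_PiE) auto
  note D = discrete_expectation[OF I restrict_measurable_count(1)[where \<eta> = \<eta>, OF A \<eta>]]
  have "((\<lambda>k. of_real (prob {\<omega>\<in>space M. restrict (\<eta> \<omega>) A = k}) * (\<Prod>a\<in>A. z a ^ k a)) has_sum s) ?I \<longleftrightarrow>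
      integrable M (\<lambda>\<omega>. \<Prod>a\<in>A. z a ^ \<eta> \<omega> a) \<and> s = expectation (\<lambda>\<omega>. \<Prod>a\<in>A. z a ^ \<eta> \<omega> a)" for z :: "'s \<Rightarrow> complex" and s
  proof -
    have eq: "(\<lambda>\<omega>. \<Prod>a\<in>A. z a ^ restrict (\<eta> \<omega>) A a) = (\<lambda>\<omega>. \<Prod>a\<in>A. z a ^ \<eta> \<omega> a)"
      by (intro ext prod.cong) auto
    have D': "integrable M (\<lambda>\<omega>. \<Prod>a\<in>A. z a ^ \<eta> \<omega> a) \<longleftrightarrow>
        (\<lambda>k. of_real (prob {\<omega>\<in>space M. restrict (\<eta> \<omega>) A = k}) * (\<Prod>a\<in>A. z a ^ k a)) summable_on ?I"
      "integrable M (\<lambda>\<omega>. \<Prod>a\<in>A. z a ^ \<eta> \<omega> a) \<Longrightarrow>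
        ((\<lambda>k. of_real (prob {\<omega>\<in>space M. restrict (\<eta> \<omega>) A = k}) * (\<Prod>a\<in>A. z a ^ k a)) has_sum
          expectation (\<lambda>\<omega>. \<Prod>a\<in>A. z a ^ \<eta> \<omega> a)) ?I"
      using D(1)[where \<phi> = "\<lambda>k. \<Prod>a\<in>A. z a ^ k a"] D(2)[where \<phi> = "\<lambda>k. \<Prod>a\<in>A. z a ^ k a"]
      by (simp_all only: eq)
    show ?thesis
    proof
      assume s: "((\<lambda>k. of_real (prob {\<omega>\<in>space M. restrict (\<eta> \<omega>) A = k}) * (\<Prod>a\<in>A. z a ^ k a)) has_sum s) ?I"
      then have int: "integrable M (\<lambda>\<omega>. \<Prod>a\<in>A. z a ^ \<eta> \<omega> a)"
        unfolding D'(1) by (rule has_sum_imp_summable)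
      then show "integrable M (\<lambda>\<omega>. \<Prod>a\<in>A. z a ^ \<eta> \<omega> a) \<and> s = expectation (\<lambda>\<omega>. \<Prod>a\<in>A. z a ^ \<eta> \<omega> a)"
        using has_sum_unique[OF s D'(2)[OF int]] by simp
    next
      assume "integrable M (\<lambda>\<omega>. \<Prod>a\<in>A. z a ^ \<eta> \<omega> a) \<and> s = expectation (\<lambda>\<omega>. \<Prod>a\<in>A. z a ^ \<eta> \<omega> a)"
      then show "((\<lambda>k. of_real (prob {\<omega>\<in>space M. restrict (\<eta> \<omega>) A = k}) * (\<Prod>a\<in>A. z a ^ k a)) has_sum s) ?I"
        using D'(2) by simp
    qed
  qed
  then show ?thesis unfolding has_gf_def by simp
qed

lemma measurable_borel_nat: "measurable M (borel :: nat measure) = measurable M (count_space UNIV)"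
  by (rule measurable_cong_sets) (simp_all add: sets_borel_eq_count_space)

lemma t_stable_finite_measure_distr:
  fixes \<eta> :: "'w \<Rightarrow> 's::countable \<Rightarrow> nat"
  assumes A: "finite A" and \<eta>: "\<eta> \<in> measurable M borel"
  shows "t_stable_finite_measure A (distr (distr M borel \<eta>) (PiM A (\<lambda>_. count_space UNIV)) (\<lambda>\<eta>. restrict \<eta> A)) \<longleftrightarrow>
    (\<exists>f. t_stable_function A f \<and> has_gf M A \<eta> f)"
proof -
  have r: "(\<lambda>\<eta> :: 's \<Rightarrow> nat. restrict \<eta> A) \<in> measurable borel (PiM A (\<lambda>_. count_space UNIV))"
  proof (rule measurable_restrict)
    fix x :: 's
    show "(\<lambda>\<eta> :: 's \<Rightarrow> nat. \<eta> x) \<in> measurable borel (count_space UNIV)"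
      unfolding measurable_borel_nat[symmetric] by (rule measurable_product_coordinates)
  qed
  have "measure (distr (distr M borel \<eta>) (PiM A (\<lambda>_. count_space UNIV)) (\<lambda>\<eta>. restrict \<eta> A)) {k}
      = measure M {\<omega>\<in>space M. restrict (\<eta> \<omega>) A = k}" if k: "k \<in> A \<rightarrow>\<^sub>E UNIV" for k
  proof -
    have "{k} = PiE A (\<lambda>x. {k x})" using k PiE_singleton[of k A] by (simp add: PiE_def)
    also have "\<dots> \<in> sets (PiM A (\<lambda>_. count_space UNIV))" using A by (intro sets_PiM_I_finite) auto
    finally have s: "{k} \<in> sets (PiM A (\<lambda>_. count_space (UNIV :: nat set)))" .
    have "distr (distr M borel \<eta>) (PiM A (\<lambda>_. count_space UNIV)) (\<lambda>\<eta>. restrict \<eta> A)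
        = distr M (PiM A (\<lambda>_. count_space UNIV)) ((\<lambda>\<eta>. restrict \<eta> A) \<circ> \<eta>)"
      by (rule distr_distr[OF r \<eta>])
    then have "measure (distr (distr M borel \<eta>) (PiM A (\<lambda>_. count_space UNIV)) (\<lambda>\<eta>. restrict \<eta> A)) {k}
      = measure M (((\<lambda>\<eta>. restrict \<eta> A) \<circ> \<eta>) -` {k} \<inter> space M)"
      using measure_distr[OF measurable_comp[OF \<eta> r] s] by simp
    also have "((\<lambda>\<eta>. restrict \<eta> A) \<circ> \<eta>) -` {k} \<inter> space M = {\<omega>\<in>space M. restrict (\<eta> \<omega>) A = k}" by auto
    finally show ?thesis .
  qed
  then show ?thesis unfolding t_stable_finite_measure_def has_gf_def
    by (intro ex_cong1 conj_cong refl ball_cong has_sum_cong) auto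
qed

context prob_space
begin

context
  fixes \<eta> :: "'a \<Rightarrow> 's \<Rightarrow> nat" and A f
  assumes A: "finite A" and \<eta>: "\<And>x. (\<lambda>\<omega>. \<eta> \<omega> x) \<in> measurable M (count_space UNIV)"
    and f: "t_stable_function A f" and gf: "has_gf M A \<eta> f"
begin

text \<open>Integrates H against the probability of having no collision among N slots per site. Left
  unnormalized, as its total mass tends to 1.\<close>

definition thinned :: "nat \<Rightarrow> (('s \<Rightarrow> nat) \<Rightarrow> real) \<Rightarrow> real" where
  "thinned N H = expectation (\<lambda>\<omega>. no_collision A N (restrict (\<eta> \<omega>) A) * H (\<eta> \<omega>))"

abbreviation "slot_weight N \<equiv> occ_weight A N (\<lambda>k. prob {\<omega>\<in>space M. restrict (\<eta> \<omega>) A = k})"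

text \<open>The intersection keeps the argument of \<open>occ\<close> finite. Without it
  monotonicity in S would fail, because an infinite set has \<open>card\<close> 0.\<close>

lemma thinned_eq_wsum:
  assumes H: "depends_only_on A H"
  shows "thinned N H = wsum (A \<times> {..<N}) (slot_weight N) (\<lambda>S. H (occ (S \<inter> A \<times> {..<N})))"
proof -
  let ?e = "\<lambda>k x. if x \<in> A then k x else (0 :: nat)"
  let ?a = "\<lambda>k. prob {\<omega>\<in>space M. restrict (\<eta> \<omega>) A = k}"
  have He: "H (\<eta> \<omega>) = H (?e (restrict (\<eta> \<omega>) A))" for \<omega>
    using H unfolding depends_only_on_def by (auto intro!: H[unfolded depends_only_on_def, rule_format])
  have "thinned N H = expectation (\<lambda>\<omega>. (\<lambda>k. no_collision A N k * H (?e k)) (restrict (\<eta> \<omega>) A))"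
    unfolding thinned_def He ..
  also have "\<dots> = (\<Sum>k\<in>A \<rightarrow>\<^sub>E {..N}. ?a k * (no_collision A N k * H (?e k)))"
  proof (rule expectation_finite_values)
    show "finite (A \<rightarrow>\<^sub>E {..N})" using A by (rule finite_PiE) simp
    show "{\<omega>\<in>space M. restrict (\<eta> \<omega>) A = k} \<in> events" for k by (rule restrict_measurable_count(2)[where \<eta> = \<eta>, OF A \<eta>])
    show "no_collision A N (restrict (\<eta> \<omega>) A) * H (?e (restrict (\<eta> \<omega>) A)) = 0"
      if "restrict (\<eta> \<omega>) A \<notin> A \<rightarrow>\<^sub>E {..N}" for \<omega>
      using no_collision_eq_0[OF A, of "restrict (\<eta> \<omega>) A" N] that by simp
  qed
  also have "\<dots> = wsum (A \<times> {..<N}) (slot_weight N) (\<lambda>S. H (?e (restrict (occ S) A)))"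
    using wsum_occ_weight[OF A, of N ?a "\<lambda>k. H (?e k)"] by (simp add: mult.assoc)
  also have "\<dots> = wsum (A \<times> {..<N}) (slot_weight N) (\<lambda>S. H (occ (S \<inter> A \<times> {..<N})))"
  proof (rule wsum_cong)
    fix S assume S: "S \<subseteq> A \<times> {..<N}"
    then have "?e (restrict (occ S) A) = occ S" using occ_eq_0[of S A] by fastforce
    moreover have "S \<inter> A \<times> {..<N} = S" using S by auto
    ultimately show "slot_weight N S * H (?e (restrict (occ S) A)) = slot_weight N S * H (occ (S \<inter> A \<times> {..<N}))" by simp
  qed
  finally show ?thesis .
qed

text \<open>The no-collision factor lies in [0, 1] and tends to 1 for each configuration, so |H|
  dominates.\<close>

lemma thinned_tendsto:
  assumes H: "integrable M (\<lambda>\<omega>. H (\<eta> \<omega>))"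
  shows "(\<lambda>N. thinned N H) \<longlonglongrightarrow> expectation (\<lambda>\<omega>. H (\<eta> \<omega>))"
  unfolding thinned_def
proof (rule integral_dominated_convergence[where w = "\<lambda>\<omega>. norm (H (\<eta> \<omega>))"])
  show "(\<lambda>\<omega>. H (\<eta> \<omega>)) \<in> borel_measurable M" using H by simp
  have "(\<lambda>\<omega>. no_collision A N (restrict (\<eta> \<omega>) A)) \<in> borel_measurable M" for N
    by (rule measurable_compose[OF restrict_measurable_count(1)[where \<eta> = \<eta>, OF A \<eta>]]) simp
  then show "(\<lambda>\<omega>. no_collision A N (restrict (\<eta> \<omega>) A) * H (\<eta> \<omega>)) \<in> borel_measurable M" for N
    using H by (intro borel_measurable_times) auto
  show "integrable M (\<lambda>\<omega>. norm (H (\<eta> \<omega>)))" using H by simp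
  have "(\<lambda>N. no_collision A N (restrict (\<eta> \<omega>) A) * H (\<eta> \<omega>)) \<longlonglongrightarrow> 1 * H (\<eta> \<omega>)" for \<omega>
    by (intro tendsto_mult no_collision_tendsto tendsto_const)
  then show "AE \<omega> in M. (\<lambda>N. no_collision A N (restrict (\<eta> \<omega>) A) * H (\<eta> \<omega>)) \<longlonglongrightarrow> H (\<eta> \<omega>)" by simp
  have "norm (no_collision A N (restrict (\<eta> \<omega>) A) * H (\<eta> \<omega>)) \<le> norm (H (\<eta> \<omega>))" for N \<omega>
    using no_collision_bounds[of A N "restrict (\<eta> \<omega>) A"] by (simp add: abs_mult mult_left_le_one_le)
  then show "AE \<omega> in M. norm (no_collision A N (restrict (\<eta> \<omega>) A) * H (\<eta> \<omega>)) \<le> norm (H (\<eta> \<omega>))" for N by simp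
qed

text \<open>The total slot weight tends to 1, so it is eventually positive, which excludes the zero
  polynomial.\<close>

lemma eventually_slot_stable:
  "\<forall>\<^sub>F N in sequentially. wsum (A \<times> {..<N}) (slot_weight N) (\<lambda>_. 1) > 0 \<and>
     (\<forall>y\<in>upper_poly (A \<times> {..<N}). multiaffine (A \<times> {..<N}) (\<lambda>S. of_real (slot_weight N S)) y \<noteq> 0)"
proof -
  have "(\<lambda>N. thinned N (\<lambda>_. 1)) \<longlonglongrightarrow> 1" using thinned_tendsto[of "\<lambda>_. 1"] by (simp add: prob_space)
  then have "\<forall>\<^sub>F N in sequentially. thinned N (\<lambda>_. 1) > 0" by (rule order_tendstoD) simp
  then show ?thesis using eventually_gt_at_top[of 0]
  proof eventually_elim
    case (elim N)
    then have p: "wsum (A \<times> {..<N}) (slot_weight N) (\<lambda>_. 1) > 0"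
      using thinned_eq_wsum[of "\<lambda>_. 1" N] by (simp add: depends_only_on_def)
    moreover have "multiaffine (A \<times> {..<N}) (\<lambda>S. of_real (slot_weight N S)) y \<noteq> 0"
      if "y \<in> upper_poly (A \<times> {..<N})" for y
      using gf p elim that by (intro t_stable_multiaffine[OF A f]) (auto simp: has_gf_def)
    ultimately show ?case by blast
  qed
qed

lemma slot_weight_nonneg: "slot_weight N S \<ge> 0"
  unfolding occ_weight_def by (intro mult_nonneg_nonneg prod_nonneg) auto

lemma occ_mono: "finite T \<Longrightarrow> S \<subseteq> T \<Longrightarrow> occ S \<le> occ T"
  unfolding occ_def le_fun_def by (auto intro!: card_mono)

text \<open>For fixed N, F and G become increasing functions of disjoint sets of slots, where
  negative association is known; the inequality passes to the limit in N.\<close>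

lemma negatively_associated_finite:
  assumes F: "mono F" "depends_only_on A1 F" and G: "mono G" "depends_only_on A2 G"
    and A12: "A1 \<inter> A2 = {}" "A1 \<subseteq> A" "A2 \<subseteq> A"
    and int: "integrable M (\<lambda>\<omega>. F (\<eta> \<omega>))" "integrable M (\<lambda>\<omega>. G (\<eta> \<omega>))" "integrable M (\<lambda>\<omega>. F (\<eta> \<omega>) * G (\<eta> \<omega>))"
  shows "expectation (\<lambda>\<omega>. F (\<eta> \<omega>) * G (\<eta> \<omega>)) \<le> expectation (\<lambda>\<omega>. F (\<eta> \<omega>)) * expectation (\<lambda>\<omega>. G (\<eta> \<omega>))"
proof -
  have sub: "depends_only_on A H" if "depends_only_on A' H" "A' \<subseteq> A" for A' H
    unfolding depends_only_on_def
  proof (intro allI impI)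
    fix \<eta> \<zeta> :: "'s \<Rightarrow> nat" assume "\<forall>x\<in>A. \<eta> x = \<zeta> x"
    then have "\<forall>x\<in>A'. \<eta> x = \<zeta> x" using that(2) by blast
    then show "H \<eta> = H \<zeta>" using that(1) unfolding depends_only_on_def by blast
  qed
  have FG: "depends_only_on A F" "depends_only_on A G"
    using sub[OF F(2) A12(2)] sub[OF G(2) A12(3)] .
  have "depends_only_on A (\<lambda>\<eta>. F \<eta> * G \<eta>)"
    unfolding depends_only_on_def
  proof (intro allI impI)
    fix \<eta> \<zeta> :: "'s \<Rightarrow> nat" assume "\<forall>x\<in>A. \<eta> x = \<zeta> x"
    then have "F \<eta> = F \<zeta>" "G \<eta> = G \<zeta>" using FG unfolding depends_only_on_def by blast+
    then show "F \<eta> * G \<eta> = F \<zeta> * G \<zeta>" by simp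
  qed
  moreover have "depends_only_on A (\<lambda>_. 1)" by (simp add: depends_only_on_def)
  ultimately have dep: "depends_only_on A F" "depends_only_on A G" "depends_only_on A (\<lambda>\<eta>. F \<eta> * G \<eta>)"
    "depends_only_on A (\<lambda>_. 1)" using FG by blast+
  have lim1: "(\<lambda>N. thinned N (\<lambda>_. 1)) \<longlonglongrightarrow> 1" using thinned_tendsto[of "\<lambda>_. 1"] by (simp add: prob_space)
  have "\<forall>\<^sub>F N in sequentially. thinned N (\<lambda>\<eta>. F \<eta> * G \<eta>) * thinned N (\<lambda>_. 1) \<le> thinned N F * thinned N G"
    using eventually_slot_stable
  proof eventually_elim
    case (elim N)
    let ?E = "A \<times> {..<N}"
    have m: "mono (\<lambda>S. H (occ (S \<inter> ?E)))" if "mono H" for H :: "('s \<Rightarrow> nat) \<Rightarrow> real"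
      using A by (intro monoI monoD[OF that] occ_mono) auto
    have d: "H (occ (S \<inter> ?E)) = H (occ ((S \<inter> (A' \<times> UNIV)) \<inter> ?E))" if "depends_only_on A' H" for H :: "('s \<Rightarrow> nat) \<Rightarrow> real" and S A'
    proof (rule that[unfolded depends_only_on_def, rule_format])
      fix x assume "x \<in> A'"
      then have "{e \<in> S \<inter> ?E. fst e = x} = {e \<in> S \<inter> (A' \<times> UNIV) \<inter> ?E. fst e = x}" by auto
      then show "occ (S \<inter> ?E) x = occ (S \<inter> (A' \<times> UNIV) \<inter> ?E) x" by (simp only: occ_def)
    qed
    show ?case unfolding thinned_eq_wsum[OF dep(1)] thinned_eq_wsum[OF dep(2)] thinned_eq_wsum[OF dep(3)] thinned_eq_wsum[OF dep(4)]
      by (rule multiaffine_negatively_associated[OF _ slot_weight_nonneg _ m[OF F(1)] m[OF G(1)] d[OF F(2)] d[OF G(2)]])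
        (use A elim A12 in auto)
  qed
  from tendsto_le[OF _ tendsto_mult[OF thinned_tendsto[OF int(1)] thinned_tendsto[OF int(2)]]
      tendsto_mult[OF thinned_tendsto[OF int(3)] lim1] this]
  show ?thesis by simp
qed

text \<open>With all slot variables equal to x, the slot polynomial counts occupied slots. Its zeros
  avoid both open half planes because the coefficients are real, and the positive axis because these
  are nonnegative and not all 0. So the three point inequality applies for each large N, and the
  value at 1 tends to 1.\<close>

lemma three_point_moment_bound:
  defines "V r \<equiv> \<lambda>\<omega>. (\<Prod>x\<in>A. (r :: real) ^ \<eta> \<omega> x)"
  shows "integrable M (V r)"
    and "expectation (V (1 + real m / 2)) * expectation (V (1 / 2)) ^ m \<le> 1"
proof -
  let ?P = "\<lambda>r \<zeta>. \<Prod>x\<in>A. (r :: real) ^ \<zeta> x"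
  show int: "integrable M (V r)" for r
  proof -
    define z where "z = restrict (\<lambda>_. complex_of_real r) A"
    have "z \<in> A \<rightarrow>\<^sub>E UNIV" by (simp add: z_def)
    then have "integrable M (\<lambda>\<omega>. \<Prod>a\<in>A. z a ^ \<eta> \<omega> a)"
      using gf unfolding has_gf_expectation[where \<eta> = \<eta>, OF A \<eta>] by blast
    moreover have "(\<Prod>a\<in>A. z a ^ \<eta> \<omega> a) = of_real (V r \<omega>)" for \<omega>
      by (simp add: V_def z_def)
    ultimately have "integrable M (\<lambda>\<omega>. complex_of_real (V r \<omega>))" by simp
    from integrable_Re[OF this] show ?thesis by simp
  qed
  have dep: "depends_only_on A (?P r)" "depends_only_on A (\<lambda>_. 1)" for r by (auto simp: depends_only_on_def)
  have lim1: "(\<lambda>N. thinned N (\<lambda>_. 1)) \<longlonglongrightarrow> 1" using thinned_tendsto[of "\<lambda>_. 1"] by (simp add: prob_space)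
  have lim: "(\<lambda>N. thinned N (?P r)) \<longlonglongrightarrow> expectation (V r)" for r
    using thinned_tendsto[of "?P r"] int[of r] by (simp add: V_def)
  have "\<forall>\<^sub>F N in sequentially. thinned N (?P (1 + real m / 2)) * thinned N (?P (1 / 2)) ^ m \<le> thinned N (\<lambda>_. 1) ^ Suc m"
    using eventually_slot_stable
  proof eventually_elim
    case (elim N)
    let ?E = "A \<times> {..<N}"
    have E: "finite ?E" using A by simp
    define q where "q = (\<Sum>S\<in>Pow ?E. monom (complex_of_real (slot_weight N S)) (card S))"
    have q: "poly q x = multiaffine ?E (\<lambda>S. of_real (slot_weight N S)) (\<lambda>_. x)" for x
      by (simp add: q_def poly_sum poly_monom multiaffine_def)
    have qr: "poly q (of_real r) = of_real (wsum ?E (slot_weight N) (\<lambda>S. r ^ card S))" for r :: real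
      by (simp add: q multiaffine_def wsum_def)
    have thin: "thinned N (?P r) = wsum ?E (slot_weight N) (\<lambda>S. r ^ card S)" for r
      unfolding thinned_eq_wsum[OF dep(1)]
    proof (rule wsum_cong)
      fix S assume S: "S \<subseteq> ?E"
      then have "finite S" "S \<subseteq> A \<times> UNIV" "S \<inter> ?E = S" using E finite_subset by auto
      then show "slot_weight N S * ?P r (occ (S \<inter> ?E)) = slot_weight N S * r ^ card S"
        using prod_occ[OF A, of S r] by simp
    qed
    have pos: "wsum ?E (slot_weight N) (\<lambda>S. r ^ card S) \<ge> 0" if "r \<ge> 0" for r
      unfolding wsum_def using slot_weight_nonneg that by (intro sum_nonneg mult_nonneg_nonneg) auto
    have n: "norm (poly q (of_real r)) = thinned N (?P r)" if "r \<ge> 0" for r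
      using pos[OF that] by (simp add: qr thin)
    have root: "x \<in> \<real> \<and> Re x \<le> 0" if "poly q x = 0" for x
    proof -
      have "\<not> Im x > 0" using elim that unfolding q upper_poly_def by auto
      moreover have "\<not> Im x < 0"
      proof
        assume "Im x < 0"
        then have "poly q (cnj x) \<noteq> 0" using elim unfolding q upper_poly_def by auto
        then show False using that multiaffine_cnj[of ?E "slot_weight N" "\<lambda>_. x"] by (simp add: q)
      qed
      ultimately have x: "x = of_real (Re x)" by (simp add: complex_eq_iff)
      have "Re x \<le> 0"
      proof (rule ccontr)
        assume "\<not> Re x \<le> 0"
        then have r: "Re x > 0" by simp
        have "wsum ?E (slot_weight N) (\<lambda>S. Re x ^ card S) = 0" using that x qr[of "Re x"] by simp
        then have "\<forall>S\<in>Pow ?E. slot_weight N S * Re x ^ card S = 0"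
          unfolding wsum_def using E slot_weight_nonneg r by (subst (asm) sum_nonneg_eq_0_iff) auto
        then have "\<forall>S\<in>Pow ?E. slot_weight N S = 0" using r by auto
        then show False using elim by (simp add: wsum_def)
      qed
      then show ?thesis using x by (metis Reals_of_real)
    qed
    have "thinned N (?P (1 + real m / 2)) * thinned N (?P (1 / 2)) ^ m \<le> thinned N (?P 1) ^ Suc m"
      using real_rooted_three_point[of q m, OF root] n[of "1 + real m / 2"] n[of "1 / 2"] n[of 1] by simp
    then show ?case by simp
  qed
  from tendsto_le[OF _ tendsto_power[OF lim1] tendsto_mult[OF lim tendsto_power[OF lim]] this]
  show "expectation (V (1 + real m / 2)) * expectation (V (1 / 2)) ^ m \<le> 1" by simp
qed

end

end

section \<open>Negative association and closure properties\<close>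

lemma tendsto_coordinatewise:
  fixes f :: "'n \<Rightarrow> 'a \<Rightarrow> 'b :: topological_space"
  assumes "\<And>x. ((\<lambda>n. f n x) \<longlongrightarrow> l x) F"
  shows "(f \<longlongrightarrow> l) F"
proof -
  have "limitin (product_topology (\<lambda>_. euclidean) UNIV) f l F"
    using assms by (simp add: limitin_componentwise)
  then show ?thesis by (simp add: euclidean_product_topology)
qed

text \<open>The remaining sites get 0, the least value, so cutting off can only lower an increasing
  function.\<close>

definition cutoff :: "nat \<Rightarrow> ('s::countable \<Rightarrow> nat) \<Rightarrow> 's \<Rightarrow> nat" where
  "cutoff n \<eta> = (\<lambda>x. if to_nat x < n then \<eta> x else 0)"

lemma cutoff_mono: "mono (cutoff n)"
  by (auto simp: mono_def le_fun_def cutoff_def)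

lemma cutoff_le: "cutoff n \<eta> \<le> \<eta>"
  by (auto simp: le_fun_def cutoff_def)

lemma cutoff_tendsto: "(\<lambda>n. cutoff n \<eta>) \<longlonglongrightarrow> \<eta>"
proof (rule tendsto_coordinatewise)
  fix x
  have "\<forall>\<^sub>F n in sequentially. cutoff n \<eta> x = \<eta> x"
    using eventually_gt_at_top[of "to_nat x"] by eventually_elim (simp add: cutoff_def)
  then show "(\<lambda>n. cutoff n \<eta> x) \<longlonglongrightarrow> \<eta> x" by (rule tendsto_eventually)
qed

lemma finite_to_nat_less: "finite {x :: 's :: countable. to_nat x < n}"
  using finite_vimageI[OF finite_lessThan[of n] inj_to_nat] by (simp add: vimage_def)

text \<open>
  Continuity is used only to approximate by functions of finitely many coordinates; the value at
  \<open>0\<close> is subtracted to make the functions nonnegative, so that domination is free.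
\<close>

theorem t_stable_measure_negatively_associated:
  fixes \<mu> :: "('s::countable \<Rightarrow> nat) measure"
  assumes \<mu>: "t_stable_measure \<mu>"
  shows "negatively_associated \<mu>"
proof -
  have ps: "prob_space \<mu>" and sets: "sets \<mu> = sets borel"
    and ts: "\<And>A. finite A \<Longrightarrow> t_stable_finite_measure A (distr \<mu> (PiM A (\<lambda>_. count_space UNIV)) (\<lambda>\<eta>. restrict \<eta> A))"
    using \<mu> unfolding t_stable_measure_def by blast+
  interpret prob_space \<mu> by (rule ps)
  have id: "(\<lambda>\<eta>. \<eta>) \<in> measurable \<mu> borel" using measurable_ident_sets[OF sets] .
  have coord: "(\<lambda>\<eta>. \<eta> x) \<in> measurable \<mu> (count_space UNIV)" for x :: 's
    unfolding measurable_borel_nat[symmetric] using measurable_product_then_coordinatewise[OF id] .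
  have "\<exists>f. t_stable_function A f \<and> has_gf \<mu> A (\<lambda>\<eta>. \<eta>) f" if "finite A" for A
    using t_stable_finite_measure_distr[OF that id] ts[OF that] distr_id2[OF sets[symmetric]] by simp
  then obtain f where f: "\<And>A. finite A \<Longrightarrow> t_stable_function A (f A)" "\<And>A. finite A \<Longrightarrow> has_gf \<mu> A (\<lambda>\<eta>. \<eta>) (f A)"
    by metis
  have main: "(\<integral>\<eta>. F \<eta> * G \<eta> \<partial>\<mu>) \<le> (\<integral>\<eta>. F \<eta> \<partial>\<mu>) * (\<integral>\<eta>. G \<eta> \<partial>\<mu>)"
    if F: "mono F" "continuous_on UNIV F" "depends_only_on A F" "integrable \<mu> F"
      and G: "mono G" "continuous_on UNIV G" "depends_only_on B G" "integrable \<mu> G"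
      and AB: "A \<inter> B = {}" and FG: "integrable \<mu> (\<lambda>\<eta>. F \<eta> * G \<eta>)" for F G A B
  proof -
    define F' where "F' \<eta> = F \<eta> - F (\<lambda>_. 0)" for \<eta>
    define G' where "G' \<eta> = G \<eta> - G (\<lambda>_. 0)" for \<eta>
    have le: "0 \<le> H (cutoff n \<eta>) - H (\<lambda>_. 0)" "H (cutoff n \<eta>) \<le> H \<eta>" if "mono H" for H :: "('s \<Rightarrow> nat) \<Rightarrow> real" and n \<eta>
      using monoD[OF that cutoff_le] monoD[OF that, of "\<lambda>_. 0" "cutoff n \<eta>"] by (auto simp: le_fun_def)
    have bd: "0 \<le> F' (cutoff n \<eta>)" "F' (cutoff n \<eta>) \<le> F' \<eta>" "0 \<le> G' (cutoff n \<eta>)" "G' (cutoff n \<eta>) \<le> G' \<eta>" for n \<eta>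
      using le[OF F(1)] le[OF G(1)] by (auto simp: F'_def G'_def)
    have cutm: "cutoff n \<in> measurable \<mu> borel" for n
    proof (rule measurable_coordinatewise_then_product)
      fix x :: 's
      show "(\<lambda>\<eta>. cutoff n \<eta> x) \<in> borel_measurable \<mu>"
        unfolding cutoff_def by (cases "to_nat x < n") (simp_all add: measurable_product_then_coordinatewise[OF id])
    qed
    have meas: "(\<lambda>\<eta>. H (cutoff n \<eta>)) \<in> borel_measurable \<mu>" if "continuous_on UNIV H" for H :: "('s \<Rightarrow> nat) \<Rightarrow> real" and n
      by (rule measurable_compose[OF cutm borel_measurable_continuous_onI[OF that]])
    have cont: "continuous_on UNIV F'" "continuous_on UNIV G'"
      unfolding F'_def G'_def by (intro continuous_intros F G)+
    have int: "integrable \<mu> F'" "integrable \<mu> G'" "integrable \<mu> (\<lambda>\<eta>. F' \<eta> * G' \<eta>)"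
      using F(4) G(4) FG by (simp_all add: F'_def[abs_def] G'_def[abs_def] algebra_simps)
    have lim: "(\<lambda>n. H (cutoff n \<eta>)) \<longlonglongrightarrow> H \<eta>" if "continuous_on UNIV H" for H :: "('s \<Rightarrow> nat) \<Rightarrow> real" and \<eta>
      using continuous_on_tendsto_compose[OF that cutoff_tendsto] by simp
    have "0 \<le> F' (cutoff n \<eta>) * G' (cutoff n \<eta>) \<and> F' (cutoff n \<eta>) * G' (cutoff n \<eta>) \<le> F' \<eta> * G' \<eta>" for n \<eta>
      using bd by (auto intro!: mult_mono order_trans[OF bd(1) bd(2)])
    then have bdFG: "norm (F' (cutoff n \<eta>) * G' (cutoff n \<eta>)) \<le> F' \<eta> * G' \<eta>" for n \<eta> by simp
    have bdF: "norm (F' (cutoff n \<eta>)) \<le> F' \<eta>" "norm (G' (cutoff n \<eta>)) \<le> G' \<eta>" for n \<eta> using bd by auto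
    note mF = meas[OF cont(1)] and mG = meas[OF cont(2)]
    have mFG: "(\<lambda>\<eta>. F' (cutoff n \<eta>) * G' (cutoff n \<eta>)) \<in> borel_measurable \<mu>" for n using mF mG by (rule borel_measurable_times)
    have intn: "integrable \<mu> (\<lambda>\<eta>. F' (cutoff n \<eta>))" "integrable \<mu> (\<lambda>\<eta>. G' (cutoff n \<eta>))"
      "integrable \<mu> (\<lambda>\<eta>. F' (cutoff n \<eta>) * G' (cutoff n \<eta>))" for n
    proof -
      have dom: "integrable \<mu> h" if "integrable \<mu> g" "h \<in> borel_measurable \<mu>" "\<And>\<eta>. norm (h \<eta>) \<le> g \<eta>"
        for g h :: "('s \<Rightarrow> nat) \<Rightarrow> real"
        by (rule Bochner_Integration.integrable_bound[OF that(1,2)]) (use that(3) in \<open>auto intro!: AE_I2 order_trans[OF _ abs_ge_self]\<close>)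
      show "integrable \<mu> (\<lambda>\<eta>. F' (cutoff n \<eta>))" by (rule dom[OF int(1) mF bdF(1)])
      show "integrable \<mu> (\<lambda>\<eta>. G' (cutoff n \<eta>))" by (rule dom[OF int(2) mG bdF(2)])
      show "integrable \<mu> (\<lambda>\<eta>. F' (cutoff n \<eta>) * G' (cutoff n \<eta>))" by (rule dom[OF int(3) mFG bdFG])
    qed
    have NA: "(\<integral>\<eta>. F' (cutoff n \<eta>) * G' (cutoff n \<eta>) \<partial>\<mu>) \<le> (\<integral>\<eta>. F' (cutoff n \<eta>) \<partial>\<mu>) * (\<integral>\<eta>. G' (cutoff n \<eta>) \<partial>\<mu>)" for n
    proof -
      let ?N = "{x :: 's. to_nat x < n}"
      have mono: "mono (\<lambda>\<eta>. H (cutoff n \<eta>) - c)" if "mono H" for H :: "('s \<Rightarrow> nat) \<Rightarrow> real" and c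
        by (intro monoI diff_right_mono monoD[OF that] monoD[OF cutoff_mono])
      have dep: "depends_only_on (C \<inter> ?N) (\<lambda>\<eta>. H (cutoff n \<eta>) - c)" if "depends_only_on C H" for C and H :: "('s \<Rightarrow> nat) \<Rightarrow> real" and c
        unfolding depends_only_on_def
      proof (intro allI impI)
        fix \<eta> \<zeta> :: "'s \<Rightarrow> nat" assume "\<forall>x\<in>C \<inter> ?N. \<eta> x = \<zeta> x"
        then have "\<forall>x\<in>C. cutoff n \<eta> x = cutoff n \<zeta> x" by (auto simp: cutoff_def)
        then show "H (cutoff n \<eta>) - c = H (cutoff n \<zeta>) - c" using that unfolding depends_only_on_def by metis
      qed
      note fin = finite_to_nat_less[of n]
      show ?thesis
        unfolding F'_def G'_def
        by (rule negatively_associated_finite[where \<eta> = "\<lambda>\<eta>. \<eta>", OF fin coord f(1)[OF fin] f(2)[OF fin] mono[OF F(1)] dep[OF F(3)]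
            mono[OF G(1)] dep[OF G(3)] _ _ _ intn[unfolded F'_def G'_def]]) (use AB in auto)
    qed
    have "(\<integral>\<eta>. F' \<eta> * G' \<eta> \<partial>\<mu>) \<le> (\<integral>\<eta>. F' \<eta> \<partial>\<mu>) * (\<integral>\<eta>. G' \<eta> \<partial>\<mu>)"
    proof (rule LIMSEQ_le)
      show "(\<lambda>n. \<integral>\<eta>. F' (cutoff n \<eta>) * G' (cutoff n \<eta>) \<partial>\<mu>) \<longlonglongrightarrow> (\<integral>\<eta>. F' \<eta> * G' \<eta> \<partial>\<mu>)"
        by (rule integral_dominated_convergence[OF _ mFG int(3)])
          (use int(3) bdFG lim[OF cont(1)] lim[OF cont(2)] in \<open>auto intro!: AE_I2 tendsto_mult\<close>)
      have "(\<lambda>n. \<integral>\<eta>. F' (cutoff n \<eta>) \<partial>\<mu>) \<longlonglongrightarrow> (\<integral>\<eta>. F' \<eta> \<partial>\<mu>)"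
        by (rule integral_dominated_convergence[OF _ mF int(1)])
          (use int(1) bdF lim[OF cont(1)] in \<open>auto intro!: AE_I2\<close>)
      moreover have "(\<lambda>n. \<integral>\<eta>. G' (cutoff n \<eta>) \<partial>\<mu>) \<longlonglongrightarrow> (\<integral>\<eta>. G' \<eta> \<partial>\<mu>)"
        by (rule integral_dominated_convergence[OF _ mG int(2)])
          (use int(2) bdF lim[OF cont(2)] in \<open>auto intro!: AE_I2\<close>)
      ultimately show "(\<lambda>n. (\<integral>\<eta>. F' (cutoff n \<eta>) \<partial>\<mu>) * (\<integral>\<eta>. G' (cutoff n \<eta>) \<partial>\<mu>)) \<longlonglongrightarrow> (\<integral>\<eta>. F' \<eta> \<partial>\<mu>) * (\<integral>\<eta>. G' \<eta> \<partial>\<mu>)"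
        by (rule tendsto_mult)
      show "\<exists>N. \<forall>n\<ge>N. (\<integral>\<eta>. F' (cutoff n \<eta>) * G' (cutoff n \<eta>) \<partial>\<mu>) \<le> (\<integral>\<eta>. F' (cutoff n \<eta>) \<partial>\<mu>) * (\<integral>\<eta>. G' (cutoff n \<eta>) \<partial>\<mu>)"
        using NA by blast
    qed
    moreover have "(\<integral>\<eta>. F' \<eta> \<partial>\<mu>) = (\<integral>\<eta>. F \<eta> \<partial>\<mu>) - F (\<lambda>_. 0)" "(\<integral>\<eta>. G' \<eta> \<partial>\<mu>) = (\<integral>\<eta>. G \<eta> \<partial>\<mu>) - G (\<lambda>_. 0)"
      using F(4) G(4) by (simp_all add: F'_def G'_def prob_space)
    \<comment> \<open>Subtracting constants does not change a covariance.\<close>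
    moreover have "(\<integral>\<eta>. F' \<eta> * G' \<eta> \<partial>\<mu>) = (\<integral>\<eta>. (F \<eta> * G \<eta> - F (\<lambda>_. 0) * G \<eta>) - (G (\<lambda>_. 0) * F \<eta> - F (\<lambda>_. 0) * G (\<lambda>_. 0)) \<partial>\<mu>)"
      by (intro Bochner_Integration.integral_cong) (auto simp: F'_def G'_def algebra_simps)
    then have "(\<integral>\<eta>. F' \<eta> * G' \<eta> \<partial>\<mu>) = (\<integral>\<eta>. F \<eta> * G \<eta> \<partial>\<mu>) - F (\<lambda>_. 0) * (\<integral>\<eta>. G \<eta> \<partial>\<mu>) - (G (\<lambda>_. 0) * (\<integral>\<eta>. F \<eta> \<partial>\<mu>) - F (\<lambda>_. 0) * G (\<lambda>_. 0))"
      using F(4) G(4) FG by (simp add: prob_space)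
    ultimately show ?thesis by (simp add: algebra_simps)
  qed
  show ?thesis unfolding negatively_associated_def
    using ps sets main by blast
qed

section \<open>Closure of t-stability under limits and affine substitution\<close>

lemma t_stable_function_limit:
  assumes A: "finite A" and f: "\<And>n :: nat. t_stable_function A (f n)"
    and lim: "\<And>R. uniform_limit (A \<rightarrow>\<^sub>E cball 0 R) f g sequentially"
  shows "t_stable_function A g"
proof -
  \<comment> \<open>Diagonal choice: one polynomial per n, accurate to 1 / (n + 1) on the polydisc
    of radius n.\<close>
  have "\<exists>p. stable_polynomial A p \<and> (\<forall>z\<in>A \<rightarrow>\<^sub>E cball 0 (real n). dist (p z) (f n z) < inverse (real (Suc n)))" for n
  proof -
    obtain p where p: "\<And>m. stable_polynomial A (p m)" "\<And>R. uniform_limit (A \<rightarrow>\<^sub>E cball 0 R) p (f n) sequentially"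
      using f[of n] unfolding t_stable_function_polydisc[OF A] by blast
    have "\<forall>\<^sub>F m in sequentially. \<forall>z\<in>A \<rightarrow>\<^sub>E cball 0 (real n). dist (p m z) (f n z) < inverse (real (Suc n))"
      by (rule uniform_limitD[OF p(2)]) simp
    then show ?thesis using p(1) eventually_happens'[OF sequentially_bot] by blast
  qed
  then obtain p where p: "\<And>n. stable_polynomial A (p n)"
    "\<And>n z. z \<in> A \<rightarrow>\<^sub>E cball 0 (real n) \<Longrightarrow> dist (p n z) (f n z) < inverse (real (Suc n))" by metis
  have "uniform_limit (A \<rightarrow>\<^sub>E cball 0 R) p g sequentially" for R
  proof (rule uniform_limitI)
    fix e :: real assume "e > 0"
    have "\<forall>\<^sub>F n in sequentially. \<forall>z\<in>A \<rightarrow>\<^sub>E cball 0 R. dist (f n z) (g z) < e / 2"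
      using uniform_limitD[OF lim, of "e / 2"] \<open>e > 0\<close> by simp
    moreover have "\<forall>\<^sub>F n in sequentially. inverse (real (Suc n)) < e / 2"
      using order_tendstoD(2)[OF LIMSEQ_inverse_real_of_nat, of "e / 2"] \<open>e > 0\<close> by simp
    moreover have "\<forall>\<^sub>F n in sequentially. R \<le> real n" by real_asymp
    ultimately show "\<forall>\<^sub>F n in sequentially. \<forall>z\<in>A \<rightarrow>\<^sub>E cball 0 R. dist (p n z) (g z) < e"
    proof eventually_elim
      case (elim n)
      show ?case
      proof
        fix z :: "'a \<Rightarrow> complex" assume z: "z \<in> A \<rightarrow>\<^sub>E cball 0 R"
        then have "z \<in> A \<rightarrow>\<^sub>E cball 0 (real n)" using elim(3) by (auto simp: PiE_iff intro: order_trans)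
        then have "dist (p n z) (f n z) < e / 2" using p(2)[of z n] elim(2) by linarith
        moreover have "dist (f n z) (g z) < e / 2" using elim(1) z by blast
        ultimately show "dist (p n z) (g z) < e" using dist_triangle_half_r[of "f n z" "p n z" e "g z"]
          by (simp add: dist_commute)
      qed
    qed
  qed
  then show ?thesis unfolding t_stable_function_polydisc[OF A] using p(1) by blast
qed

text \<open>Exponents may repeat and need not be extensional: restricting them to A and collecting
  equal ones gives the form in the definition.\<close>

lemma polynomial_functionI:
  assumes A: "finite A" and J: "finite J"
    and p: "\<And>z. z \<in> A \<rightarrow>\<^sub>E UNIV \<Longrightarrow> p z = (\<Sum>j\<in>J. c j * (\<Prod>a\<in>A. z a ^ e j a))"
  shows "polynomial_function_on A p"
proof -
  let ?r = "\<lambda>j. restrict (e j) A"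
  let ?c = "\<lambda>k. \<Sum>j\<in>{j \<in> J. ?r j = k}. c j"
  have "p z = (\<Sum>k\<in>?r ` J. ?c k * (\<Prod>a\<in>A. z a ^ k a))" if z: "z \<in> A \<rightarrow>\<^sub>E UNIV" for z
  proof -
    have "p z = (\<Sum>k\<in>?r ` J. \<Sum>j\<in>{j \<in> J. ?r j = k}. c j * (\<Prod>a\<in>A. z a ^ e j a))"
      unfolding p[OF z] by (rule sum.image_gen[OF J])
    also have "\<dots> = (\<Sum>k\<in>?r ` J. \<Sum>j\<in>{j \<in> J. ?r j = k}. c j * (\<Prod>a\<in>A. z a ^ k a))"
    proof (intro sum.cong refl)
      fix k j assume "j \<in> {j \<in> J. ?r j = k}"
      then have "e j a = k a" if "a \<in> A" for a using that by auto
      then show "c j * (\<Prod>a\<in>A. z a ^ e j a) = c j * (\<Prod>a\<in>A. z a ^ k a)" by simp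
    qed
    finally show ?thesis by (simp add: sum_distrib_right)
  qed
  moreover have "finite (?r ` J)" "?r ` J \<subseteq> A \<rightarrow>\<^sub>E UNIV" using J by auto
  ultimately show ?thesis unfolding polynomial_function_on_def
    by (intro exI[of _ "?r ` J"] exI[of _ ?c] conjI ballI)
qed

lemma polynomial_functionE:
  assumes "polynomial_function_on A p"
  obtains K :: "('v \<Rightarrow> nat) set" and c where "finite K" "\<And>z. z \<in> A \<rightarrow>\<^sub>E UNIV \<Longrightarrow> p z = (\<Sum>k\<in>K. c k * (\<Prod>a\<in>A. z a ^ k a))"
proof -
  from assms obtain K c where "finite K \<and> K \<subseteq> A \<rightarrow>\<^sub>E (UNIV :: nat set) \<and>
      (\<forall>z \<in> A \<rightarrow>\<^sub>E UNIV. p z = (\<Sum>k\<in>K. c k * (\<Prod>a\<in>A. z a ^ k a)))"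
    unfolding polynomial_function_on_def by (elim exE)
  then show ?thesis by (intro that[of K c]) simp_all
qed

lemma polynomial_function_const: "finite A \<Longrightarrow> polynomial_function_on A (\<lambda>_. c)"
  by (rule polynomial_functionI[where J = "{()}" and c = "\<lambda>_. c" and e = "\<lambda>_ _. 0"]) auto

lemma polynomial_function_coord:
  assumes "finite A" "a \<in> A" shows "polynomial_function_on A (\<lambda>z. z a)"
proof (rule polynomial_functionI[where J = "{()}" and c = "\<lambda>_. 1" and e = "\<lambda>_ b. if b = a then 1 else 0"])
  fix z :: "'a \<Rightarrow> complex"
  have "(\<Prod>b\<in>A. z b ^ (if b = a then 1 else 0)) = (\<Prod>b\<in>A. if b = a then z b else 1)" by (intro prod.cong) auto
  then show "z a = (\<Sum>j\<in>{()}. 1 * (\<Prod>b\<in>A. z b ^ (if b = a then 1 else 0)))" using assms by simp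
qed (use assms in auto)

lemma polynomial_function_add:
  assumes A: "finite A" and p: "polynomial_function_on A p" and q: "polynomial_function_on A q"
  shows "polynomial_function_on A (\<lambda>z. p z + q z)"
proof -
  obtain K c where K: "finite K" "\<And>z. z \<in> A \<rightarrow>\<^sub>E UNIV \<Longrightarrow> p z = (\<Sum>k\<in>K. c k * (\<Prod>a\<in>A. z a ^ k a))"
    using polynomial_functionE[OF p] by metis
  obtain L d where L: "finite L" "\<And>z. z \<in> A \<rightarrow>\<^sub>E UNIV \<Longrightarrow> q z = (\<Sum>k\<in>L. d k * (\<Prod>a\<in>A. z a ^ k a))"
    using polynomial_functionE[OF q] by metis
  show ?thesis
    by (rule polynomial_functionI[where J = "K <+> L" and c = "case_sum c d" and e = "case_sum (\<lambda>k. k) (\<lambda>k. k)"])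
      (use A K L in \<open>auto simp: sum.Plus\<close>)
qed

lemma polynomial_function_mult:
  assumes A: "finite A" and p: "polynomial_function_on A p" and q: "polynomial_function_on A q"
  shows "polynomial_function_on A (\<lambda>z. p z * q z)"
proof -
  obtain K c where K: "finite K" "\<And>z. z \<in> A \<rightarrow>\<^sub>E UNIV \<Longrightarrow> p z = (\<Sum>k\<in>K. c k * (\<Prod>a\<in>A. z a ^ k a))"
    using polynomial_functionE[OF p] by metis
  obtain L d where L: "finite L" "\<And>z. z \<in> A \<rightarrow>\<^sub>E UNIV \<Longrightarrow> q z = (\<Sum>k\<in>L. d k * (\<Prod>a\<in>A. z a ^ k a))"
    using polynomial_functionE[OF q] by metis
  show ?thesis
  proof (rule polynomial_functionI[where J = "K \<times> L" and c = "\<lambda>(k, l). c k * d l" and e = "\<lambda>(k, l) a. k a + l a"])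
    fix z :: "'a \<Rightarrow> complex" assume z: "z \<in> A \<rightarrow>\<^sub>E UNIV"
    show "p z * q z = (\<Sum>j\<in>K \<times> L. (case j of (k, l) \<Rightarrow> c k * d l) * (\<Prod>a\<in>A. z a ^ (case j of (k, l) \<Rightarrow> \<lambda>a. k a + l a) a))"
      unfolding K(2)[OF z] L(2)[OF z] sum_product sum.cartesian_product
      by (intro sum.cong refl) (auto simp: power_add prod.distrib mult_ac)
  qed (use A K L in auto)
qed

lemma polynomial_function_sum:
  "finite A \<Longrightarrow> (\<And>j. j \<in> J \<Longrightarrow> polynomial_function_on A (p j)) \<Longrightarrow> polynomial_function_on A (\<lambda>z. \<Sum>j\<in>J. p j z)"
  by (induction J rule: infinite_finite_induct) (auto intro: polynomial_function_const polynomial_function_add)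

lemma polynomial_function_prod:
  "finite A \<Longrightarrow> (\<And>j. j \<in> J \<Longrightarrow> polynomial_function_on A (p j)) \<Longrightarrow> polynomial_function_on A (\<lambda>z. \<Prod>j\<in>J. p j z)"
  by (induction J rule: infinite_finite_induct) (auto intro: polynomial_function_const polynomial_function_mult)

lemma polynomial_function_power:
  "finite A \<Longrightarrow> polynomial_function_on A p \<Longrightarrow> polynomial_function_on A (\<lambda>z. p z ^ n)"
  by (induction n) (auto intro: polynomial_function_const polynomial_function_mult)

text \<open>Boundedness of the limit is carried through the induction, since products of uniform
  limits require it.\<close>

lemma uniform_limit_finite_prod:
  fixes u :: "'j \<Rightarrow> 'n \<Rightarrow> 'z \<Rightarrow> complex"
  assumes "finite J" "\<And>j. j \<in> J \<Longrightarrow> uniform_limit Z (u j) (l j) F" "\<And>j. j \<in> J \<Longrightarrow> bounded (l j ` Z)"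
  shows "uniform_limit Z (\<lambda>n z. \<Prod>j\<in>J. u j n z) (\<lambda>z. \<Prod>j\<in>J. l j z) F \<and> bounded ((\<lambda>z. \<Prod>j\<in>J. l j z) ` Z)"
  using assms
proof (induction J rule: finite_induct)
  case empty
  then show ?case by (auto simp: bounded_iff intro: uniform_limit_const)
next
  case (insert j J)
  then have IH: "uniform_limit Z (\<lambda>n z. \<Prod>j\<in>J. u j n z) (\<lambda>z. \<Prod>j\<in>J. l j z) F" "bounded ((\<lambda>z. \<Prod>j\<in>J. l j z) ` Z)" by auto
  have j: "uniform_limit Z (u j) (l j) F" "bounded (l j ` Z)" using insert by auto
  have "uniform_limit Z (\<lambda>n z. u j n z * (\<Prod>j\<in>J. u j n z)) (\<lambda>z. l j z * (\<Prod>j\<in>J. l j z)) F"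
    by (rule uniform_lim_mult[OF j(1) IH(1) j(2) IH(2)])
  moreover have "bounded ((\<lambda>z. l j z * (\<Prod>j\<in>J. l j z)) ` Z)"
  proof -
    obtain a b where "\<And>z. z \<in> Z \<Longrightarrow> norm (l j z) \<le> a" "\<And>z. z \<in> Z \<Longrightarrow> norm (\<Prod>j\<in>J. l j z) \<le> b"
      using j(2) IH(2) by (auto simp: bounded_iff)
    then have "norm (l j z * (\<Prod>j\<in>J. l j z)) \<le> a * b" if "z \<in> Z" for z
      unfolding norm_mult using that by (intro mult_mono) (auto intro: order_trans[OF norm_ge_zero])
    then show ?thesis by (auto simp: bounded_iff)
  qed
  ultimately show ?case by (simp only: prod.insert[OF insert(1,2)])
qed

text \<open>Substituting \<open>\<phi> + \<i>/n\<close> instead of \<open>\<phi>\<close> takes care of the rows of \<open>m\<close> that vanish.\<close>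

lemma stable_polynomial_affine:
  fixes m :: "'x \<Rightarrow> 'v \<Rightarrow> real" and c :: "'x \<Rightarrow> real"
  assumes A: "finite A" and B: "finite B" and p: "stable_polynomial B p"
    and m: "\<And>x a. x \<in> B \<Longrightarrow> a \<in> A \<Longrightarrow> m x a \<ge> 0"
  shows "t_stable_function A (\<lambda>z. p (\<lambda>x\<in>B. of_real (c x) + (\<Sum>a\<in>A. of_real (m x a) * z a)))"
proof -
  define \<phi> where "\<phi> z x = of_real (c x) + (\<Sum>a\<in>A. of_real (m x a) * z a)" for z :: "'v \<Rightarrow> complex" and x
  define \<epsilon> where "\<epsilon> n = \<i> / of_nat (Suc n)" for n
  obtain K d where K: "finite K" "\<And>w. w \<in> B \<rightarrow>\<^sub>E UNIV \<Longrightarrow> p w = (\<Sum>k\<in>K. d k * (\<Prod>x\<in>B. w x ^ k x))"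
    using p polynomial_functionE unfolding stable_polynomial_def by metis
  define q where "q n z = p (\<lambda>x\<in>B. \<phi> z x + \<epsilon> n)" for n z
  have q: "q n z = (\<Sum>k\<in>K. d k * (\<Prod>x\<in>B. (\<phi> z x + \<epsilon> n) ^ k x))" for n z
    unfolding q_def by (subst K(2)) auto
  have pphi: "p (\<lambda>x\<in>B. \<phi> z x) = (\<Sum>k\<in>K. d k * (\<Prod>x\<in>B. \<phi> z x ^ k x))" for z
    by (subst K(2)) auto
  have "stable_polynomial A (q n)" for n
    unfolding stable_polynomial_def
  proof (intro conjI ballI impI)
    show "polynomial_function_on A (q n)" unfolding q[abs_def] \<phi>_def
      by (intro polynomial_function_sum polynomial_function_mult polynomial_function_const polynomial_function_prod
          polynomial_function_power polynomial_function_add polynomial_function_coord A)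
    fix z :: "'v \<Rightarrow> complex" assume z: "\<forall>a\<in>A. Im (z a) > 0"
    have "Im (\<phi> z x + \<epsilon> n) > 0" if x: "x \<in> B" for x
    proof -
      have "Im (\<phi> z x) = (\<Sum>a\<in>A. m x a * Im (z a))" by (simp add: \<phi>_def)
      also have "\<dots> \<ge> 0" using m[OF x] z by (intro sum_nonneg mult_nonneg_nonneg) (auto intro: less_imp_le)
      finally have "Im (\<phi> z x) \<ge> 0" .
      moreover have "Im (\<epsilon> n) > 0" by (simp add: \<epsilon>_def Im_divide_of_nat del: of_nat_Suc)
      ultimately show ?thesis by simp
    qed
    then show "q n z \<noteq> 0" using p unfolding q_def stable_polynomial_def by simp
  qed
  moreover have "uniform_limit (A \<rightarrow>\<^sub>E cball 0 R) q (\<lambda>z. p (\<lambda>x\<in>B. \<phi> z x)) sequentially" for R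
  proof -
    let ?Z = "A \<rightarrow>\<^sub>E cball (0 :: complex) R"
    have \<epsilon>: "\<epsilon> \<longlonglongrightarrow> 0" unfolding \<epsilon>_def[abs_def] by (rule tendsto_const_over_Suc)
    have bd: "bounded ((\<lambda>z. \<phi> z x) ` ?Z)" for x
    proof -
      have "norm (\<phi> z x) \<le> \<bar>c x\<bar> + (\<Sum>a\<in>A. \<bar>m x a\<bar> * R)" if "z \<in> ?Z" for z
      proof -
        have "norm (\<phi> z x) \<le> norm (of_real (c x) :: complex) + norm (\<Sum>a\<in>A. of_real (m x a) * z a)"
          unfolding \<phi>_def by (rule norm_triangle_ineq)
        also have "norm (\<Sum>a\<in>A. of_real (m x a) * z a) \<le> (\<Sum>a\<in>A. \<bar>m x a\<bar> * R)"
          using that by (intro sum_norm_le) (auto simp: norm_mult PiE_iff intro!: mult_left_mono)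
        finally show ?thesis by simp
      qed
      then show ?thesis by (auto simp: bounded_iff)
    qed
    have u: "uniform_limit ?Z (\<lambda>n z. \<phi> z x + \<epsilon> n) (\<lambda>z. \<phi> z x) sequentially" for x
    proof (rule uniform_limitI)
      fix e :: real assume "e > 0"
      then have "\<forall>\<^sub>F n in sequentially. dist (\<epsilon> n) 0 < e" using \<epsilon> by (rule tendstoD[rotated])
      then show "\<forall>\<^sub>F n in sequentially. \<forall>z\<in>?Z. dist (\<phi> z x + \<epsilon> n) (\<phi> z x) < e"
        by eventually_elim (simp add: dist_norm)
    qed
    have pw: "uniform_limit ?Z (\<lambda>n z. (\<phi> z x + \<epsilon> n) ^ k) (\<lambda>z. \<phi> z x ^ k) sequentially \<and> bounded ((\<lambda>z. \<phi> z x ^ k) ` ?Z)" for x k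
      using uniform_limit_finite_prod[where F = sequentially and J = "{..<k}" and Z = ?Z and u = "\<lambda>_ n z. \<phi> z x + \<epsilon> n" and l = "\<lambda>_ z. \<phi> z x"] u bd by simp
    have "uniform_limit ?Z (\<lambda>n z. \<Sum>k\<in>K. d k * (\<Prod>x\<in>B. (\<phi> z x + \<epsilon> n) ^ k x)) (\<lambda>z. \<Sum>k\<in>K. d k * (\<Prod>x\<in>B. \<phi> z x ^ k x)) sequentially"
    proof (rule uniform_limit_finite_sum[OF K(1)])
      fix k
      have 1: "uniform_limit ?Z (\<lambda>n z. \<Prod>x\<in>B. (\<phi> z x + \<epsilon> n) ^ k x) (\<lambda>z. \<Prod>x\<in>B. \<phi> z x ^ k x) sequentially"
        "bounded ((\<lambda>z. \<Prod>x\<in>B. \<phi> z x ^ k x) ` ?Z)"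
        using uniform_limit_finite_prod[where F = sequentially and J = B and Z = ?Z and u = "\<lambda>x n z. (\<phi> z x + \<epsilon> n) ^ k x" and l = "\<lambda>x z. \<phi> z x ^ k x"] pw B by auto
      have 2: "bounded ((\<lambda>_. d k) ` ?Z)" by (auto simp: bounded_iff)
      show "uniform_limit ?Z (\<lambda>n z. d k * (\<Prod>x\<in>B. (\<phi> z x + \<epsilon> n) ^ k x)) (\<lambda>z. d k * (\<Prod>x\<in>B. \<phi> z x ^ k x)) sequentially"
        by (rule uniform_lim_mult[OF uniform_limit_const 1(1) 2 1(2)])
    qed
    then show ?thesis unfolding q[abs_def] pphi .
  qed
  ultimately show ?thesis unfolding t_stable_function_polydisc[OF A] \<phi>_def by blast
qed

text \<open>The affine map sends polydiscs into polydiscs, so substitution keeps uniform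
  convergence; each approximating polynomial gives a t-stable function, and t-stability is closed
  under such limits.\<close>

lemma t_stable_function_affine:
  fixes m :: "'x \<Rightarrow> 'v \<Rightarrow> real" and c :: "'x \<Rightarrow> real"
  assumes A: "finite A" and B: "finite B" and f: "t_stable_function B f"
    and m: "\<And>x a. x \<in> B \<Longrightarrow> a \<in> A \<Longrightarrow> m x a \<ge> 0"
  shows "t_stable_function A (\<lambda>z. f (\<lambda>x\<in>B. of_real (c x) + (\<Sum>a\<in>A. of_real (m x a) * z a)))"
proof -
  let ?\<phi> = "\<lambda>z. \<lambda>x\<in>B. complex_of_real (c x) + (\<Sum>a\<in>A. of_real (m x a) * z a)"
  obtain p where p: "\<And>n. stable_polynomial B (p n)" "\<And>R. uniform_limit (B \<rightarrow>\<^sub>E cball 0 R) p f sequentially"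
    using f unfolding t_stable_function_polydisc[OF B] by blast
  show ?thesis
  proof (rule t_stable_function_limit[OF A])
    show "t_stable_function A (\<lambda>z. p n (?\<phi> z))" for n by (rule stable_polynomial_affine[OF A B p(1) m])
    fix R
    let ?R = "\<Sum>x\<in>B. \<bar>c x\<bar> + (\<Sum>a\<in>A. \<bar>m x a\<bar> * \<bar>R\<bar>)"
    have "?\<phi> z \<in> B \<rightarrow>\<^sub>E cball 0 ?R" if z: "z \<in> A \<rightarrow>\<^sub>E cball 0 R" for z
    proof -
      have "norm (complex_of_real (c x) + (\<Sum>a\<in>A. of_real (m x a) * z a)) \<le> ?R" if x: "x \<in> B" for x
      proof -
        have "norm (complex_of_real (c x) + (\<Sum>a\<in>A. of_real (m x a) * z a)) \<le> norm (of_real (c x) :: complex) + norm (\<Sum>a\<in>A. of_real (m x a) * z a)"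
          by (rule norm_triangle_ineq)
        also have "norm (\<Sum>a\<in>A. of_real (m x a) * z a) \<le> (\<Sum>a\<in>A. \<bar>m x a\<bar> * \<bar>R\<bar>)"
          using z by (intro sum_norm_le) (force simp: norm_mult PiE_iff intro!: mult_left_mono)
        also have "norm (of_real (c x) :: complex) + (\<Sum>a\<in>A. \<bar>m x a\<bar> * \<bar>R\<bar>) \<le> ?R"
          using B x member_le_sum[of x B "\<lambda>x. \<bar>c x\<bar> + (\<Sum>a\<in>A. \<bar>m x a\<bar> * \<bar>R\<bar>)"] by (simp add: sum_nonneg)
        finally show ?thesis by simp
      qed
      then show ?thesis by auto
    qed
    then have sub: "?\<phi> ` (A \<rightarrow>\<^sub>E cball 0 R) \<subseteq> B \<rightarrow>\<^sub>E cball 0 ?R" by blast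
    show "uniform_limit (A \<rightarrow>\<^sub>E cball 0 R) (\<lambda>n z. p n (?\<phi> z)) (\<lambda>z. f (?\<phi> z)) sequentially"
    proof (rule uniform_limitI)
      fix e :: real assume "e > 0"
      from uniform_limitD[OF p(2) this, of ?R]
      show "\<forall>\<^sub>F n in sequentially. \<forall>z\<in>A \<rightarrow>\<^sub>E cball 0 R. dist (p n (?\<phi> z)) (f (?\<phi> z)) < e"
        by eventually_elim (use sub in blast)
    qed
  qed
qed

section \<open>Independent particles\<close>

text \<open>Stands in for conditioning on a countably valued V: finitely many atoms V = v at a time
  exhaust the space, and dominated convergence passes to the limit.\<close>

lemma integral_eq_by_values:
  fixes f g :: "'w \<Rightarrow> complex" and V :: "'w \<Rightarrow> 'v :: countable"
  assumes f: "integrable M f" and g: "integrable M g"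
    and V: "\<And>v. {\<omega>\<in>space M. V \<omega> = v} \<in> sets M"
    and eq: "\<And>v. (\<integral>\<omega>. indicator {\<omega>\<in>space M. V \<omega> = v} \<omega> *\<^sub>R f \<omega> \<partial>M) = (\<integral>\<omega>. indicator {\<omega>\<in>space M. V \<omega> = v} \<omega> *\<^sub>R g \<omega> \<partial>M)"
  shows "integral\<^sup>L M f = integral\<^sup>L M g"
proof -
  define d where "d \<omega> = f \<omega> - g \<omega>" for \<omega>
  have d: "integrable M d" unfolding d_def[abs_def] using f g by simp
  let ?S = "\<lambda>v. {\<omega>\<in>space M. V \<omega> = v}"
  have ind: "integrable M (\<lambda>\<omega>. indicator (?S v) \<omega> *\<^sub>R h \<omega>)" if "integrable M h" for v and h :: "'w \<Rightarrow> complex"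
    using integrable_mult_indicator[OF V that] .
  have 0: "(\<integral>\<omega>. indicator (?S v) \<omega> *\<^sub>R d \<omega> \<partial>M) = 0" for v
    using ind[OF f, of v] ind[OF g, of v] eq[of v] by (simp add: d_def scaleR_diff_right)
  define T where "T n = {\<omega>\<in>space M. to_nat (V \<omega>) < n}" for n
  have T: "T n \<in> sets M" for n
  proof -
    have "T n = (\<Union>v\<in>{v. to_nat v < n}. ?S v)" by (auto simp: T_def)
    then show ?thesis using V finite_to_nat_less[of n] by (auto intro!: sets.finite_UN)
  qed
  have "(\<integral>\<omega>. indicator (T n) \<omega> *\<^sub>R d \<omega> \<partial>M) = 0" for n
  proof -
    have "(\<integral>\<omega>. indicator (T n) \<omega> *\<^sub>R d \<omega> \<partial>M) = (\<integral>\<omega>. (\<Sum>v\<in>{v. to_nat v < n}. indicator (?S v) \<omega> *\<^sub>R d \<omega>) \<partial>M)"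
    proof (rule Bochner_Integration.integral_cong)
      fix \<omega> assume \<omega>: "\<omega> \<in> space M"
      have "(\<Sum>v\<in>{v. to_nat v < n}. indicator (?S v) \<omega> *\<^sub>R d \<omega>) = (\<Sum>v\<in>{v. to_nat v < n}. if v = V \<omega> then d \<omega> else 0)"
        using \<omega> by (intro sum.cong) (auto simp: indicator_def)
      also have "\<dots> = (if to_nat (V \<omega>) < n then d \<omega> else 0)"
        using finite_to_nat_less[of n, where 's = 'v] by simp
      finally show "indicator (T n) \<omega> *\<^sub>R d \<omega> = (\<Sum>v\<in>{v. to_nat v < n}. indicator (?S v) \<omega> *\<^sub>R d \<omega>)"
        using \<omega> by (simp add: T_def)
    qed simp
    also have "\<dots> = (\<Sum>v\<in>{v. to_nat v < n}. \<integral>\<omega>. indicator (?S v) \<omega> *\<^sub>R d \<omega> \<partial>M)"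
      by (intro Bochner_Integration.integral_sum ind d)
    finally show ?thesis by (simp add: 0)
  qed
  moreover have "(\<lambda>n. \<integral>\<omega>. indicator (T n) \<omega> *\<^sub>R d \<omega> \<partial>M) \<longlonglongrightarrow> integral\<^sup>L M d"
  proof (rule integral_dominated_convergence[where w = "\<lambda>\<omega>. norm (d \<omega>)"])
    show "d \<in> borel_measurable M" "integrable M (\<lambda>\<omega>. norm (d \<omega>))" using d by auto
    show "(\<lambda>\<omega>. indicator (T n) \<omega> *\<^sub>R d \<omega>) \<in> borel_measurable M" for n
      using integrable_mult_indicator[OF T d] by (rule borel_measurable_integrable)
    have "(\<lambda>n. indicator (T n) \<omega> *\<^sub>R d \<omega>) \<longlonglongrightarrow> d \<omega>" if "\<omega> \<in> space M" for \<omega>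
    proof (rule tendsto_eventually)
      show "\<forall>\<^sub>F n in sequentially. indicator (T n) \<omega> *\<^sub>R d \<omega> = d \<omega>"
        using eventually_gt_at_top[of "to_nat (V \<omega>)"] by eventually_elim (use that in \<open>simp add: T_def\<close>)
    qed
    then show "AE \<omega> in M. (\<lambda>n. indicator (T n) \<omega> *\<^sub>R d \<omega>) \<longlonglongrightarrow> d \<omega>" by (rule AE_I2)
    show "AE \<omega> in M. norm (indicator (T n) \<omega> *\<^sub>R d \<omega>) \<le> norm (d \<omega>)" for n
      by (rule AE_I2) (auto simp: indicator_def)
  qed
  ultimately have "integral\<^sup>L M d = 0" by (simp add: LIMSEQ_const_iff)
  then show ?thesis using f g by (simp add: d_def[abs_def])
qed

lemma integral_uniform_measure_eq:
  fixes f :: "'w \<Rightarrow> complex"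
  assumes "prob_space M" "E \<in> sets M" "measure M E > 0" "f \<in> borel_measurable M"
  shows "(\<integral>\<omega>. indicator E \<omega> *\<^sub>R f \<omega> \<partial>M) = measure M E *\<^sub>R integral\<^sup>L (uniform_measure M E) f"
proof -
  interpret prob_space M by fact
  have "uniform_measure M E = density M (\<lambda>\<omega>. ennreal (indicator E \<omega> / prob E))"
    unfolding uniform_measure_def emeasure_eq_measure
    by (intro density_cong) (use assms in \<open>auto simp: indicator_def divide_ennreal[symmetric]\<close>)
  then have "integral\<^sup>L (uniform_measure M E) f = (\<integral>\<omega>. (indicator E \<omega> / prob E) *\<^sub>R f \<omega> \<partial>M)"
    using assms by (simp add: integral_density)
  also have "\<dots> = (\<integral>\<omega>. (1 / prob E) *\<^sub>R (indicator E \<omega> *\<^sub>R f \<omega>) \<partial>M)"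
    by simp
  also have "\<dots> = (1 / prob E) *\<^sub>R (\<integral>\<omega>. indicator E \<omega> *\<^sub>R f \<omega> \<partial>M)"
    by (rule integral_scaleR_right)
  finally show ?thesis using assms(3) by simp
qed

lemma (in prob_space) integral_indicator_scaleR:
  fixes c :: complex
  assumes "S \<in> events"
  shows "integrable M (\<lambda>\<omega>. indicator S \<omega> *\<^sub>R c)" "expectation (\<lambda>\<omega>. indicator S \<omega> *\<^sub>R c) = prob S *\<^sub>R c"
proof -
  have int: "integrable M (indicator S :: _ \<Rightarrow> real)"
    using assms by (intro integrable_real_indicator) (simp_all add: emeasure_eq_measure)
  then show "integrable M (\<lambda>\<omega>. indicator S \<omega> *\<^sub>R c)" by (intro integrable_scaleR_left)
  have "expectation (\<lambda>\<omega>. indicator S \<omega> *\<^sub>R c) = expectation (indicator S) *\<^sub>R c"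
    using int by (intro integral_scaleR_left)
  then show "expectation (\<lambda>\<omega>. indicator S \<omega> *\<^sub>R c) = prob S *\<^sub>R c"
    using assms sets.sets_into_space[of S M] by (simp add: Int_absorb2)
qed

lemma prod_group_card:
  fixes u :: "'a \<Rightarrow> 'c :: comm_monoid_mult"
  assumes J: "finite J" and A: "finite A"
  shows "(\<Prod>i\<in>J. if h i \<in> A then u (h i) else 1) = (\<Prod>a\<in>A. u a ^ card {i\<in>J. h i = a})"
proof -
  let ?J = "{i\<in>J. h i \<in> A}"
  have "(\<Prod>i\<in>J. if h i \<in> A then u (h i) else 1) = (\<Prod>i\<in>?J. u (h i))"
    using J by (simp add: prod.inter_filter)
  also have "\<dots> = (\<Prod>a\<in>A. \<Prod>i\<in>{i. i \<in> ?J \<and> h i = a}. u (h i))"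
    using J A by (subst prod.group) auto
  also have "\<dots> = (\<Prod>a\<in>A. u a ^ card {i\<in>J. h i = a})"
  proof (intro prod.cong refl)
    fix a assume "a \<in> A"
    then have "{i. i \<in> ?J \<and> h i = a} = {i\<in>J. h i = a}" by auto
    then show "(\<Prod>i\<in>{i. i \<in> ?J \<and> h i = a}. u (h i)) = u a ^ card {i\<in>J. h i = a}" by simp
  qed
  finally show ?thesis .
qed

locale particles = prob_space M for M :: "'w measure" +
  fixes P :: "real \<Rightarrow> 's::countable \<Rightarrow> 's \<Rightarrow> real" and N :: "'w \<Rightarrow> enat" and X :: "nat \<Rightarrow> real \<Rightarrow> 'w \<Rightarrow> 's" and t :: real
  assumes P: "transition_function P" and indep: "independent_particles M P N X" and t: "0 \<le> t"
    and fin: "\<And>s x. 0 \<le> s \<Longrightarrow> AE \<omega> in M. finite (particles_at N X s \<omega> x)"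
begin

lemma N_measurable: "N \<in> measurable M (count_space UNIV)"
  and X_measurable: "0 \<le> s \<Longrightarrow> X i s \<in> measurable M (count_space UNIV)"
  using indep unfolding independent_particles_def by blast+

lemma N_sets: "{\<omega>\<in>space M. Q (N \<omega>)} \<in> events"
proof -
  have "N -` {n. Q n} \<inter> space M \<in> events" using N_measurable by (rule measurable_sets) simp
  also have "N -` {n. Q n} \<inter> space M = {\<omega>\<in>space M. Q (N \<omega>)}" by auto
  finally show ?thesis .
qed

lemma X_sets: "0 \<le> s \<Longrightarrow> {\<omega>\<in>space M. Q (X i s \<omega>)} \<in> events"
proof -
  assume s: "0 \<le> s"
  have "X i s -` {x. Q x} \<inter> space M \<in> events" using X_measurable[OF s] by (rule measurable_sets) simp
  also have "X i s -` {x. Q x} \<inter> space M = {\<omega>\<in>space M. Q (X i s \<omega>)}" by auto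
  finally show ?thesis .
qed

lemma start_event:
  assumes "finite I"
  shows "{\<omega>\<in>space M. N \<omega> = n \<and> (\<forall>i\<in>I. X i 0 \<omega> = \<xi> i)} \<in> events"
proof -
  have "{\<omega>\<in>space M. N \<omega> = n \<and> (\<forall>i\<in>I. X i 0 \<omega> = \<xi> i)} =
      {\<omega>\<in>space M. N \<omega> = n} \<inter> {\<omega>\<in>space M. \<forall>i\<in>I. X i 0 \<omega> = \<xi> i}" by auto
  also have "\<dots> \<in> events" using assms by (intro sets.Int N_sets sets.sets_Collect_finite_All X_sets) auto
  finally show ?thesis .
qed

text \<open>For finite B almost surely only finitely many particles are counted, so that conditional
  independence of finite families suffices.\<close>

definition moved :: "'s set \<Rightarrow> 'w \<Rightarrow> 's \<Rightarrow> nat" where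
  "moved B \<omega> a = card {i. enat i < N \<omega> \<and> X i 0 \<omega> \<in> B \<and> X i t \<omega> = a}"

lemma moved_measurable: "(\<lambda>\<omega>. moved B \<omega> a) \<in> measurable M (count_space UNIV)"
  unfolding moved_def
proof (rule measurable_card)
  fix i
  have "{\<omega>\<in>space M. i \<in> {i. enat i < N \<omega> \<and> X i 0 \<omega> \<in> B \<and> X i t \<omega> = a}} =
      {\<omega>\<in>space M. enat i < N \<omega>} \<inter> {\<omega>\<in>space M. X i 0 \<omega> \<in> B} \<inter> {\<omega>\<in>space M. X i t \<omega> = a}" by auto
  also have "\<dots> \<in> events" using t by (intro sets.Int N_sets X_sets) auto
  finally show "{\<omega>\<in>space M. i \<in> {i. enat i < N \<omega> \<and> X i 0 \<omega> \<in> B \<and> X i t \<omega> = a}} \<in> events" .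
qed

lemma occupation_measurable:
  assumes "0 \<le> s" shows "(\<lambda>\<omega>. occupation N X s \<omega> a) \<in> measurable M (count_space UNIV)"
  unfolding occupation_def
proof (rule measurable_card)
  fix i
  have "{\<omega>\<in>space M. i \<in> particles_at N X s \<omega> a} =
      {\<omega>\<in>space M. enat i < N \<omega>} \<inter> {\<omega>\<in>space M. X i s \<omega> = a}" by (auto simp: particles_at_def)
  also have "\<dots> \<in> events" using assms by (intro sets.Int N_sets X_sets) auto
  finally show "{\<omega>\<in>space M. i \<in> particles_at N X s \<omega> a} \<in> events" .
qed

lemma occupation_measurable_borel:
  assumes "0 \<le> s" shows "occupation N X s \<in> measurable M borel"
proof (rule measurable_coordinatewise_then_product)
  fix x
  show "(\<lambda>\<omega>. occupation N X s \<omega> x) \<in> borel_measurable M"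
    unfolding measurable_borel_nat by (rule occupation_measurable[OF assms])
qed

text \<open>
  A particle started at \<open>x\<close> contributes the factor \<open>weight x y\<close> when it is at \<open>y\<close> at time \<open>t\<close>, and
  \<open>mean_weight x\<close> is the conditional expectation of this factor.
\<close>

context
  fixes A B :: "'s set" and z :: "'s \<Rightarrow> complex"
  assumes A: "finite A" and B: "finite B"
begin

definition weight :: "'s \<Rightarrow> 's \<Rightarrow> complex" where
  "weight x y = (if x \<in> B then if y \<in> A then z y else 1 else 1)"

text \<open>Mean of z at the time t position of a particle from x, with z read as 1 off A. It is
  affine in z with slopes \<open>P t x a\<close>, which makes the generating functions
  compose.\<close>

definition mean_gf :: "'s \<Rightarrow> complex" where
  "mean_gf x = of_real (1 - (\<Sum>a\<in>A. P t x a)) + (\<Sum>a\<in>A. of_real (P t x a) * z a)"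

definition mean_weight :: "'s \<Rightarrow> complex" where
  "mean_weight x = (if x \<in> B then mean_gf x else 1)"

text \<open>On a null event both sides vanish. Otherwise the particles are independent under the
  conditional measure, and the Markov property at time 0 gives each of them the law
  \<open>P t (\<xi> i)\<close>.\<close>

lemma expectation_product_given_start:
  fixes n I \<xi>
  assumes I: "finite I" "\<And>i. i \<in> I \<Longrightarrow> enat i < n"
  defines "E \<equiv> {\<omega>\<in>space M. N \<omega> = n \<and> (\<forall>i\<in>I. X i 0 \<omega> = \<xi> i)}"
  shows "(\<integral>\<omega>. indicator E \<omega> *\<^sub>R (\<Prod>i\<in>I. weight (\<xi> i) (X i t \<omega>)) \<partial>M) = prob E *\<^sub>R (\<Prod>i\<in>I. mean_weight (\<xi> i))"
proof (cases "prob E > 0")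
  case False
  have Em: "E \<in> events" unfolding E_def by (rule start_event[OF I(1)])
  have "prob E = 0" using False measure_nonneg[of M E] by linarith
  then have "E \<in> null_sets M" using Em by (simp add: null_sets_def emeasure_eq_measure)
  then have "AE \<omega> in M. \<omega> \<notin> E" by (rule AE_not_in)
  then have "AE \<omega> in M. indicator E \<omega> *\<^sub>R (\<Prod>i\<in>I. weight (\<xi> i) (X i t \<omega>)) = 0" by eventually_elim simp
  then have "(\<integral>\<omega>. indicator E \<omega> *\<^sub>R (\<Prod>i\<in>I. weight (\<xi> i) (X i t \<omega>)) \<partial>M) = 0"
    by (rule integral_eq_zero_AE)
  then show ?thesis using \<open>prob E = 0\<close> by simp
next
  case True
  have Em: "E \<in> events" unfolding E_def by (rule start_event[OF I(1)])
  define M' where "M' = uniform_measure M E"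
  have E0: "emeasure M E \<noteq> 0" "emeasure M E \<noteq> \<infinity>" using True by (simp_all add: emeasure_eq_measure)
  have ps: "prob_space M'" unfolding M'_def by (rule prob_space_uniform_measure[OF E0])
  interpret M': prob_space M' by (rule ps)
  have sp: "space M' = space M" "sets M' = sets M" by (simp_all add: M'_def)
  have iv: "M'.indep_vars (\<lambda>_. PiM {0..} (\<lambda>_. count_space UNIV)) (\<lambda>i \<omega>. \<lambda>t\<in>{0..}. X i t \<omega>) I"
    and mc: "\<And>i. i \<in> I \<Longrightarrow> markov_chain M' P (X i)"
    using indep I True unfolding independent_particles_def Let_def M'_def E_def by blast+
  have Xm: "X i s \<in> measurable M' (count_space UNIV)" if "0 \<le> s" for i s
    using X_measurable[OF that] measurable_cong_sets[OF sp(2) refl] by blast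
  \<comment> \<open>As 1 plus a finite combination of indicators, the factor has an expectation that
    involves only the probabilities of the finitely many sites in A.\<close>
  have w: "weight x y = 1 + (if x \<in> B then \<Sum>a\<in>A. (z a - 1) * indicator {a} y else 0)" for x y
  proof -
    have "(\<Sum>a\<in>A. (z a - 1) * indicator {a} y) = (\<Sum>a\<in>A. if a = y then z y - 1 else 0)"
      by (intro sum.cong) (auto simp: indicator_def)
    also have "\<dots> = (if y \<in> A then z y - 1 else 0)" using A by simp
    finally show ?thesis by (simp add: weight_def)
  qed
  \<comment> \<open>Markov property with s = 0 and T = {0}; its condition has probability 1 under
    M', since the start is part of E.\<close>
  have law: "M'.prob {\<omega>\<in>space M'. X i t \<omega> = a} = P t (\<xi> i) a" if i: "i \<in> I" for i a
  proof -
    let ?Q = "\<lambda>\<omega>. \<forall>u\<in>{0}. X i u \<omega> = \<xi> i"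
    have Q: "{\<omega>\<in>space M'. ?Q \<omega>} \<in> events" using X_sets[of 0 "\<lambda>x. x = \<xi> i" i] by (simp add: sp)
    have Y: "{\<omega>\<in>space M'. X i t \<omega> = a} \<in> events" using X_sets[OF t, of "\<lambda>x. x = a" i] by (simp add: sp)
    have YQ: "{\<omega>\<in>space M'. X i t \<omega> = a \<and> ?Q \<omega>} \<in> events"
      using sets.Int[OF Y Q] by (simp add: Int_def conj_ac)
    have pm: "M'.prob C = prob (E \<inter> C) / prob E" if "C \<in> events" for C
      unfolding M'_def by (rule measure_uniform_measure[OF E0 that])
    have "E \<inter> {\<omega>\<in>space M'. ?Q \<omega>} = E" using i by (auto simp: E_def sp)
    then have p1: "M'.prob {\<omega>\<in>space M'. ?Q \<omega>} = 1" using True pm[OF Q] by simp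
    have "E \<inter> {\<omega>\<in>space M'. X i t \<omega> = a \<and> ?Q \<omega>} = E \<inter> {\<omega>\<in>space M'. X i t \<omega> = a}" using i by (auto simp: E_def sp)
    then have p2: "M'.prob {\<omega>\<in>space M'. X i t \<omega> = a \<and> ?Q \<omega>} = M'.prob {\<omega>\<in>space M'. X i t \<omega> = a}"
      using pm[OF YQ] pm[OF Y] by simp
    have "\<P>(\<omega> in M'. X i (0 + t) \<omega> = a \<bar> ?Q \<omega>) = P t ((\<lambda>_. \<xi> i) 0) a"
    proof -
      have "\<forall>s\<ge>0. \<forall>h\<ge>0. \<forall>T z y. finite T \<and> T \<subseteq> {0..s} \<and> s \<in> T \<and> \<P>(\<omega> in M'. \<forall>u\<in>T. X i u \<omega> = z u) > 0 \<longrightarrow>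
          \<P>(\<omega> in M'. X i (s + h) \<omega> = y \<bar> \<forall>u\<in>T. X i u \<omega> = z u) = P h (z s) y"
        using mc[OF i] unfolding markov_chain_def by blast
      from this[rule_format, of 0 t "{0}" "\<lambda>_. \<xi> i" a] show ?thesis using t p1 by simp
    qed
    then show ?thesis using p1 p2 by (simp add: cond_prob_def)
  qed
  have one: "M'.expectation (\<lambda>\<omega>. weight (\<xi> i) (X i t \<omega>)) = mean_weight (\<xi> i)" if i: "i \<in> I" for i
  proof (cases "\<xi> i \<in> B")
    case True
    have set: "{\<omega>\<in>space M'. X i t \<omega> = a} \<in> M'.events" for a
      using X_sets[OF t, of "\<lambda>x. x = a" i] by (simp add: sp)
    have int: "integrable M' (\<lambda>\<omega>. (z a - 1) * indicator {a} (X i t \<omega>))"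
      and val: "M'.expectation (\<lambda>\<omega>. (z a - 1) * indicator {a} (X i t \<omega>)) = (z a - 1) * of_real (P t (\<xi> i) a)" for a
    proof -
      have eq: "(z a - 1) * indicator {a} (X i t \<omega>) = indicator {\<omega>\<in>space M'. X i t \<omega> = a} \<omega> *\<^sub>R (z a - 1)" if "\<omega> \<in> space M'" for \<omega>
        using that by (auto simp: indicator_def)
      show "integrable M' (\<lambda>\<omega>. (z a - 1) * indicator {a} (X i t \<omega>))"
        using M'.integral_indicator_scaleR(1)[OF set] Bochner_Integration.integrable_cong[OF refl eq] by (rule iffD2[rotated])
      have "M'.expectation (\<lambda>\<omega>. (z a - 1) * indicator {a} (X i t \<omega>)) =
          M'.expectation (\<lambda>\<omega>. indicator {\<omega>\<in>space M'. X i t \<omega> = a} \<omega> *\<^sub>R (z a - 1))"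
        by (rule Bochner_Integration.integral_cong[OF refl eq])
      also have "\<dots> = M'.prob {\<omega>\<in>space M'. X i t \<omega> = a} *\<^sub>R (z a - 1)"
        by (rule M'.integral_indicator_scaleR(2)[OF set])
      finally show "M'.expectation (\<lambda>\<omega>. (z a - 1) * indicator {a} (X i t \<omega>)) = (z a - 1) * of_real (P t (\<xi> i) a)"
        by (simp add: law[OF i] scaleR_conv_of_real mult.commute)
    qed
    have "M'.expectation (\<lambda>\<omega>. weight (\<xi> i) (X i t \<omega>)) = M'.expectation (\<lambda>\<omega>. 1 + (\<Sum>a\<in>A. (z a - 1) * indicator {a} (X i t \<omega>)))"
      using True by (simp add: w)
    also have "\<dots> = 1 + (\<Sum>a\<in>A. (z a - 1) * of_real (P t (\<xi> i) a))"
    proof -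
      have "M'.expectation (\<lambda>\<omega>. 1 + (\<Sum>a\<in>A. (z a - 1) * indicator {a} (X i t \<omega>)))
          = M'.expectation (\<lambda>_. 1) + M'.expectation (\<lambda>\<omega>. \<Sum>a\<in>A. (z a - 1) * indicator {a} (X i t \<omega>))"
        by (intro Bochner_Integration.integral_add Bochner_Integration.integrable_sum int) simp
      also have "M'.expectation (\<lambda>\<omega>. \<Sum>a\<in>A. (z a - 1) * indicator {a} (X i t \<omega>)) = (\<Sum>a\<in>A. (z a - 1) * of_real (P t (\<xi> i) a))"
        by (subst Bochner_Integration.integral_sum[OF int]) (simp only: val)
      finally show ?thesis by (simp add: M'.prob_space)
    qed
    also have "\<dots> = mean_weight (\<xi> i)"
      using True by (simp add: mean_weight_def mean_gf_def left_diff_distrib sum_subtractf mult.commute)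
    finally show ?thesis .
  qed (simp add: weight_def mean_weight_def M'.prob_space)
  have wm: "(\<lambda>\<omega>. weight (\<xi> i) (X i t \<omega>)) \<in> borel_measurable M'" for i
    by (rule measurable_compose[OF Xm[OF t]]) simp
  have wint: "integrable M' (\<lambda>\<omega>. weight (\<xi> i) (X i t \<omega>))" for i
  proof (rule M'.integrable_const_bound[OF _ wm])
    have "norm (weight x y) \<le> 1 + (\<Sum>a\<in>A. norm (z a))" for x y
    proof (cases "x \<in> B \<and> y \<in> A")
      case True
      then have "norm (z y) \<le> (\<Sum>a\<in>A. norm (z a))" using A by (intro member_le_sum) auto
      then show ?thesis using True by (simp add: weight_def)
    qed (auto simp: weight_def sum_nonneg)
    then show "AE \<omega> in M'. norm (weight (\<xi> i) (X i t \<omega>)) \<le> 1 + (\<Sum>a\<in>A. norm (z a))" by simp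
  qed
  have "M'.indep_vars (\<lambda>_. borel) (\<lambda>i \<omega>. (\<lambda>f. weight (\<xi> i) (f t)) (\<lambda>t\<in>{0..}. X i t \<omega>)) I"
  proof (rule M'.indep_vars_compose2[OF iv])
    fix i
    have "(\<lambda>f. f t) \<in> measurable (PiM {0..} (\<lambda>_. count_space UNIV)) (count_space (UNIV :: 's set))"
      using t by (intro measurable_component_singleton) simp
    then show "(\<lambda>f. weight (\<xi> i) (f t)) \<in> borel_measurable (PiM {0..} (\<lambda>_. count_space UNIV))"
      by (rule measurable_compose) simp
  qed
  then have iv': "M'.indep_vars (\<lambda>_. borel) (\<lambda>i \<omega>. weight (\<xi> i) (X i t \<omega>)) I" using t by simp
  have "(\<integral>\<omega>. indicator E \<omega> *\<^sub>R (\<Prod>i\<in>I. weight (\<xi> i) (X i t \<omega>)) \<partial>M) = prob E *\<^sub>R M'.expectation (\<lambda>\<omega>. \<Prod>i\<in>I. weight (\<xi> i) (X i t \<omega>))"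
    unfolding M'_def
  proof (rule integral_uniform_measure_eq[OF _ Em True])
    have "(\<lambda>\<omega>. weight (\<xi> i) (X i t \<omega>)) \<in> borel_measurable M" for i
      by (rule measurable_compose[OF X_measurable[OF t]]) simp
    then show "(\<lambda>\<omega>. \<Prod>i\<in>I. weight (\<xi> i) (X i t \<omega>)) \<in> borel_measurable M" by (intro borel_measurable_prod)
  qed (rule prob_space_axioms)
  also have "M'.expectation (\<lambda>\<omega>. \<Prod>i\<in>I. weight (\<xi> i) (X i t \<omega>)) = (\<Prod>i\<in>I. mean_weight (\<xi> i))"
    using M'.indep_vars_lebesgue_integral[OF I(1) iv' wint] one by simp
  finally show ?thesis .
qed

text \<open>Only indices below m enter, so that finitely many starting positions have to be
  conditioned on.\<close>

definition weight_prod :: "nat \<Rightarrow> 'w \<Rightarrow> complex" where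
  "weight_prod m \<omega> = (\<Prod>i<m. if enat i < N \<omega> then weight (X i 0 \<omega>) (X i t \<omega>) else 1)"

definition mean_weight_prod :: "nat \<Rightarrow> 'w \<Rightarrow> complex" where
  "mean_weight_prod m \<omega> = (\<Prod>i<m. if enat i < N \<omega> then mean_weight (X i 0 \<omega>) else 1)"

definition weight_bound :: real where
  "weight_bound = 1 + (\<Sum>a\<in>A. norm (z a))"

lemma weight_bound_ge_1: "weight_bound \<ge> 1"
  by (simp add: weight_bound_def sum_nonneg)

lemma norm_le_weight_bound: "a \<in> A \<Longrightarrow> norm (z a) \<le> weight_bound"
  unfolding weight_bound_def using A member_le_sum[of a A "\<lambda>a. norm (z a)"] by simp

lemma norm_weight: "norm (weight x y) \<le> (if x \<in> B then weight_bound else 1)"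
  using norm_le_weight_bound weight_bound_ge_1 by (simp add: weight_def)

text \<open>A convex combination of 1 and the values z a, all of norm at most
  \<open>weight_bound\<close>, because the row sum over A is at most 1.\<close>

lemma norm_mean_gf: "norm (mean_gf x) \<le> weight_bound"
proof -
  have p: "P t x y \<ge> 0" for y using P t unfolding transition_function_def by blast
  have s: "(P t x has_sum 1) UNIV" using P t unfolding transition_function_def by blast
  have "sum (P t x) A \<le> 1"
    by (rule has_sum_mono_neutral[OF has_sum_finite[OF A] s]) (auto simp: p)
  then have q: "0 \<le> 1 - sum (P t x) A" by simp
  have "norm (mean_gf x) \<le> norm (of_real (1 - sum (P t x) A) :: complex) + norm (\<Sum>a\<in>A. of_real (P t x a) * z a)"
    unfolding mean_gf_def by (rule norm_triangle_ineq)
  also have "norm (of_real (1 - sum (P t x) A) :: complex) = 1 - sum (P t x) A"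
    using q by (simp only: norm_of_real abs_of_nonneg)
  also have "norm (\<Sum>a\<in>A. of_real (P t x a) * z a) \<le> (\<Sum>a\<in>A. P t x a * weight_bound)"
    using p norm_le_weight_bound by (intro sum_norm_le) (simp add: norm_mult mult_left_mono)
  also have "(1 - sum (P t x) A) + (\<Sum>a\<in>A. P t x a * weight_bound)
      \<le> (1 - sum (P t x) A) * weight_bound + (\<Sum>a\<in>A. P t x a * weight_bound)"
    using mult_left_mono[OF weight_bound_ge_1 q] by simp
  also have "\<dots> = weight_bound" by (simp add: left_diff_distrib sum_distrib_right)
  finally show ?thesis by simp
qed

lemma norm_mean_weight: "norm (mean_weight x) \<le> (if x \<in> B then weight_bound else 1)"
  using norm_mean_gf by (simp add: mean_weight_def)

lemma weight_prod_measurable: "weight_prod m \<in> borel_measurable M"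
  unfolding weight_prod_def[abs_def]
proof (intro borel_measurable_prod measurable_If)
  fix i
  have "(\<lambda>\<omega>. weight x (X i t \<omega>)) \<in> borel_measurable M" for x
    by (rule measurable_compose[OF X_measurable[OF t]]) simp
  from measurable_compose_countable[OF this X_measurable[of 0 i]]
  show "(\<lambda>\<omega>. weight (X i 0 \<omega>) (X i t \<omega>)) \<in> borel_measurable M" by simp
  show "{\<omega>\<in>space M. enat i < N \<omega>} \<in> events" by (rule N_sets)
qed simp

lemma mean_weight_prod_measurable: "mean_weight_prod m \<in> borel_measurable M"
  unfolding mean_weight_prod_def[abs_def]
proof (intro borel_measurable_prod measurable_If)
  fix i
  show "(\<lambda>\<omega>. mean_weight (X i 0 \<omega>)) \<in> borel_measurable M"
    by (rule measurable_compose[OF X_measurable]) simp_all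
  show "{\<omega>\<in>space M. enat i < N \<omega>} \<in> events" by (rule N_sets)
qed simp

lemma norm_prod_le_started:
  assumes h: "\<And>i. norm (h i) \<le> (if X i 0 \<omega> \<in> B then weight_bound else 1)"
  shows "norm (\<Prod>i<m. if enat i < N \<omega> then h i else (1 :: complex)) \<le> weight_bound ^ card {i\<in>{..<m}. enat i < N \<omega> \<and> X i 0 \<omega> \<in> B}"
proof -
  have "norm (\<Prod>i<m. if enat i < N \<omega> then h i else 1) = (\<Prod>i<m. norm (if enat i < N \<omega> then h i else 1))"
    by (rule prod_norm[symmetric])
  also have "\<dots> \<le> (\<Prod>i<m. if enat i < N \<omega> \<and> X i 0 \<omega> \<in> B then weight_bound else 1)"
  proof (rule prod_mono)
    fix i
    show "0 \<le> norm (if enat i < N \<omega> then h i else 1) \<and>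
        norm (if enat i < N \<omega> then h i else 1) \<le> (if enat i < N \<omega> \<and> X i 0 \<omega> \<in> B then weight_bound else 1)"
      using h[of i] by (cases "X i 0 \<omega> \<in> B") auto
  qed
  also have "\<dots> = weight_bound ^ card {i\<in>{..<m}. enat i < N \<omega> \<and> X i 0 \<omega> \<in> B}"
    by (simp add: prod.inter_filter[symmetric])
  finally show ?thesis .
qed

lemma norm_weight_prod: "norm (weight_prod m \<omega>) \<le> weight_bound ^ card {i\<in>{..<m}. enat i < N \<omega> \<and> X i 0 \<omega> \<in> B}"
  unfolding weight_prod_def by (rule norm_prod_le_started[OF norm_weight])

lemma norm_mean_weight_prod: "norm (mean_weight_prod m \<omega>) \<le> weight_bound ^ card {i\<in>{..<m}. enat i < N \<omega> \<and> X i 0 \<omega> \<in> B}"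
  unfolding mean_weight_prod_def by (rule norm_prod_le_started[OF norm_mean_weight])

text \<open>The atoms are given by N and the starting positions of the existing particles below m.
  Missing particles are masked by \<open>None\<close>, because conditioning is allowed only on
  particles with index below N.\<close>

lemma expectation_weight_prod: "expectation (weight_prod m) = expectation (mean_weight_prod m)"
proof (rule integral_eq_by_values[where V = "\<lambda>\<omega>. (N \<omega>, map (\<lambda>i. if enat i < N \<omega> then Some (X i 0 \<omega>) else None) [0..<m])"])
  have c: "weight_bound ^ card {i\<in>{..<m}. enat i < N \<omega> \<and> X i 0 \<omega> \<in> B} \<le> weight_bound ^ m" for \<omega>
    using card_mono[of "{..<m}" "{i\<in>{..<m}. enat i < N \<omega> \<and> X i 0 \<omega> \<in> B}"]
    by (intro power_increasing weight_bound_ge_1) auto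
  show "integrable M (weight_prod m)"
    by (rule integrable_const_bound[OF _ weight_prod_measurable, of _ "weight_bound ^ m"])
      (use order_trans[OF norm_weight_prod c] in simp)
  show "integrable M (mean_weight_prod m)"
    by (rule integrable_const_bound[OF _ mean_weight_prod_measurable, of _ "weight_bound ^ m"])
      (use order_trans[OF norm_mean_weight_prod c] in simp)
  let ?V = "\<lambda>\<omega>. (N \<omega>, map (\<lambda>i. if enat i < N \<omega> then Some (X i 0 \<omega>) else None) [0..<m])"
  fix v
  have "{\<omega>\<in>space M. ?V \<omega> = v} \<in> events \<and>
    (\<integral>\<omega>. indicator {\<omega>\<in>space M. ?V \<omega> = v} \<omega> *\<^sub>R weight_prod m \<omega> \<partial>M) = (\<integral>\<omega>. indicator {\<omega>\<in>space M. ?V \<omega> = v} \<omega> *\<^sub>R mean_weight_prod m \<omega> \<partial>M)"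
  proof (cases "{\<omega>\<in>space M. ?V \<omega> = v} = {}")
    case True
    show ?thesis unfolding True by simp
  next
    case False
    then obtain \<omega>0 where \<omega>0: "?V \<omega>0 = v" by auto
    define n where "n = N \<omega>0"
    define \<xi> where "\<xi> i = X i 0 \<omega>0" for i
    define I where "I = {i\<in>{..<m}. enat i < n}"
    define E where "E = {\<omega>\<in>space M. N \<omega> = n \<and> (\<forall>i\<in>I. X i 0 \<omega> = \<xi> i)}"
    have I: "finite I" "\<And>i. i \<in> I \<Longrightarrow> enat i < n" by (auto simp: I_def)
    have VE: "{\<omega>\<in>space M. ?V \<omega> = v} = E"
      unfolding \<omega>0[symmetric] E_def by (auto simp: n_def \<xi>_def I_def list_eq_iff_nth_eq split: if_splits)
    have Em: "E \<in> events" unfolding E_def by (rule start_event[OF I(1)])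
    have fil: "(\<Prod>i<m. if enat i < n then h i else 1) = prod h I" for h :: "nat \<Rightarrow> complex"
      unfolding I_def by (subst prod.inter_filter) auto
    have w: "indicator E \<omega> *\<^sub>R weight_prod m \<omega> = indicator E \<omega> *\<^sub>R (\<Prod>i\<in>I. weight (\<xi> i) (X i t \<omega>))" for \<omega>
    proof (cases "\<omega> \<in> E")
      case True
      then have "weight_prod m \<omega> = (\<Prod>i\<in>I. weight (X i 0 \<omega>) (X i t \<omega>))" by (simp add: weight_prod_def E_def fil)
      also have "\<dots> = (\<Prod>i\<in>I. weight (\<xi> i) (X i t \<omega>))" using True by (intro prod.cong) (auto simp: E_def)
      finally show ?thesis by simp
    qed simp
    have mw: "indicator E \<omega> *\<^sub>R mean_weight_prod m \<omega> = indicator E \<omega> *\<^sub>R (\<Prod>i\<in>I. mean_weight (\<xi> i))" for \<omega>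
    proof (cases "\<omega> \<in> E")
      case True
      then have "mean_weight_prod m \<omega> = (\<Prod>i\<in>I. mean_weight (X i 0 \<omega>))" by (simp add: mean_weight_prod_def E_def fil)
      also have "\<dots> = (\<Prod>i\<in>I. mean_weight (\<xi> i))" using True by (intro prod.cong) (auto simp: E_def)
      finally show ?thesis by simp
    qed simp
    have "(\<integral>\<omega>. indicator E \<omega> *\<^sub>R (\<Prod>i\<in>I. mean_weight (\<xi> i)) \<partial>M) = prob E *\<^sub>R (\<Prod>i\<in>I. mean_weight (\<xi> i))"
      by (rule integral_indicator_scaleR(2)[OF Em])
    then show ?thesis unfolding VE w mw
      using Em expectation_product_given_start[OF I, where \<xi> = \<xi>, folded E_def] by simp
  qed
  then show "{\<omega>\<in>space M. ?V \<omega> = v} \<in> events"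
    and "(\<integral>\<omega>. indicator {\<omega>\<in>space M. ?V \<omega> = v} \<omega> *\<^sub>R weight_prod m \<omega> \<partial>M) = (\<integral>\<omega>. indicator {\<omega>\<in>space M. ?V \<omega> = v} \<omega> *\<^sub>R mean_weight_prod m \<omega> \<partial>M)"
    by blast+
qed

lemma started_finite: "AE \<omega> in M. finite {i. enat i < N \<omega> \<and> X i 0 \<omega> \<in> B}"
proof -
  have "AE \<omega> in M. \<forall>x\<in>B. finite (particles_at N X 0 \<omega> x)"
    using B fin[of 0] by (intro AE_finite_allI) auto
  then show ?thesis
  proof eventually_elim
    case (elim \<omega>)
    have "{i. enat i < N \<omega> \<and> X i 0 \<omega> \<in> B} = (\<Union>x\<in>B. particles_at N X 0 \<omega> x)" by (auto simp: particles_at_def)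
    then show ?case using elim B by simp
  qed
qed

text \<open>Let m tend to infinity. Almost surely both products become constant in m, and both are
  dominated by \<open>weight_bound\<close> to the number of particles started in B, which is
  integrable because the initial generating function on B converges everywhere.\<close>

lemma expectation_moved:
  assumes gf: "has_gf M B (occupation N X 0) f"
  shows "integrable M (\<lambda>\<omega>. \<Prod>a\<in>A. z a ^ moved B \<omega> a) \<and>
    f (restrict mean_gf B) = expectation (\<lambda>\<omega>. \<Prod>a\<in>A. z a ^ moved B \<omega> a)"
proof -
  let ?J = "\<lambda>\<omega>. {i. enat i < N \<omega> \<and> X i 0 \<omega> \<in> B}"
  let ?occ = "\<lambda>\<omega>. occupation N X 0 \<omega>"
  note gf' = gf[unfolded has_gf_expectation[where \<eta> = "occupation N X 0", OF B occupation_measurable[OF order_refl]], rule_format]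
  define D where "D \<omega> = (\<Prod>x\<in>B. weight_bound ^ ?occ \<omega> x)" for \<omega>
  have D: "integrable M D"
  proof -
    have "integrable M (\<lambda>\<omega>. \<Prod>x\<in>B. restrict (\<lambda>_. complex_of_real weight_bound) B x ^ ?occ \<omega> x)"
      using gf'[of "restrict (\<lambda>_. complex_of_real weight_bound) B"] by simp
    moreover have "(\<Prod>x\<in>B. restrict (\<lambda>_. complex_of_real weight_bound) B x ^ ?occ \<omega> x) = of_real (D \<omega>)" for \<omega>
      by (simp add: D_def)
    ultimately have "integrable M (\<lambda>\<omega>. complex_of_real (D \<omega>))" by simp
    from integrable_Re[OF this] show ?thesis by simp
  qed
  have fJ: "weight_bound ^ card (?J \<omega>) = D \<omega>" if "finite (?J \<omega>)" for \<omega>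
  proof -
    have "weight_bound ^ card (?J \<omega>) = (\<Prod>i\<in>?J \<omega>. if X i 0 \<omega> \<in> B then weight_bound else 1)" by simp
    also have "\<dots> = (\<Prod>x\<in>B. weight_bound ^ card {i\<in>?J \<omega>. X i 0 \<omega> = x})"
      by (rule prod_group_card[OF that B])
    also have "\<dots> = D \<omega>" unfolding D_def occupation_def particles_at_def
      by (intro prod.cong refl arg_cong[where f = "\<lambda>k. weight_bound ^ card k"]) auto
    finally show ?thesis .
  qed
  have dom: "norm (\<Prod>i<m. if enat i < N \<omega> then h i else (1 :: complex)) \<le> D \<omega>"
    if "finite (?J \<omega>)" "\<And>i. norm (h i) \<le> (if X i 0 \<omega> \<in> B then weight_bound else 1)" for m \<omega> h
  proof -
    have "card {i\<in>{..<m}. enat i < N \<omega> \<and> X i 0 \<omega> \<in> B} \<le> card (?J \<omega>)"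
      using that(1) by (intro card_mono) auto
    then have "weight_bound ^ card {i\<in>{..<m}. enat i < N \<omega> \<and> X i 0 \<omega> \<in> B} \<le> D \<omega>"
      unfolding fJ[OF that(1), symmetric] by (intro power_increasing weight_bound_ge_1)
    then show ?thesis using norm_prod_le_started[OF that(2), of m] by linarith
  qed
  have lim: "(\<lambda>m. \<Prod>i<m. if enat i < N \<omega> then h i else (1 :: complex)) \<longlonglongrightarrow> (\<Prod>i\<in>?J \<omega>. h i)"
    if J: "finite (?J \<omega>)" and h: "\<And>i. X i 0 \<omega> \<notin> B \<Longrightarrow> h i = 1" for \<omega> h
  proof (rule tendsto_eventually)
    obtain m0 where m0: "?J \<omega> \<subseteq> {..<m0}" using finite_nat_iff_bounded[THEN iffD1, OF J] by blast
    show "\<forall>\<^sub>F m in sequentially. (\<Prod>i<m. if enat i < N \<omega> then h i else 1) = (\<Prod>i\<in>?J \<omega>. h i)"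
      using eventually_ge_at_top[of m0]
    proof eventually_elim
      case (elim m)
      have "(\<Prod>i\<in>?J \<omega>. h i) = (\<Prod>i\<in>?J \<omega>. if enat i < N \<omega> then h i else 1)" by (intro prod.cong) auto
      also have "\<dots> = (\<Prod>i<m. if enat i < N \<omega> then h i else 1)"
        using m0 elim h by (intro prod.mono_neutral_left) auto
      finally show ?case by simp
    qed
  qed
  define G where "G \<omega> = (\<Prod>a\<in>A. z a ^ moved B \<omega> a)" for \<omega>
  define H where "H \<omega> = (\<Prod>x\<in>B. mean_gf x ^ ?occ \<omega> x)" for \<omega>
  have limG: "(\<lambda>m. weight_prod m \<omega>) \<longlonglongrightarrow> G \<omega>" if J: "finite (?J \<omega>)" for \<omega>
  proof -
    have "(\<lambda>m. weight_prod m \<omega>) \<longlonglongrightarrow> (\<Prod>i\<in>?J \<omega>. weight (X i 0 \<omega>) (X i t \<omega>))"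
      unfolding weight_prod_def by (rule lim[OF J]) (simp add: weight_def)
    also have "(\<Prod>i\<in>?J \<omega>. weight (X i 0 \<omega>) (X i t \<omega>)) = (\<Prod>i\<in>?J \<omega>. if X i t \<omega> \<in> A then z (X i t \<omega>) else 1)"
      by (intro prod.cong) (auto simp: weight_def)
    also have "\<dots> = (\<Prod>a\<in>A. z a ^ card {i\<in>?J \<omega>. X i t \<omega> = a})" by (rule prod_group_card[OF J A])
    also have "\<dots> = G \<omega>" by (simp add: G_def moved_def conj_assoc)
    finally show ?thesis .
  qed
  have limH: "(\<lambda>m. mean_weight_prod m \<omega>) \<longlonglongrightarrow> H \<omega>" if J: "finite (?J \<omega>)" for \<omega>
  proof -
    have "(\<lambda>m. mean_weight_prod m \<omega>) \<longlonglongrightarrow> (\<Prod>i\<in>?J \<omega>. mean_weight (X i 0 \<omega>))"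
      unfolding mean_weight_prod_def by (rule lim[OF J]) (simp add: mean_weight_def)
    also have "(\<Prod>i\<in>?J \<omega>. mean_weight (X i 0 \<omega>)) = (\<Prod>i\<in>?J \<omega>. if X i 0 \<omega> \<in> B then mean_gf (X i 0 \<omega>) else 1)"
      by (simp add: mean_weight_def)
    also have "\<dots> = (\<Prod>x\<in>B. mean_gf x ^ card {i\<in>?J \<omega>. X i 0 \<omega> = x})" by (rule prod_group_card[OF J B])
    also have "\<dots> = H \<omega>" unfolding H_def occupation_def particles_at_def
      by (intro prod.cong refl arg_cong[where f = "\<lambda>k. _ ^ card k"]) auto
    finally show ?thesis .
  qed
  have Gm: "G \<in> borel_measurable M" unfolding G_def[abs_def]
    by (intro borel_measurable_prod measurable_compose[OF moved_measurable]) simp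
  have Hm: "H \<in> borel_measurable M" unfolding H_def[abs_def]
    by (intro borel_measurable_prod measurable_compose[OF occupation_measurable[OF order_refl]]) simp
  have aeG: "AE \<omega> in M. (\<lambda>m. weight_prod m \<omega>) \<longlonglongrightarrow> G \<omega>" "AE \<omega> in M. norm (weight_prod m \<omega>) \<le> D \<omega>" for m
    using started_finite by (eventually_elim; use limG dom[OF _ norm_weight] in \<open>simp add: weight_prod_def\<close>)+
  have aeH: "AE \<omega> in M. (\<lambda>m. mean_weight_prod m \<omega>) \<longlonglongrightarrow> H \<omega>" "AE \<omega> in M. norm (mean_weight_prod m \<omega>) \<le> D \<omega>" for m
    using started_finite by (eventually_elim; use limH dom[OF _ norm_mean_weight] in \<open>simp add: mean_weight_prod_def\<close>)+
  have "(\<lambda>m. expectation (weight_prod m)) \<longlonglongrightarrow> expectation G"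
    by (rule integral_dominated_convergence[OF Gm weight_prod_measurable D aeG])
  moreover have "(\<lambda>m. expectation (mean_weight_prod m)) \<longlonglongrightarrow> expectation H"
    by (rule integral_dominated_convergence[OF Hm mean_weight_prod_measurable D aeH])
  ultimately have "expectation G = expectation H"
    unfolding expectation_weight_prod by (rule LIMSEQ_unique)
  moreover have "integrable M G"
    by (rule integrable_dominated_convergence[OF Gm weight_prod_measurable D aeG])
  moreover have "f (restrict mean_gf B) = expectation H"
    using gf'[of "restrict mean_gf B"] by (simp add: H_def[abs_def])
  ultimately show ?thesis by (simp add: G_def[abs_def])
qed

end

lemma moved_gf:
  assumes A: "finite A" and B: "finite B" and f: "t_stable_function B f" and gf: "has_gf M B (occupation N X 0) f"
  shows "\<exists>g. t_stable_function A g \<and> has_gf M A (moved B) g"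
proof (intro exI conjI)
  let ?g = "\<lambda>z. f (\<lambda>x\<in>B. of_real (1 - (\<Sum>a\<in>A. P t x a)) + (\<Sum>a\<in>A. of_real (P t x a) * z a))"
  have p: "P t x y \<ge> 0" for x y using P t unfolding transition_function_def by blast
  show "t_stable_function A ?g" by (rule t_stable_function_affine[OF A B f p])
  show "has_gf M A (moved B) ?g"
    unfolding has_gf_expectation[where \<eta> = "moved B", OF A moved_measurable]
  proof
    fix z :: "'s \<Rightarrow> complex"
    have "restrict (mean_gf A z) B = (\<lambda>x\<in>B. of_real (1 - (\<Sum>a\<in>A. P t x a)) + (\<Sum>a\<in>A. of_real (P t x a) * z a))"
      by (rule restrict_ext) (simp add: mean_gf_def[OF A B])
    then show "integrable M (\<lambda>\<omega>. \<Prod>a\<in>A. z a ^ moved B \<omega> a) \<and> ?g z = expectation (\<lambda>\<omega>. \<Prod>a\<in>A. z a ^ moved B \<omega> a)"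
      using expectation_moved[OF A B gf, of z] by simp
  qed
qed

end

section \<open>From finite starting sets to all particles\<close>

context particles
begin

lemma moved_le_occupation:
  assumes "finite (particles_at N X t \<omega> a)" shows "moved B \<omega> a \<le> occupation N X t \<omega> a"
  unfolding moved_def occupation_def by (rule card_mono[OF assms]) (auto simp: particles_at_def)

text \<open>The finitely many particles at a have finitely many starting sites, whose indices are
  bounded.\<close>

lemma eventually_moved_eq_occupation:
  assumes "finite (particles_at N X t \<omega> a)"
  shows "\<forall>\<^sub>F n in sequentially. moved {x. to_nat x < n} \<omega> a = occupation N X t \<omega> a"
proof -
  define m where "m = Max (insert 0 ((\<lambda>i. to_nat (X i 0 \<omega>)) ` particles_at N X t \<omega> a))"
  have m: "to_nat (X i 0 \<omega>) \<le> m" if "i \<in> particles_at N X t \<omega> a" for i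
    unfolding m_def using assms that by (intro Max_ge) auto
  show ?thesis using eventually_gt_at_top[of m]
  proof eventually_elim
    case (elim n)
    have "to_nat (X i 0 \<omega>) < n" if "i \<in> particles_at N X t \<omega> a" for i using m[OF that] elim by simp
    then have "{i. enat i < N \<omega> \<and> X i 0 \<omega> \<in> {x. to_nat x < n} \<and> X i t \<omega> = a} = particles_at N X t \<omega> a"
      by (auto simp: particles_at_def)
    then show ?case by (simp add: moved_def occupation_def)
  qed
qed

text \<open>
  Exponential moments of the number of particles in \<open>A\<close> are bounded uniformly in the starting set,
  because the three point inequality bounds them by negative exponential moments, and those
  decrease to a positive limit.
\<close>

lemma occupation_exponential_moment:
  assumes A: "finite A" and R: "R \<ge> 1"
    and f: "\<And>n. t_stable_function A (f n)" and gf: "\<And>n. has_gf M A (moved {x. to_nat x < n}) (f n)"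
  shows "integrable M (\<lambda>\<omega>. \<Prod>a\<in>A. (R :: real) ^ occupation N X t \<omega> a)"
proof -
  let ?mv = "\<lambda>n. moved {x :: 's. to_nat x < n}"
  let ?oc = "occupation N X t"
  define V where "V r \<zeta> \<omega> = (\<Prod>a\<in>A. (r :: real) ^ \<zeta> \<omega> a)" for r and \<zeta> :: "'w \<Rightarrow> 's \<Rightarrow> nat" and \<omega>
  have fin': "AE \<omega> in M. \<forall>a\<in>A. finite (particles_at N X t \<omega> a)"
    using A fin[OF t] by (intro AE_finite_allI) auto
  have Vm: "V r (?mv n) \<in> borel_measurable M" "V r ?oc \<in> borel_measurable M" for r n
    unfolding V_def[abs_def]
    by (intro borel_measurable_prod measurable_compose[OF moved_measurable] measurable_compose[OF occupation_measurable[OF t]]; simp)+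
  have three: "integrable M (V r (?mv n))" "expectation (V (1 + real m / 2) (?mv n)) * expectation (V (1 / 2) (?mv n)) ^ m \<le> 1" for r n m
    using three_point_moment_bound[where \<eta> = "?mv n", OF A moved_measurable f gf] unfolding V_def[abs_def] by blast+
  define \<delta> where "\<delta> = expectation (V (1 / 2) ?oc)"
  have half: "0 < V (1 / 2) \<zeta> \<omega>" "V (1 / 2) \<zeta> \<omega> \<le> 1" for \<zeta> \<omega>
    unfolding V_def by (auto intro!: prod_pos prod_le_1 power_le_one)
  have int_half: "integrable M (V (1 / 2) ?oc)"
    by (rule integrable_const_bound[OF _ Vm(2), of _ 1]) (use half in \<open>simp add: less_imp_le\<close>)
  \<comment> \<open>The integrand, a power of 1/2 with a finite exponent, is positive at every
    outcome.\<close>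
  have "\<delta> > 0"
  proof -
    have "\<delta> \<ge> 0" unfolding \<delta>_def using half by (intro integral_nonneg_AE) (auto intro: less_imp_le)
    moreover have "\<delta> \<noteq> 0"
    proof
      assume "\<delta> = 0"
      then have "AE \<omega> in M. V (1 / 2) ?oc \<omega> = 0"
        unfolding \<delta>_def using integral_nonneg_eq_0_iff_AE[OF int_half] half by (simp add: less_imp_le)
      then have "AE \<omega> in M. False" by eventually_elim (metis half(1) less_irrefl)
      then show False by simp
    qed
    ultimately show ?thesis by simp
  qed
  \<comment> \<open>Counting fewer particles gives a larger power of 1/2, so \<delta> is a lower
    bound for all n.\<close>
  have mono: "\<delta> \<le> expectation (V (1 / 2) (?mv n))" for n
    unfolding \<delta>_def
  proof (rule integral_mono_AE[OF int_half three(1)])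
    show "AE \<omega> in M. V (1 / 2) ?oc \<omega> \<le> V (1 / 2) (?mv n) \<omega>"
      using fin'
    proof eventually_elim
      case (elim \<omega>)
      then show ?case unfolding V_def
        by (intro prod_mono conjI power_decreasing moved_le_occupation) auto
    qed
  qed
  \<comment> \<open>m makes the outer point 1 + m/2 of the three point inequality reach R.\<close>
  obtain m where m: "R \<le> 1 + real m / 2"
    using real_arch_simple[of "2 * (R - 1)"] by (auto simp: field_simps)
  let ?R = "1 + real m / 2"
  have bound: "expectation (V ?R (?mv n)) \<le> inverse (\<delta> ^ m)" for n
  proof -
    have nn: "0 \<le> expectation (V ?R (?mv n))" unfolding V_def by (intro integral_nonneg_AE) (auto intro!: prod_nonneg)
    have "\<delta> ^ m \<le> expectation (V (1 / 2) (?mv n)) ^ m" using mono[of n] \<open>\<delta> > 0\<close> by (intro power_mono) auto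
    then have "expectation (V ?R (?mv n)) * \<delta> ^ m \<le> 1" using three(2)[of m n] mult_left_mono[OF _ nn] by (blast intro: order_trans)
    then show ?thesis using \<open>\<delta> > 0\<close> by (simp add: inverse_eq_divide pos_le_divide_eq)
  qed
  \<comment> \<open>Fatou's lemma carries the bound, uniform in n, over to the full occupation
    numbers.\<close>
  have "(\<integral>\<^sup>+\<omega>. ennreal (V ?R ?oc \<omega>) \<partial>M) = (\<integral>\<^sup>+\<omega>. liminf (\<lambda>n. ennreal (V ?R (?mv n) \<omega>)) \<partial>M)"
  proof (rule nn_integral_cong_AE)
    show "AE \<omega> in M. ennreal (V ?R ?oc \<omega>) = liminf (\<lambda>n. ennreal (V ?R (?mv n) \<omega>))"
      using fin'
    proof eventually_elim
      case (elim \<omega>)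
      have "\<forall>\<^sub>F n in sequentially. \<forall>a\<in>A. ?mv n \<omega> a = ?oc \<omega> a"
        using A elim by (intro eventually_ball_finite) (auto intro: eventually_moved_eq_occupation)
      then have "\<forall>\<^sub>F n in sequentially. ennreal (V ?R (?mv n) \<omega>) = ennreal (V ?R ?oc \<omega>)"
        by eventually_elim (simp add: V_def)
      then have "(\<lambda>n. ennreal (V ?R (?mv n) \<omega>)) \<longlonglongrightarrow> ennreal (V ?R ?oc \<omega>)" by (rule tendsto_eventually)
      then show ?case by (simp add: lim_imp_Liminf)
    qed
  qed
  also have "\<dots> \<le> liminf (\<lambda>n. \<integral>\<^sup>+\<omega>. ennreal (V ?R (?mv n) \<omega>) \<partial>M)"
    using Vm by (intro nn_integral_liminf) auto
  also have "\<dots> \<le> liminf (\<lambda>n. ennreal (inverse (\<delta> ^ m)))"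
  proof (intro Liminf_mono always_eventually allI)
    fix n
    have "(\<integral>\<^sup>+\<omega>. ennreal (V ?R (?mv n) \<omega>) \<partial>M) = ennreal (expectation (V ?R (?mv n)))"
      by (rule nn_integral_eq_integral[OF three(1)]) (auto simp: V_def intro!: prod_nonneg)
    also have "\<dots> \<le> ennreal (inverse (\<delta> ^ m))" using bound[of n] by (rule ennreal_leI)
    finally show "(\<integral>\<^sup>+\<omega>. ennreal (V ?R (?mv n) \<omega>) \<partial>M) \<le> ennreal (inverse (\<delta> ^ m))" .
  qed
  also have "\<dots> < \<infinity>" by (simp add: Liminf_const)
  finally have "(\<integral>\<^sup>+\<omega>. ennreal (V ?R ?oc \<omega>) \<partial>M) < \<infinity>" .
  then have "integrable M (V ?R ?oc)"
    using Vm(2) by (intro integrableI_bounded) (auto simp: V_def prod_nonneg)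
  then have "integrable M (V R ?oc)"
  proof (rule Bochner_Integration.integrable_bound[OF _ Vm(2)])
    have "norm (V R ?oc \<omega>) \<le> norm (V ?R ?oc \<omega>)" for \<omega>
    proof -
      have "V R ?oc \<omega> \<le> V ?R ?oc \<omega>" unfolding V_def using R m by (intro prod_mono conjI power_mono) auto
      moreover have "0 \<le> V R ?oc \<omega>" unfolding V_def using R by (intro prod_nonneg) auto
      ultimately show ?thesis by simp
    qed
    then show "AE \<omega> in M. norm (V R ?oc \<omega>) \<le> norm (V ?R ?oc \<omega>)" by simp
  qed
  then show ?thesis by (simp add: V_def[abs_def])
qed

text \<open>On a polydisc of radius R \<ge> 1 the integrands for the n-th starting set and for all
  particles differ only where the two configurations disagree on A, and then by at most 2 R^Y.
  Almost every outcome stops disagreeing for large n, and R^Y is integrable, so the difference of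
  the generating functions tends to 0 uniformly.\<close>

lemma occupation_t_stable:
  assumes A: "finite A" and ts0: "\<And>B. finite B \<Longrightarrow> \<exists>f. t_stable_function B f \<and> has_gf M B (occupation N X 0) f"
  shows "\<exists>g. t_stable_function A g \<and> has_gf M A (occupation N X t) g"
proof -
  let ?mv = "\<lambda>n. moved {x :: 's. to_nat x < n}"
  let ?oc = "occupation N X t"
  have "\<exists>g. t_stable_function A g \<and> has_gf M A (?mv n) g" for n
    using ts0[OF finite_to_nat_less[of n]] moved_gf[OF A finite_to_nat_less[of n]] by blast
  then obtain f where f: "\<And>n. t_stable_function A (f n)" and gf: "\<And>n. has_gf M A (?mv n) (f n)" by metis
  note exp = occupation_exponential_moment[OF A _ f gf]
  have fin': "AE \<omega> in M. \<forall>a\<in>A. finite (particles_at N X t \<omega> a)"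
    using A fin[OF t] by (intro AE_finite_allI) auto
  define U where "U z \<zeta> = (\<Prod>a\<in>A. z a ^ \<zeta> a)" for z :: "'s \<Rightarrow> complex" and \<zeta> :: "'s \<Rightarrow> nat"
  have Um: "(\<lambda>\<omega>. U z (?mv n \<omega>)) \<in> borel_measurable M" "(\<lambda>\<omega>. U z (?oc \<omega>)) \<in> borel_measurable M" for z n
    unfolding U_def
    by (intro borel_measurable_prod measurable_compose[OF moved_measurable] measurable_compose[OF occupation_measurable[OF t]]; simp)+
  have Ub: "norm (U z \<zeta>) \<le> (\<Prod>a\<in>A. R ^ \<zeta> a)" if "\<And>a. a \<in> A \<Longrightarrow> norm (z a) \<le> R" for z \<zeta> R
    unfolding U_def prod_norm[symmetric] norm_power using that by (intro prod_mono conjI power_mono) auto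
  have Uint: "integrable M (\<lambda>\<omega>. U z (?oc \<omega>))" for z
  proof -
    let ?R = "1 + (\<Sum>a\<in>A. norm (z a))"
    have "norm (z a) \<le> ?R" if "a \<in> A" for a using A member_le_sum[of a A "\<lambda>a. norm (z a)"] that by simp
    from Ub[of z ?R, OF this] have "norm (U z \<zeta>) \<le> (\<Prod>a\<in>A. ?R ^ \<zeta> a)" for \<zeta> .
    then have "norm (U z \<zeta>) \<le> norm (\<Prod>a\<in>A. ?R ^ \<zeta> a)" for \<zeta> unfolding real_norm_def by (rule order_trans[OF _ abs_ge_self])
    then show ?thesis
      by (intro Bochner_Integration.integrable_bound[OF exp[of ?R] Um(2)]) (simp_all add: sum_nonneg)
  qed
  define g where "g z = expectation (\<lambda>\<omega>. U z (?oc \<omega>))" for z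
  have fU: "f n z = expectation (\<lambda>\<omega>. U z (?mv n \<omega>))" "integrable M (\<lambda>\<omega>. U z (?mv n \<omega>))" if "z \<in> A \<rightarrow>\<^sub>E UNIV" for n z
    using gf[of n] that unfolding has_gf_expectation[where \<eta> = "?mv n", OF A moved_measurable] U_def by blast+
  have "uniform_limit (A \<rightarrow>\<^sub>E cball 0 R0) f g sequentially" for R0
  proof -
    define R where "R = max 1 R0"
    define W where "W \<zeta> = (\<Prod>a\<in>A. R ^ \<zeta> a)" for \<zeta> :: "'s \<Rightarrow> nat"
    have Wint: "integrable M (\<lambda>\<omega>. W (?oc \<omega>))" unfolding W_def by (rule exp) (simp add: R_def)
    have W0: "0 \<le> W \<zeta>" for \<zeta> unfolding W_def R_def by (intro prod_nonneg) auto
    let ?eq = "\<lambda>n \<omega>. \<forall>a\<in>A. ?mv n \<omega> a = ?oc \<omega> a"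
    define h where "h n \<omega> = (if ?eq n \<omega> then 0 else 2 * W (?oc \<omega>))" for n \<omega>
    have hm: "h n \<in> borel_measurable M" for n
      unfolding h_def[abs_def]
    proof (rule measurable_If)
      have "{\<omega>\<in>space M. ?mv n \<omega> a = ?oc \<omega> a} \<in> events" for a
      proof -
        have "{\<omega>\<in>space M. ?mv n \<omega> a = ?oc \<omega> a} = (\<Union>k. ((\<lambda>\<omega>. ?mv n \<omega> a) -` {k} \<inter> space M) \<inter> ((\<lambda>\<omega>. ?oc \<omega> a) -` {k} \<inter> space M))"
          by auto
        also have "\<dots> \<in> events"
        proof (rule sets.countable_UN'[OF countableI_type], safe)
          show "((\<lambda>\<omega>. ?mv n \<omega> a) -` {k} \<inter> space M) \<inter> ((\<lambda>\<omega>. ?oc \<omega> a) -` {k} \<inter> space M) \<in> events" for k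
            by (rule sets.Int; rule measurable_sets[OF moved_measurable] measurable_sets[OF occupation_measurable[OF t]]; simp)
        qed
        finally show ?thesis .
      qed
      then show "{\<omega>\<in>space M. ?eq n \<omega>} \<in> events" using A by (intro sets.sets_Collect_finite_All) auto
      show "(\<lambda>\<omega>. 2 * W (?oc \<omega>)) \<in> borel_measurable M" using Wint by simp
    qed simp
    have "(\<lambda>n. expectation (h n)) \<longlonglongrightarrow> expectation (\<lambda>_. 0)"
    proof (rule integral_dominated_convergence[where w = "\<lambda>\<omega>. 2 * W (?oc \<omega>)"])
      show "integrable M (\<lambda>\<omega>. 2 * W (?oc \<omega>))" using Wint by simp
      show "AE \<omega> in M. (\<lambda>n. h n \<omega>) \<longlonglongrightarrow> 0"
        using fin'
      proof eventually_elim
        case (elim \<omega>)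
        have "\<forall>\<^sub>F n in sequentially. ?eq n \<omega>"
          using A elim by (intro eventually_ball_finite) (auto intro: eventually_moved_eq_occupation)
        then have "\<forall>\<^sub>F n in sequentially. h n \<omega> = 0" by eventually_elim (simp add: h_def)
        then show ?case by (rule tendsto_eventually)
      qed
      show "AE \<omega> in M. norm (h n \<omega>) \<le> 2 * W (?oc \<omega>)" for n using W0 by (simp add: h_def)
    qed (use hm in simp_all)
    then have hlim: "(\<lambda>n. expectation (h n)) \<longlonglongrightarrow> 0" by simp
    have hint: "integrable M (h n)" for n
    proof (rule Bochner_Integration.integrable_bound[OF _ hm])
      show "integrable M (\<lambda>\<omega>. 2 * W (?oc \<omega>))" using Wint by simp
      show "AE \<omega> in M. norm (h n \<omega>) \<le> norm (2 * W (?oc \<omega>))" using W0 by (simp add: h_def)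
    qed
    have le: "dist (f n z) (g z) \<le> expectation (h n)" if z: "z \<in> A \<rightarrow>\<^sub>E cball 0 R0" for n z
    proof -
      have z': "z \<in> A \<rightarrow>\<^sub>E UNIV" and zR: "\<And>a. a \<in> A \<Longrightarrow> norm (z a) \<le> R"
        using z by (auto simp: PiE_iff R_def le_max_iff_disj)
      have "f n z - g z = expectation (\<lambda>\<omega>. U z (?mv n \<omega>) - U z (?oc \<omega>))"
        unfolding fU(1)[OF z'] g_def by (rule Bochner_Integration.integral_diff[OF fU(2)[OF z'] Uint, symmetric])
      then have "dist (f n z) (g z) \<le> expectation (\<lambda>\<omega>. norm (U z (?mv n \<omega>) - U z (?oc \<omega>)))"
        unfolding dist_norm by (simp only:) (rule integral_norm_bound)
      also have "\<dots> \<le> expectation (h n)"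
      proof (rule integral_mono_AE)
        show "integrable M (\<lambda>\<omega>. norm (U z (?mv n \<omega>) - U z (?oc \<omega>)))" using fU(2)[OF z'] Uint by simp
        show "AE \<omega> in M. norm (U z (?mv n \<omega>) - U z (?oc \<omega>)) \<le> h n \<omega>"
          using fin'
        proof eventually_elim
          case (elim \<omega>)
          show ?case
          proof (cases "?eq n \<omega>")
            case True
            then show ?thesis by (simp add: h_def U_def)
          next
            case False
            have "W (?mv n \<omega>) \<le> W (?oc \<omega>)" unfolding W_def
              using elim by (intro prod_mono conjI power_increasing moved_le_occupation) (auto simp: R_def)
            moreover have "norm (U z \<zeta>) \<le> W \<zeta>" for \<zeta> unfolding W_def by (rule Ub[OF zR])
            from this[of "?mv n \<omega>"] this[of "?oc \<omega>"]
            have "norm (U z (?mv n \<omega>)) + norm (U z (?oc \<omega>)) \<le> W (?mv n \<omega>) + W (?oc \<omega>)" by (rule add_mono)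
            ultimately have "norm (U z (?mv n \<omega>)) + norm (U z (?oc \<omega>)) \<le> 2 * W (?oc \<omega>)" by linarith
            then show ?thesis using False norm_triangle_ineq4[of "U z (?mv n \<omega>)" "U z (?oc \<omega>)"]
              unfolding h_def by (simp only: if_False)
          qed
        qed
      qed (rule hint)
      finally show ?thesis .
    qed
    show ?thesis
    proof (rule uniform_limitI)
      fix e :: real assume "e > 0"
      with hlim have "\<forall>\<^sub>F n in sequentially. expectation (h n) < e" by (rule order_tendstoD)
      then show "\<forall>\<^sub>F n in sequentially. \<forall>z\<in>A \<rightarrow>\<^sub>E cball 0 R0. dist (f n z) (g z) < e"
        by eventually_elim (use le in \<open>auto intro: le_less_trans\<close>)
    qed
  qed
  then have "t_stable_function A g" by (rule t_stable_function_limit[OF A f])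
  moreover have "has_gf M A ?oc g"
    unfolding has_gf_expectation[where \<eta> = ?oc, OF A occupation_measurable[OF t]]
    using Uint by (simp add: g_def U_def)
  ultimately show ?thesis by blast
qed

end

theorem proposition3p11:
  fixes M :: "'w measure"
    and q :: "'s::countable \<Rightarrow> 's \<Rightarrow> real"
    and P :: "real \<Rightarrow> 's \<Rightarrow> 's \<Rightarrow> real"
    and N :: "'w \<Rightarrow> enat"
    and X :: "nat \<Rightarrow> real \<Rightarrow> 'w \<Rightarrow> 's"
  assumes "prob_space M"
    and "jump_rates q"
    and "transition_function P"
    and "has_jump_rates P q"
    and "independent_particles M P N X"
    and "\<And>t x. 0 \<le> t \<Longrightarrow> AE \<omega> in M. finite (particles_at N X t \<omega> x)"
  shows "(t_stable_measure (distr M borel (occupation N X 0)) \<longrightarrow>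
            (\<forall>t\<ge>0. t_stable_measure (distr M borel (occupation N X t)))) \<and>
         (t_stable_measure (distr M borel (occupation N X 0)) \<longrightarrow>
            (\<forall>t\<ge>0. negatively_associated (distr M borel (occupation N X t))))"
proof -
  have "t_stable_measure (distr M borel (occupation N X t))"
    if ts: "t_stable_measure (distr M borel (occupation N X 0))" and t: "0 \<le> t" for t
  proof -
    interpret prob_space M by fact
    interpret particles M P N X t by unfold_locales (use assms t in auto)
    note mb = occupation_measurable_borel
    have "\<exists>f. t_stable_function B f \<and> has_gf M B (occupation N X 0) f" if "finite B" for B
      using ts that t_stable_finite_measure_distr[OF that mb[OF order_refl]] unfolding t_stable_measure_def by blast
    from occupation_t_stable[OF _ this]
    have "t_stable_finite_measure A (distr (distr M borel (occupation N X t)) (PiM A (\<lambda>_. count_space UNIV)) (\<lambda>\<eta>. restrict \<eta> A))"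
      if "finite A" for A
      using that t_stable_finite_measure_distr[OF that mb[OF t]] by blast
    then show ?thesis
      unfolding t_stable_measure_def using prob_space_distr[OF mb[OF t]] by simp
  qed
  then show ?thesis using t_stable_measure_negatively_associated by blast
qed

end
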